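(* There is a constant $d>1$ and a deterministic algorithm such that, for every $k\leq n/4$, given a comparator circuit $C$ on $n$ variables with at most \[ \frac{n^{1.5}}{d\cdot k\cdot\sqrt{\log n}} \] gates, the algorithm outputs the number of satisfying assignments of $C$ (i.e., $|\{x\in\{0,1\}^n : C(x)=1\}|$) in time $2^{n-k}\cdot\mathrm{poly}(n)$.
   Context: A comparator circuit on $n$ variables consists of a set of wires, each labelled by an input literal ($x_i$ or $\neg x_i$), a sequence of gates, each of which is an ordered pair of distinct wires $(w_i,w_j)$, and a designated output wire. On input $a\in\{0,1\}^n$, each wire is initialised with the value of its literal on $a$, and the gates are applied in order: a gate $(w_i,w_j)$ replaces the current values $(u,v)$ of $(w_i,w_j)$ by $(u\wedge v,\,u\vee v)$. The final value of the output wire is $C(a)$. The size is the number of gates. Logarithms are base 2. *)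

theory Defs
  imports Complex_Main "HOL-Library.Log_Nat" "HOL-Computational_Algebra.Polynomial"
begin

section \<open>Comparator circuits\<close>

datatype literal = Pos nat | Neg nat

fun var_of :: "literal \<Rightarrow> nat" where
  "var_of (Pos i) = i"
| "var_of (Neg i) = i"

text \<open>An input in \<open>{0,1}\<^sup>n\<close> is a Boolean list of length \<open>n\<close>; variables are numbered from 0.\<close>

fun lit_val :: "bool list \<Rightarrow> literal \<Rightarrow> bool" where
  "lit_val x (Pos i) = x ! i"
| "lit_val x (Neg i) = (\<not> x ! i)"

record circuit =
  wires :: "nat set"
  label :: "nat \<Rightarrow> literal"
  gates :: "(nat \<times> nat) list"
  out_wire :: nat

definition comparator_circuit :: "nat \<Rightarrow> circuit \<Rightarrow> bool" where
  "comparator_circuit n C \<longleftrightarrow>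
     finite (wires C) \<and>
     (\<forall>w\<in>wires C. var_of (label C w) < n) \<and>
     (\<forall>(i, j)\<in>set (gates C). i \<in> wires C \<and> j \<in> wires C \<and> i \<noteq> j) \<and>
     out_wire C \<in> wires C"

fun apply_gate :: "nat \<times> nat \<Rightarrow> (nat \<Rightarrow> bool) \<Rightarrow> (nat \<Rightarrow> bool)" where
  "apply_gate (i, j) v = v(i := (v i \<and> v j), j := (v i \<or> v j))"

definition circuit_val :: "circuit \<Rightarrow> bool list \<Rightarrow> bool" where
  "circuit_val C x = fold apply_gate (gates C) (\<lambda>w. lit_val x (label C w)) (out_wire C)"

definition circuit_size :: "circuit \<Rightarrow> nat" where
  "circuit_size C = length (gates C)"

definition num_sat :: "nat \<Rightarrow> circuit \<Rightarrow> nat" where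
  "num_sat n C = card {x. length x = n \<and> circuit_val C x}"

section \<open>Presenting a circuit to an algorithm\<close>

text \<open>
  The number of wires is not bounded by the number of gates, but a wire that is neither the
  output wire nor touched by a gate has no influence on the computation.  A description of a
  circuit lists, in an arbitrary order, the wires that do occur, and refers to them by their
  positions in this list, so that its length is polynomial in the number of gates.
\<close>

definition occurring_wires :: "circuit \<Rightarrow> nat set" where
  "occurring_wires C = insert (out_wire C) (fst ` set (gates C) \<union> snd ` set (gates C))"

definition wire_listing :: "circuit \<Rightarrow> nat list \<Rightarrow> bool" where
  "wire_listing C ws \<longleftrightarrow> distinct ws \<and> set ws = occurring_wires C"

definition position :: "nat list \<Rightarrow> nat \<Rightarrow> nat" where
  "position ws w = (LEAST i. i < length ws \<and> ws ! i = w)"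

fun encode_literal :: "literal \<Rightarrow> nat" where
  "encode_literal (Pos i) = 2 * i"
| "encode_literal (Neg i) = 2 * i + 1"

definition encode_circuit :: "nat \<Rightarrow> circuit \<Rightarrow> nat list \<Rightarrow> nat list" where
  "encode_circuit n C ws =
     [n, length ws, length (gates C), position ws (out_wire C)]
     @ map (\<lambda>w. encode_literal (label C w)) ws
     @ concat (map (\<lambda>(i, j). [position ws i, position ws j]) (gates C))"

section \<open>Deterministic algorithms: random access machines with logarithmic cost\<close>

text \<open>
  Algorithms are structured programs over finitely many registers (register names are
  constants of the program) and an indirectly addressable memory, both holding natural
  numbers.  Subtraction is truncated and division by zero gives zero.  Every register access,
  memory access and operation is charged the bit lengths of the numbers and addresses
  involved, with schoolbook cost for multiplication and division; hence running times agree
  with those of the usual logarithmic-cost RAM up to polynomial factors in the bit length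
  of the numbers involved.
\<close>

datatype expr =
    Num nat
  | Reg nat
  | Mem expr
  | Add expr expr
  | Sub expr expr
  | Mul expr expr
  | Div expr expr

datatype com =
    Skip
  | SetReg nat expr
  | Store expr expr
  | Seq com com
  | If expr com com
  | While expr com

type_synonym state = "(nat \<Rightarrow> nat) \<times> (nat \<Rightarrow> nat)"  \<comment> \<open>registers and memory\<close>

definition len :: "nat \<Rightarrow> nat" where
  "len m = max 1 (floorlog 2 m)"

fun eval_expr :: "expr \<Rightarrow> state \<Rightarrow> nat" where
  "eval_expr (Num c) s = c"
| "eval_expr (Reg r) s = fst s r"
| "eval_expr (Mem a) s = snd s (eval_expr a s)"
| "eval_expr (Add a b) s = eval_expr a s + eval_expr b s"
| "eval_expr (Sub a b) s = eval_expr a s - eval_expr b s"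
| "eval_expr (Mul a b) s = eval_expr a s * eval_expr b s"
| "eval_expr (Div a b) s = eval_expr a s div eval_expr b s"

fun expr_cost :: "expr \<Rightarrow> state \<Rightarrow> nat" where
  "expr_cost (Num c) s = len c"
| "expr_cost (Reg r) s = len r + len (fst s r)"
| "expr_cost (Mem a) s =
     expr_cost a s + len (eval_expr a s) + len (snd s (eval_expr a s))"
| "expr_cost (Add a b) s =
     expr_cost a s + expr_cost b s + len (eval_expr a s) + len (eval_expr b s)"
| "expr_cost (Sub a b) s =
     expr_cost a s + expr_cost b s + len (eval_expr a s) + len (eval_expr b s)"
| "expr_cost (Mul a b) s =
     expr_cost a s + expr_cost b s + len (eval_expr a s) * len (eval_expr b s)"
| "expr_cost (Div a b) s =
     expr_cost a s + expr_cost b s + len (eval_expr a s) * len (eval_expr b s)"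

text \<open>\<open>run c s t s'\<close>: started in \<open>s\<close>, the program \<open>c\<close> halts in \<open>s'\<close> after time \<open>t\<close>.
  A guard counts as true iff its value is nonzero.\<close>

inductive run :: "com \<Rightarrow> state \<Rightarrow> nat \<Rightarrow> state \<Rightarrow> bool" where
  run_Skip: "run Skip s 1 s"
| run_SetReg: "run (SetReg r e) (R, M)
     (expr_cost e (R, M) + len r + len (eval_expr e (R, M)))
     (R(r := eval_expr e (R, M)), M)"
| run_Store: "run (Store a e) (R, M)
     (expr_cost a (R, M) + expr_cost e (R, M) + len (eval_expr a (R, M)) + len (eval_expr e (R, M)))
     (R, M(eval_expr a (R, M) := eval_expr e (R, M)))"
| run_Seq: "run c1 s t1 s' \<Longrightarrow> run c2 s' t2 s'' \<Longrightarrow> run (Seq c1 c2) s (t1 + t2) s''"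
| run_IfTrue: "eval_expr b s \<noteq> 0 \<Longrightarrow> run c1 s t s' \<Longrightarrow>
     run (If b c1 c2) s (expr_cost b s + 1 + t) s'"
| run_IfFalse: "eval_expr b s = 0 \<Longrightarrow> run c2 s t s' \<Longrightarrow>
     run (If b c1 c2) s (expr_cost b s + 1 + t) s'"
| run_WhileFalse: "eval_expr b s = 0 \<Longrightarrow> run (While b c) s (expr_cost b s + 1) s"
| run_WhileTrue: "eval_expr b s \<noteq> 0 \<Longrightarrow> run c s t1 s' \<Longrightarrow> run (While b c) s' t2 s'' \<Longrightarrow>
     run (While b c) s (expr_cost b s + 1 + t1 + t2) s''"

lemma run_deterministic:
  "run c s t s' \<Longrightarrow> run c s u s'' \<Longrightarrow> u = t \<and> s'' = s'"
proof (induction arbitrary: u s'' rule: run.induct)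
  case (run_Seq c1 s t1 s' c2 t2 s3)
  from run_Seq.prems obtain v1 v2 r where
    r: "run c1 s v1 r" "run c2 r v2 s''" "u = v1 + v2"
    by (cases rule: run.cases) simp_all
  from run_Seq.IH(1)[OF r(1)] have "v1 = t1" "r = s'" by simp_all
  with run_Seq.IH(2)[of v2 s''] r show ?case by simp
next
  case (run_IfTrue b s c1 t s' c2)
  from run_IfTrue.prems run_IfTrue.hyps obtain v where
    v: "run c1 s v s''" "u = expr_cost b s + 1 + v"
    by (cases rule: run.cases) simp_all
  from run_IfTrue.IH[OF v(1)] v(2) show ?case by simp
next
  case (run_IfFalse b s c2 t s' c1)
  from run_IfFalse.prems run_IfFalse.hyps obtain v where
    v: "run c2 s v s''" "u = expr_cost b s + 1 + v"
    by (cases rule: run.cases) simp_all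
  from run_IfFalse.IH[OF v(1)] v(2) show ?case by simp
next
  case (run_WhileFalse b s c)
  from run_WhileFalse.prems show ?case
    by (cases rule: run.cases) (use run_WhileFalse.hyps in simp_all)
next
  case (run_WhileTrue b s c t1 s' t2 s3)
  from run_WhileTrue.prems run_WhileTrue.hyps obtain v1 v2 r where
    r: "run c s v1 r" "run (While b c) r v2 s''" "u = expr_cost b s + 1 + v1 + v2"
    by (cases rule: run.cases) simp_all
  from run_WhileTrue.IH(1)[OF r(1)] have "v1 = t1" "r = s'" by simp_all
  with run_WhileTrue.IH(2)[of v2 s''] r show ?case by simp
next
  case run_Skip
  then show ?case by (cases rule: run.cases) simp_all
next
  case run_SetReg
  then show ?case by (cases rule: run.cases) simp_all
next
  case run_Store
  then show ?case by (cases rule: run.cases) simp_all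
qed

definition init_state :: "nat list \<Rightarrow> state" where
  "init_state xs = ((\<lambda>_. 0), (\<lambda>i. if i < length xs then xs ! i else 0))"

text \<open>The output of a halting program is the final content of register 0.\<close>

definition computes_within :: "com \<Rightarrow> nat list \<Rightarrow> nat \<Rightarrow> nat \<Rightarrow> bool" where
  "computes_within A xs y T \<longleftrightarrow> (\<exists>t R M. run A (init_state xs) t (R, M) \<and> R 0 = y \<and> t \<le> T)"

end

(* Relabel variable i as bit (i + a) mod n of a number X, choosing the rotation a so that few wires
   carry one of the m lowest bits; by averaging, L <= k (2 s + 1) / n such wires are possible for
   m = k.  After the n - m other bits are fixed, only these L wires are not constant.  Keep a set of
   pairs of wires that are known to be ordered on all inputs.  A gate on an ordered pair either does
   nothing or swaps two wires and can be dropped; every other gate increases the number of known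
   pairs by one.  So each restriction leaves at most L^2 gates, hence at most 2^(O(L^2 log n))
   different restricted circuits arise, which the size bound makes at most 2^(n/16) poly(n).  Each
   of them is counted by brute force once, and the count is stored in the memory at an address that
   encodes the restricted circuit.  The total is 2^(n-m) poly(n) + 2^(n/16) 2^m poly(n). *)
theory Submission
  imports Defs
begin

section \<open>Step counting and weakest preconditions\<close>

text \<open>Fixing bits does not by itself remove gates, since constants keep travelling through the
  wires. What makes a gate removable is a known order, and a constant is ordered against everything;
  so every surviving gate has both ends among the live slots. Constants: averaging over rotations
  gives L - 1 <= 2 s k / n, where subtracting one absorbs the output wire. With d = 16 this yields
  (L - 1)^2 log n <= n / 64, and as the program uses the rounded logarithm l <= 2 log n, the
  testable condition is 32 (L - 1)^2 l <= n. About 2 (L - 1)^2 gates with at most n choices each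
  give 2^(n/16) keys up to polynomial factors. A block length m with k <= m <= n / 2 makes both
  2^(n-m) and 2^(n/16 + m) at most 2^(n-k), because k <= n / 4. Only n rotations compete, so a good
  one is found by trial. The table needs neither initialisation nor search: fresh memory is zero,
  and under logarithmic cost an access at an address of polynomially many bits takes polynomial
  time.\<close>

definition bounded_state :: "nat \<Rightarrow> state \<Rightarrow> bool" where
  "bounded_state B s \<longleftrightarrow> (\<forall>r. fst s r < 2 ^ B) \<and> (\<forall>a. snd s a < 2 ^ B)"

text \<open>
  \<open>k\<close> counts elementary steps only; since all values that are ever stored stay below \<open>2\<^sup>B\<close>, each
  step costs \<open>O(B\<^sup>2)\<close>, with a factor that depends on the program alone.
\<close>

inductive brun :: "nat \<Rightarrow> com \<Rightarrow> state \<Rightarrow> nat \<Rightarrow> state \<Rightarrow> bool" for B where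
  brun_Skip: "brun B Skip s 1 s"
| brun_SetReg: "eval_expr e (R, M) < 2 ^ B \<Longrightarrow>
     brun B (SetReg r e) (R, M) 1 (R(r := eval_expr e (R, M)), M)"
| brun_Store: "eval_expr e (R, M) < 2 ^ B \<Longrightarrow>
     brun B (Store a e) (R, M) 1 (R, M(eval_expr a (R, M) := eval_expr e (R, M)))"
| brun_Seq: "brun B c1 s k1 s' \<Longrightarrow> brun B c2 s' k2 s'' \<Longrightarrow> brun B (Seq c1 c2) s (k1 + k2) s''"
| brun_IfTrue: "eval_expr b s \<noteq> 0 \<Longrightarrow> brun B c1 s k s' \<Longrightarrow> brun B (If b c1 c2) s (k + 1) s'"
| brun_IfFalse: "eval_expr b s = 0 \<Longrightarrow> brun B c2 s k s' \<Longrightarrow> brun B (If b c1 c2) s (k + 1) s'"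
| brun_WhileFalse: "eval_expr b s = 0 \<Longrightarrow> brun B (While b c) s 1 s"
| brun_WhileTrue: "eval_expr b s \<noteq> 0 \<Longrightarrow> brun B c s k1 s' \<Longrightarrow> brun B (While b c) s' k2 s'' \<Longrightarrow>
     brun B (While b c) s (k1 + k2 + 1) s''"

section \<open>Translating elementary steps into logarithmic cost\<close>

text \<open>Bounds the bit length of the value in units of \<open>B\<close>, rather than the length
  of the term: under each operation bit lengths at most add up. Intermediate values, and addresses
  in particular, may thus exceed \<open>2 ^ B\<close>.\<close>

fun expr_size :: "expr \<Rightarrow> nat" where
  "expr_size (Num c) = len c"
| "expr_size (Reg r) = len r + 1"
| "expr_size (Mem a) = expr_size a + 1"
| "expr_size (Add a b) = expr_size a + expr_size b + 1"
| "expr_size (Sub a b) = expr_size a + expr_size b + 1"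
| "expr_size (Mul a b) = expr_size a + expr_size b + 1"
| "expr_size (Div a b) = expr_size a + expr_size b + 1"

lemma len_le_iff: "0 < b \<Longrightarrow> len m \<le> b \<longleftrightarrow> m < 2 ^ b"
  unfolding len_def by (auto simp: floorlog_leD floorlog_le_iff)

lemma len_pos: "0 < len m"
  by (simp add: len_def)

lemma less_two_power_len: "m < 2 ^ len m"
  using len_le_iff[of "len m" m] len_pos[of m] by simp

lemma len_leI: "m < 2 ^ b \<Longrightarrow> 0 < b \<Longrightarrow> len m \<le> b"
  by (simp add: len_le_iff)

lemma len_mono: "a \<le> b \<Longrightarrow> len a \<le> len b"
  using less_two_power_len[of b] len_pos[of b] by (intro len_leI) auto

lemma len_add: "len (a + b) \<le> len a + len b"
proof (rule len_leI)
  have "a + b < 2 ^ len a * 2 ^ len b"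
  proof -
    have "Suc a * Suc b \<le> 2 ^ len a * 2 ^ len b"
      using less_two_power_len by (intro mult_le_mono) (simp_all add: Suc_le_eq)
    then show ?thesis by simp
  qed
  then show "a + b < 2 ^ (len a + len b)" by (simp add: power_add)
qed (use len_pos[of a] in simp)

lemma len_mult: "len (a * b) \<le> len a + len b"
proof (rule len_leI)
  show "a * b < 2 ^ (len a + len b)"
    unfolding power_add using less_two_power_len by (intro mult_strict_mono) simp_all
qed (use len_pos[of a] in simp)

lemma len_eval_expr:
  assumes "bounded_state B s" "0 < B"
  shows "len (eval_expr e s) \<le> expr_size e * B"
proof (induction e)
  case (Num c)
  have "len c * 1 \<le> len c * B" using assms(2) by (intro mult_le_mono2) simp
  then show ?case by simp
next
  case (Reg r)
  have "len (fst s r) \<le> B" using assms by (intro len_leI) (auto simp: bounded_state_def)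
  then show ?case by (simp add: algebra_simps)
next
  case (Mem a)
  have "len (snd s (eval_expr a s)) \<le> B" using assms by (intro len_leI) (auto simp: bounded_state_def)
  then show ?case by (simp add: algebra_simps)
next
  case (Add a b)
  then show ?case using len_add[of "eval_expr a s" "eval_expr b s"] by (simp add: algebra_simps)
next
  case (Sub a b)
  then show ?case using len_mono[of "eval_expr a s - eval_expr b s" "eval_expr a s"]
    by (simp add: algebra_simps)
next
  case (Mul a b)
  then show ?case using len_mult[of "eval_expr a s" "eval_expr b s"] by (simp add: algebra_simps)
next
  case (Div a b)
  then show ?case using len_mono[of "eval_expr a s div eval_expr b s" "eval_expr a s"]
    by (simp add: algebra_simps)
qed

text \<open>The cost of an evaluation in units of \<open>B^2\<close>; the products stem from
  schoolbook multiplication and division.\<close>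

fun expr_weight :: "expr \<Rightarrow> nat" where
  "expr_weight (Num c) = len c"
| "expr_weight (Reg r) = len r + 1"
| "expr_weight (Mem a) = expr_weight a + expr_size a + 1"
| "expr_weight (Add a b) = expr_weight a + expr_weight b + expr_size a + expr_size b"
| "expr_weight (Sub a b) = expr_weight a + expr_weight b + expr_size a + expr_size b"
| "expr_weight (Mul a b) = expr_weight a + expr_weight b + expr_size a * expr_size b"
| "expr_weight (Div a b) = expr_weight a + expr_weight b + expr_size a * expr_size b"

lemma expr_cost_le:
  assumes "bounded_state B s" "0 < B"
  shows "expr_cost e s \<le> expr_weight e * B\<^sup>2"
proof (induction e)
  note L = len_eval_expr[OF assms]
  have BB: "B \<le> B\<^sup>2" "1 \<le> B\<^sup>2" using assms(2) by (simp_all add: power2_eq_square)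
  have S: "len (eval_expr a s) \<le> expr_size a * B\<^sup>2" for a
    by (rule order_trans[OF L]) (simp add: BB)
  {
    case (Num c)
    have "len c * 1 \<le> len c * B\<^sup>2" by (intro mult_le_mono2 BB)
    then show ?case by simp
  next
    case (Reg r)
    have "len (fst s r) \<le> B" using assms by (intro len_leI) (auto simp: bounded_state_def)
    moreover have "len r * 1 \<le> len r * B\<^sup>2" by (intro mult_le_mono2 BB)
    ultimately have "len r + len (fst s r) \<le> len r * B\<^sup>2 + B\<^sup>2" using BB by linarith
    then show ?case by (simp add: algebra_simps)
  next
    case (Mem a)
    have "len (snd s (eval_expr a s)) \<le> B" using assms by (intro len_leI) (auto simp: bounded_state_def)
    then show ?case using BB Mem S[of a] by (simp add: algebra_simps)
  next
    case (Add a b)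
    then show ?case using S[of a] S[of b] by (simp add: algebra_simps)
  next
    case (Sub a b)
    then show ?case using S[of a] S[of b] by (simp add: algebra_simps)
  next
    case (Mul a b)
    have "len (eval_expr a s) * len (eval_expr b s) \<le> (expr_size a * B) * (expr_size b * B)"
      by (intro mult_le_mono L)
    then show ?case using Mul by (simp add: algebra_simps power2_eq_square)
  next
    case (Div a b)
    have "len (eval_expr a s) * len (eval_expr b s) \<le> (expr_size a * B) * (expr_size b * B)"
      by (intro mult_le_mono L)
    then show ?case using Div by (simp add: algebra_simps power2_eq_square)
  }
qed

fun com_weight :: "com \<Rightarrow> nat" where
  "com_weight Skip = 1"
| "com_weight (SetReg r e) = expr_weight e + len r + expr_size e"
| "com_weight (Store a e) = expr_weight a + expr_weight e + expr_size a + expr_size e"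
| "com_weight (Seq c1 c2) = com_weight c1 + com_weight c2"
| "com_weight (If b c1 c2) = expr_weight b + 1 + com_weight c1 + com_weight c2"
| "com_weight (While b c) = expr_weight b + 1 + com_weight c"

text \<open>Boundedness is preserved because every assignment checks the value that it stores. Each
  step then costs \<open>O(B^2)\<close>, and the factor is the weight of the program text.\<close>

lemma run_of_brun:
  assumes "brun B c s k s'" "bounded_state B s" "0 < B"
  shows "bounded_state B s' \<and> (\<exists>t. run c s t s' \<and> t \<le> k * com_weight c * B\<^sup>2)"
  using assms
proof (induction rule: brun.induct)
  case (brun_Skip s)
  have "1 \<le> B\<^sup>2" using brun_Skip by simp
  then show ?case using brun_Skip by (auto intro!: exI[of _ 1] run.intros)
next
  case (brun_SetReg e R M r)
  have BB: "B \<le> B\<^sup>2" "1 \<le> B\<^sup>2" using brun_SetReg.prems(2) by (simp_all add: power2_eq_square)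
  have "len (eval_expr e (R, M)) \<le> expr_size e * B\<^sup>2"
    by (rule order_trans[OF len_eval_expr[OF brun_SetReg.prems]]) (simp add: BB)
  moreover have "len r * 1 \<le> len r * B\<^sup>2" by (intro mult_le_mono2 BB)
  ultimately have "expr_cost e (R, M) + len r + len (eval_expr e (R, M)) \<le> 1 * com_weight (SetReg r e) * B\<^sup>2"
    using expr_cost_le[OF brun_SetReg.prems, of e]
    unfolding com_weight.simps distrib_right mult_1 by linarith
  moreover have "bounded_state B (R(r := eval_expr e (R, M)), M)"
    using brun_SetReg by (auto simp: bounded_state_def)
  ultimately show ?case using run_SetReg[of r e R M] by (intro conjI exI)
next
  case (brun_Store e R M a)
  have BB: "B \<le> B\<^sup>2" "1 \<le> B\<^sup>2" using brun_Store.prems(2) by (simp_all add: power2_eq_square)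
  have "len (eval_expr e (R, M)) \<le> expr_size e * B\<^sup>2" for e
    by (rule order_trans[OF len_eval_expr[OF brun_Store.prems]]) (simp add: BB)
  from this[of a] this[of e]
  have "expr_cost a (R, M) + expr_cost e (R, M) + len (eval_expr a (R, M)) + len (eval_expr e (R, M))
      \<le> 1 * com_weight (Store a e) * B\<^sup>2"
    using expr_cost_le[OF brun_Store.prems, of e] expr_cost_le[OF brun_Store.prems, of a]
    by (simp add: algebra_simps)
  moreover have "bounded_state B (R, M(eval_expr a (R, M) := eval_expr e (R, M)))"
    using brun_Store by (auto simp: bounded_state_def)
  ultimately show ?case using run_Store[of a e R M] by (intro conjI exI)
next
  case (brun_Seq c1 s k1 s' c2 k2 s'')
  from brun_Seq.IH(1)[OF brun_Seq.prems] brun_Seq.IH(2) brun_Seq.prems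
  obtain t1 t2 where t: "run c1 s t1 s'" "t1 \<le> k1 * com_weight c1 * B\<^sup>2"
      "run c2 s' t2 s''" "t2 \<le> k2 * com_weight c2 * B\<^sup>2" "bounded_state B s''" by blast
  have "t1 + t2 \<le> (k1 + k2) * com_weight (Seq c1 c2) * B\<^sup>2"
    using t(2,4) by (simp add: algebra_simps)
  then show ?case using t(5) run_Seq[OF t(1,3)] by (intro conjI exI)
next
  case (brun_IfTrue b s c1 k s' c2)
  then obtain t where t: "run c1 s t s'" "t \<le> k * com_weight c1 * B\<^sup>2" "bounded_state B s'" by blast
  have "1 \<le> B\<^sup>2" using brun_IfTrue.prems by simp
  then have "expr_cost b s + 1 + t \<le> (k + 1) * com_weight (If b c1 c2) * B\<^sup>2"
    using t expr_cost_le[OF brun_IfTrue.prems, of b] by (simp add: algebra_simps)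
  then show ?case using t(3) run_IfTrue[OF brun_IfTrue.hyps(1) t(1)] by (intro conjI exI)
next
  case (brun_IfFalse b s c2 k s' c1)
  then obtain t where t: "run c2 s t s'" "t \<le> k * com_weight c2 * B\<^sup>2" "bounded_state B s'" by blast
  have "1 \<le> B\<^sup>2" using brun_IfFalse.prems by simp
  then have "expr_cost b s + 1 + t \<le> (k + 1) * com_weight (If b c1 c2) * B\<^sup>2"
    using t expr_cost_le[OF brun_IfFalse.prems, of b] by (simp add: algebra_simps)
  then show ?case using t(3) run_IfFalse[OF brun_IfFalse.hyps(1) t(1)] by (intro conjI exI)
next
  case (brun_WhileFalse b s c)
  have "1 \<le> B\<^sup>2" using brun_WhileFalse.prems by simp
  then have "expr_cost b s + 1 \<le> 1 * com_weight (While b c) * B\<^sup>2"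
    using expr_cost_le[OF brun_WhileFalse.prems, of b] by (simp add: algebra_simps)
  then show ?case using run_WhileFalse[OF brun_WhileFalse.hyps] brun_WhileFalse.prems(1) by (intro conjI exI)
next
  case (brun_WhileTrue b s c k1 s' k2 s'')
  from brun_WhileTrue.IH(1)[OF brun_WhileTrue.prems] brun_WhileTrue.IH(2) brun_WhileTrue.prems
  obtain t1 t2 where t: "run c s t1 s'" "t1 \<le> k1 * com_weight c * B\<^sup>2"
      "run (While b c) s' t2 s''" "t2 \<le> k2 * com_weight (While b c) * B\<^sup>2" "bounded_state B s''" by blast
  have "1 \<le> B\<^sup>2" using brun_WhileTrue.prems by simp
  then have "expr_cost b s + 1 + t1 + t2 \<le> (k1 + k2 + 1) * com_weight (While b c) * B\<^sup>2"
    using t(2,4) expr_cost_le[OF brun_WhileTrue.prems, of b] by (simp add: algebra_simps)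
  then show ?case using t(5) run_WhileTrue[OF brun_WhileTrue.hyps(1) t(1,3)] by (intro conjI exI)
qed

section \<open>Program logic for total correctness with step counts\<close>

text \<open>Demands termination. The postcondition also receives the number of steps, so that
  running time and result are verified together.\<close>

definition wp :: "nat \<Rightarrow> com \<Rightarrow> (nat \<Rightarrow> state \<Rightarrow> bool) \<Rightarrow> state \<Rightarrow> bool" where
  "wp B c Q s \<longleftrightarrow> (\<exists>k s'. brun B c s k s' \<and> Q k s')"

lemma wp_mono: "wp B c Q s \<Longrightarrow> (\<And>k s'. Q k s' \<Longrightarrow> Q' k s') \<Longrightarrow> wp B c Q' s"
  unfolding wp_def by blast

inductive_cases brun_SkipE: "brun B Skip s k s'"
inductive_cases brun_SetRegE: "brun B (SetReg r e) s k s'"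
inductive_cases brun_StoreE: "brun B (Store a e) s k s'"
inductive_cases brun_SeqE: "brun B (Seq c1 c2) s k s'"
inductive_cases brun_IfE: "brun B (If b c1 c2) s k s'"

text \<open>The rules for loop-free code are equations, so that the simplifier executes such code
  symbolically.\<close>

lemma wp_Skip [simp]: "wp B Skip Q s \<longleftrightarrow> Q 1 s"
  unfolding wp_def by (metis brun_SkipE brun_Skip)

lemma wp_SetReg [simp]: "wp B (SetReg r e) Q (R, M) \<longleftrightarrow>
    eval_expr e (R, M) < 2 ^ B \<and> Q 1 (R(r := eval_expr e (R, M)), M)"
proof -
  have "brun B (SetReg r e) (R, M) k s' \<longleftrightarrow>
      eval_expr e (R, M) < 2 ^ B \<and> k = 1 \<and> s' = (R(r := eval_expr e (R, M)), M)" for k s'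
    by (auto elim!: brun_SetRegE intro: brun_SetReg[simplified])
  then show ?thesis unfolding wp_def by auto
qed

lemma wp_Store [simp]: "wp B (Store a e) Q (R, M) \<longleftrightarrow>
    eval_expr e (R, M) < 2 ^ B \<and> Q 1 (R, M(eval_expr a (R, M) := eval_expr e (R, M)))"
proof -
  have "brun B (Store a e) (R, M) k s' \<longleftrightarrow>
      eval_expr e (R, M) < 2 ^ B \<and> k = 1 \<and> s' = (R, M(eval_expr a (R, M) := eval_expr e (R, M)))"
    for k s' by (auto elim!: brun_StoreE intro: brun_Store[simplified])
  then show ?thesis unfolding wp_def by auto
qed

lemma wp_Seq [simp]: "wp B (Seq c1 c2) Q s \<longleftrightarrow> wp B c1 (\<lambda>k1. wp B c2 (\<lambda>k2. Q (k1 + k2))) s"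
  unfolding wp_def by (metis brun_SeqE brun_Seq)

lemma wp_If [simp]: "wp B (If b c1 c2) Q s \<longleftrightarrow>
    (if eval_expr b s \<noteq> 0 then wp B c1 (\<lambda>k. Q (k + 1)) s else wp B c2 (\<lambda>k. Q (k + 1)) s)"
    (is "?l \<longleftrightarrow> ?r")
proof
  assume ?l
  then obtain k s' where k: "brun B (If b c1 c2) s k s'" "Q k s'" unfolding wp_def by blast
  from k(1) show ?r by (rule brun_IfE) (use k(2) in \<open>auto simp: wp_def simp del: split_paired_Ex\<close>)
next
  assume r: ?r
  show ?l
  proof (cases "eval_expr b s = 0")
    case True
    with r obtain k s' where "brun B c2 s k s'" "Q (k + 1) s'" unfolding wp_def by metis
    with brun_IfFalse[OF True this(1), of c1] show ?thesis unfolding wp_def by (intro exI conjI)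
  next
    case False
    with r obtain k s' where "brun B c1 s k s'" "Q (k + 1) s'" unfolding wp_def by metis
    with brun_IfTrue[OF False this(1), of c2] show ?thesis unfolding wp_def by (intro exI conjI)
  qed
qed

text \<open>The bound \<open>hi\<close> is evaluated anew in every round, which is why the loop
  rules ask that its value stay \<open>N\<close> under the invariant.\<close>

definition For :: "nat \<Rightarrow> expr \<Rightarrow> com \<Rightarrow> com" where
  "For r hi c = Seq (SetReg r (Num 0))
     (While (Sub hi (Reg r)) (Seq c (SetReg r (Add (Reg r) (Num 1)))))"

text \<open>The invariant sees the steps spent so far, so rounds of very different cost can be
  charged to a potential; the memo loop relies on this. The initial 1 is the reset of the counter,
  the 2 per round are the guard and the increment, and the final 1 is the failing guard.\<close>

lemma wp_For_amortized:
  assumes init: "I 0 1 (R(r := 0)) M"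
    and hi: "\<And>i k R' M'. I i k R' M' \<Longrightarrow> eval_expr hi (R', M') = N"
    and body: "\<And>i k R' M'. i < N \<Longrightarrow> I i k R' M' \<Longrightarrow> R' r = i \<Longrightarrow>
      wp B c (\<lambda>k' (R'', M''). R'' r = i \<and> I (Suc i) (k + k' + 2) (R''(r := Suc i)) M'') (R', M')"
    and N: "N < 2 ^ B"
    and fin: "\<And>k R' M'. I N k R' M' \<Longrightarrow> Q (k + 1) (R', M')"
  shows "wp B (For r hi c) Q (R, M)"
proof -
  let ?w = "While (Sub hi (Reg r)) (Seq c (SetReg r (Add (Reg r) (Num 1))))"
  \<comment> \<open>\<open>k'\<close> includes the failing guard at the end, which the invariant
    does not count; hence the subtraction of 1.\<close>
  have loop: "\<exists>k' R'' M''. brun B ?w (R', M') k' (R'', M'') \<and> I N (k + k' - 1) R'' M'' \<and> 0 < k'"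
    if "I i k R' M'" "R' r = i" "i \<le> N" for i k R' M'
    using that
  proof (induction "N - i" arbitrary: i k R' M')
    case 0
    from 0(1,4) have i: "i = N" by simp
    have "eval_expr (Sub hi (Reg r)) (R', M') = 0" using hi[OF 0(2)] 0(3) i by simp
    from brun_WhileFalse[OF this] have "brun B ?w (R', M') 1 (R', M')" .
    moreover have "I N (k + 1 - 1) R' M'" using 0(2) i by simp
    ultimately show ?case by (intro exI conjI) (assumption, assumption, simp)
  next
    case (Suc d)
    from Suc.hyps(2) have i: "i < N" by simp
    from body[OF i Suc.prems(1,2)] obtain k1 s1 where b0: "brun B c (R', M') k1 s1"
      "case s1 of (R'', M'') \<Rightarrow> R'' r = i \<and> I (Suc i) (k + k1 + 2) (R''(r := Suc i)) M''"
      unfolding wp_def by blast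
    obtain R1 M1 where s1: "s1 = (R1, M1)" by (cases s1)
    have b: "brun B c (R', M') k1 (R1, M1)" "R1 r = i" "I (Suc i) (k + k1 + 2) (R1(r := Suc i)) M1"
      using b0 unfolding s1 by simp_all
    have "d = N - Suc i" using Suc.hyps(2) by simp
    from Suc.hyps(1)[OF this b(3)] i obtain k2 R2 M2 where
      l: "brun B ?w (R1(r := Suc i), M1) k2 (R2, M2)" "I N (k + k1 + 2 + k2 - 1) R2 M2" "0 < k2"
      by auto
    have "brun B (SetReg r (Add (Reg r) (Num 1))) (R1, M1) 1 (R1(r := Suc i), M1)"
      using brun_SetReg[of "Add (Reg r) (Num 1)" R1 M1 B r] b(2) i N by simp
    from brun_Seq[OF b(1) this] have
      "brun B (Seq c (SetReg r (Add (Reg r) (Num 1)))) (R', M') (k1 + 1) (R1(r := Suc i), M1)" .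
    moreover have "eval_expr (Sub hi (Reg r)) (R', M') \<noteq> 0"
      using hi[OF Suc.prems(1)] Suc.prems(2) i by simp
    ultimately have "brun B ?w (R', M') (k1 + 1 + k2 + 1) (R2, M2)"
      using l(1) by (intro brun_WhileTrue)
    moreover have "I N (k + (k1 + 1 + k2 + 1) - 1) R2 M2" using l(2,3) by (simp add: algebra_simps)
    ultimately show ?case by (intro exI conjI) (assumption, assumption, simp)
  qed
  from loop[OF init] obtain k' R'' M'' where
    w: "brun B ?w (R(r := 0), M) k' (R'', M'')" "I N k' R'' M''" by auto
  have "brun B (SetReg r (Num 0)) (R, M) 1 (R(r := 0), M)"
    using brun_SetReg[of "Num 0" R M B r] by simp
  from brun_Seq[OF this w(1)] have "brun B (For r hi c) (R, M) (1 + k') (R'', M'')"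
    unfolding For_def .
  with fin[OF w(2)] show ?thesis unfolding wp_def by auto
qed

lemma wp_For:
  assumes init: "I 0 (R(r := 0)) M"
    and hi: "\<And>i R' M'. I i R' M' \<Longrightarrow> eval_expr hi (R', M') = N"
    and body: "\<And>i R' M'. i < N \<Longrightarrow> I i R' M' \<Longrightarrow> R' r = i \<Longrightarrow>
      wp B c (\<lambda>k (R'', M''). k \<le> T \<and> R'' r = i \<and> I (Suc i) (R''(r := Suc i)) M'') (R', M')"
    and N: "N < 2 ^ B"
    and fin: "\<And>k R' M'. I N R' M' \<Longrightarrow> k \<le> 2 + N * (T + 2) \<Longrightarrow> Q k (R', M')"
  shows "wp B (For r hi c) Q (R, M)"
proof (rule wp_For_amortized[where N = N and I = "\<lambda>i k R M. I i R M \<and> k \<le> 1 + i * (T + 2)"])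
  show "I 0 (R(r := 0)) M \<and> 1 \<le> 1 + 0 * (T + 2)"
    using init by simp
  show "eval_expr hi (R', M') = N" if "I i R' M' \<and> k \<le> 1 + i * (T + 2)" for i k R' M'
    using hi that by blast
  show "N < 2 ^ B" by fact
  show "Q (k + 1) (R', M')" if "I N R' M' \<and> k \<le> 1 + N * (T + 2)" for k R' M'
    using that by (intro fin) simp_all
next
  fix i k R' M'
  assume "i < N" and I: "I i R' M' \<and> k \<le> 1 + i * (T + 2)" and "R' r = i"
  then have "wp B c (\<lambda>k (R'', M''). k \<le> T \<and> R'' r = i \<and> I (Suc i) (R''(r := Suc i)) M'') (R', M')"
    by (intro body) simp_all
  then show "wp B c (\<lambda>k' (R'', M''). R'' r = i \<and> I (Suc i) (R''(r := Suc i)) M'' \<and>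
      k + k' + 2 \<le> 1 + Suc i * (T + 2)) (R', M')"
    by (rule wp_mono) (use I in \<open>auto split: prod.splits\<close>)
qed

section \<open>Symbolic simulation on partially known inputs\<close>

text \<open>
  \<open>r x y\<close> records that the value in slot \<open>x\<close> is known to imply the value in slot \<open>y\<close>.  When a gate is
  applied to \<open>(a, b)\<close>, \<open>col_update\<close> passes from the old to the new values in the second argument and
  \<open>row_update\<close> in the first.  Both preserve the number of related pairs.  If \<open>a\<close> and \<open>b\<close> were not
  comparable, \<open>(a, a)\<close> is the only reflexive pair that gets lost, and restoring it is the gain.
\<close>

definition col_update :: "nat \<Rightarrow> nat \<Rightarrow> (nat \<Rightarrow> nat \<Rightarrow> bool) \<Rightarrow> nat \<Rightarrow> nat \<Rightarrow> bool" where
  "col_update a b r = (\<lambda>x y. if y = a then r x a \<and> r x b else if y = b then r x a \<or> r x b else r x y)"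

definition row_update :: "nat \<Rightarrow> nat \<Rightarrow> (nat \<Rightarrow> nat \<Rightarrow> bool) \<Rightarrow> nat \<Rightarrow> nat \<Rightarrow> bool" where
  "row_update a b r = (\<lambda>x y. if x = a then r a y \<or> r b y else if x = b then r a y \<and> r b y else r x y)"

definition rel_update :: "nat \<Rightarrow> nat \<Rightarrow> (nat \<Rightarrow> nat \<Rightarrow> bool) \<Rightarrow> nat \<Rightarrow> nat \<Rightarrow> bool" where
  "rel_update a b r = (\<lambda>x y. (x = a \<and> y = a) \<or> row_update a b (col_update a b r) x y)"

type_synonym sim_state = "(nat \<Rightarrow> nat) \<times> (nat \<Rightarrow> nat \<Rightarrow> bool) \<times> (nat \<times> nat) list"

text \<open>\<open>cur w\<close> is the slot that currently holds the value of wire \<open>w\<close>.\<close>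

fun sim_gate :: "nat \<times> nat \<Rightarrow> sim_state \<Rightarrow> sim_state" where
  "sim_gate (i, j) (cur, r, es) =
     (if r (cur i) (cur j) then (cur, r, es)
      else if r (cur j) (cur i) then (cur(i := cur j, j := cur i), r, es)
      else (cur, rel_update (cur i) (cur j) r, es @ [(cur i, cur j)]))"

definition sound :: "(nat \<Rightarrow> nat \<Rightarrow> bool) \<Rightarrow> (nat \<Rightarrow> bool) \<Rightarrow> bool" where
  "sound r v \<longleftrightarrow> (\<forall>a b. r a b \<longrightarrow> v a \<longrightarrow> v b)"

text \<open>If \<open>x\<close> implies both \<open>a\<close> and \<open>b\<close>, it implies their
  minimum, and one of the two implications suffices for the maximum. The row update is the dual, and
  \<open>(a, a)\<close> is sound for any values.\<close>

lemma sound_rel_update: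
  assumes "sound r v" "a \<noteq> b"
  shows "sound (rel_update a b r) (apply_gate (a, b) v)"
  using assms unfolding sound_def rel_update_def row_update_def col_update_def
  by (auto split: if_splits)

lemma rel_update_refl: "(\<And>x. r x x) \<Longrightarrow> rel_update a b r x x"
  unfolding rel_update_def row_update_def col_update_def by auto

lemma inj_swap: "inj cur \<Longrightarrow> inj (cur(i := cur j, j := cur i))"
  unfolding inj_def by (auto split: if_splits)

section \<open>Correctness of the symbolic simulation\<close>

text \<open>\<open>v0\<close> gives the initial values and \<open>v\<close> the wire values after
  the gates read so far. The emitted gates act on slots, and \<open>cur\<close> translates wires
  into slots.\<close>

definition sim_ok :: "(nat \<Rightarrow> bool) \<Rightarrow> (nat \<Rightarrow> bool) \<Rightarrow> sim_state \<Rightarrow> bool" where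
  "sim_ok v0 v S \<longleftrightarrow> (case S of (cur, r, es) \<Rightarrow> inj cur \<and> (\<forall>x. r x x) \<and>
     sound r (fold apply_gate es v0) \<and> v = fold apply_gate es v0 \<circ> cur)"

text \<open>A gate on two ordered values leaves them in place or exchanges them, and an exchange is
  recorded in \<open>cur\<close> instead of being executed. In the remaining case injectivity of
  \<open>cur\<close> ensures that the gate on slots changes the values of exactly the two
  wires.\<close>

lemma sim_ok_sim_gate:
  assumes ok: "sim_ok v0 v S" and "fst g \<noteq> snd g"
  shows "sim_ok v0 (apply_gate g v) (sim_gate g S)"
proof -
  obtain i j where g: "g = (i, j)" by (cases g)
  obtain cur r es where S: "S = (cur, r, es)" by (cases S)
  define sv where "sv = fold apply_gate es v0"
  have a: "inj cur" "\<forall>x. r x x" "sound r sv" "v = sv \<circ> cur" "i \<noteq> j"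
    using ok assms(2) unfolding sim_ok_def S g sv_def by auto
  have cij: "cur i \<noteq> cur j" using a(1,5) by (auto simp: inj_def)
  consider "r (cur i) (cur j)" | "\<not> r (cur i) (cur j)" "r (cur j) (cur i)"
    | "\<not> r (cur i) (cur j)" "\<not> r (cur j) (cur i)" by blast
  then show ?thesis
  proof cases
    case 1
    then have "sv (cur i) \<longrightarrow> sv (cur j)" using a(3) by (auto simp: sound_def)
    then have "apply_gate (i, j) v = v" using a(4) by (auto simp: fun_eq_iff)
    then show ?thesis using 1 ok by (simp add: S g)
  next
    case 2
    then have "sv (cur j) \<longrightarrow> sv (cur i)" using a(3) by (auto simp: sound_def)
    then have "apply_gate (i, j) v = sv \<circ> cur(i := cur j, j := cur i)"
      using a(4,5) by (auto simp: fun_eq_iff)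
    then show ?thesis using 2 a inj_swap[OF a(1)] by (simp add: S g sim_ok_def sv_def)
  next
    case 3
    have "apply_gate (i, j) v = apply_gate (cur i, cur j) sv \<circ> cur"
      using a(1,4,5) by (auto simp: fun_eq_iff inj_def)
    then show ?thesis using 3 a sound_rel_update[OF a(3) cij] rel_update_refl[of r]
      by (auto simp add: S g sim_ok_def sv_def simp del: apply_gate.simps)
  qed
qed

lemma sim_ok_fold:
  assumes "sim_ok v0 v S" "\<forall>g\<in>set gs. fst g \<noteq> snd g"
  shows "sim_ok v0 (fold apply_gate gs v) (fold sim_gate gs S)"
  using assms
proof (induction gs arbitrary: v S)
  case (Cons g gs)
  then show ?case using sim_ok_sim_gate[OF Cons.prems(1), of g] by simp
qed simp

section \<open>The number of known pairs as a potential\<close>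

definition rel_count :: "nat set \<Rightarrow> (nat \<Rightarrow> nat \<Rightarrow> bool) \<Rightarrow> nat" where
  "rel_count A r = (\<Sum>x\<in>A. \<Sum>y\<in>A. of_bool (r x y))"

lemma sum_split_two:
  fixes f :: "nat \<Rightarrow> nat"
  assumes "finite A" "a \<in> A" "b \<in> A" "a \<noteq> b"
  shows "sum f A = f a + f b + sum f (A - {a, b})"
proof -
  have "sum f A = f a + (f b + sum f (A - {a} - {b}))"
    using assms by (simp add: sum.remove)
  moreover have "A - {a} - {b} = A - {a, b}" by auto
  ultimately show ?thesis by simp
qed

text \<open>Row by row, since \<open>of_bool (p \<and> q) + of_bool (p \<or> q) = of_bool p +
  of_bool q\<close>.\<close>

lemma rel_count_col_update:
  assumes "finite A" "a \<in> A" "b \<in> A" "a \<noteq> b"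
  shows "rel_count A (col_update a b r) = rel_count A r"
  unfolding rel_count_def
proof (rule sum.cong[OF refl])
  fix x
  have "(\<Sum>y\<in>A - {a, b}. of_bool (col_update a b r x y)) = (\<Sum>y\<in>A - {a, b}. of_bool (r x y) :: nat)"
    by (intro sum.cong) (auto simp: col_update_def)
  then show "(\<Sum>y\<in>A. of_bool (col_update a b r x y)) = (\<Sum>y\<in>A. of_bool (r x y) :: nat)"
    unfolding sum_split_two[OF assms] using assms(4) by (auto simp: col_update_def)
qed

lemma rel_count_row_update:
  assumes "finite A" "a \<in> A" "b \<in> A" "a \<noteq> b"
  shows "rel_count A (row_update a b r) = rel_count A r"
proof -
  have swap: "rel_count A r = (\<Sum>y\<in>A. \<Sum>x\<in>A. of_bool (r x y))" for r
    unfolding rel_count_def by (rule sum.swap)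
  show ?thesis
    unfolding swap
  proof (rule sum.cong[OF refl])
    fix y
    have "(\<Sum>x\<in>A - {a, b}. of_bool (row_update a b r x y)) = (\<Sum>x\<in>A - {a, b}. of_bool (r x y) :: nat)"
      by (intro sum.cong) (auto simp: row_update_def)
    then show "(\<Sum>x\<in>A. of_bool (row_update a b r x y)) = (\<Sum>x\<in>A. of_bool (r x y) :: nat)"
      unfolding sum_split_two[OF assms] using assms(4) by (auto simp: row_update_def)
  qed
qed

text \<open>Emitting a gate thus costs one unit of a quantity that never exceeds
  \<open>(card A)^2\<close>.\<close>

lemma rel_count_rel_update:
  assumes A: "finite A" "a \<in> A" "b \<in> A" "a \<noteq> b"
    and r: "\<not> r a b" "\<not> r b a"
  shows "rel_count A (rel_update a b r) = Suc (rel_count A r)"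
proof -
  let ?r = "row_update a b (col_update a b r)"
  \<comment> \<open>This entry is \<open>(r a a \<and> r a b) \<or> (r b a \<and> r b b)\<close>,
    and incomparability refutes both disjuncts.\<close>
  have *: "\<not> ?r a a" using r A(4) by (simp add: row_update_def col_update_def)
  have row: "(\<Sum>y\<in>A. of_bool (rel_update a b r x y)) = (\<Sum>y\<in>A. of_bool (?r x y) :: nat) + of_bool (x = a)" for x
  proof (cases "x = a")
    case True
    have "(\<Sum>y\<in>A - {a}. of_bool (rel_update a b r a y)) = (\<Sum>y\<in>A - {a}. of_bool (?r a y) :: nat)"
      by (intro sum.cong) (auto simp: rel_update_def)
    moreover have "rel_update a b r a a" by (simp add: rel_update_def)
    ultimately show ?thesis using * True
      unfolding True sum.remove[OF A(1,2)] by (simp del: sum_of_bool_eq)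
  qed (simp add: rel_update_def)
  have "rel_count A (rel_update a b r) = rel_count A ?r + 1"
    unfolding rel_count_def row sum.distrib using A by (simp add: sum.delta of_bool_def)
  then show ?thesis using A by (simp add: rel_count_row_update rel_count_col_update)
qed

lemma rel_count_le: "finite A \<Longrightarrow> rel_count A r \<le> (card A)\<^sup>2"
proof -
  have "rel_count A r \<le> (\<Sum>x\<in>A. \<Sum>y\<in>A. 1)" unfolding rel_count_def by (intro sum_mono) auto
  then show ?thesis by (simp add: power2_eq_square)
qed

text \<open>The emitted gates are paid for by known pairs inside \<open>A\<close>. A slot outside
  \<open>A\<close> is below everything or above everything; the last conjunct records this in a form
  that survives updates.\<close>

definition sim_bd :: "nat set \<Rightarrow> sim_state \<Rightarrow> bool" where
  "sim_bd A S \<longleftrightarrow> (case S of (cur, r, es) \<Rightarrow> inj cur \<and> (\<forall>x. r x x) \<and> set es \<subseteq> A \<times> A \<and>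
     length es \<le> rel_count A r \<and> (\<forall>a. a \<notin> A \<longrightarrow> (\<forall>w. r a w) \<or> (\<forall>w. r w a)))"

lemma sim_bd_sim_gate:
  assumes ok: "sim_bd A S" and A: "finite A" and "fst g \<noteq> snd g"
  shows "sim_bd A (sim_gate g S)"
proof -
  obtain i j where g: "g = (i, j)" by (cases g)
  obtain cur r es where S: "S = (cur, r, es)" by (cases S)
  have a: "inj cur" "\<forall>x. r x x" "set es \<subseteq> A \<times> A" "length es \<le> rel_count A r"
      "\<And>a. a \<notin> A \<Longrightarrow> (\<forall>w. r a w) \<or> (\<forall>w. r w a)" "i \<noteq> j"
    using ok assms(3) unfolding sim_bd_def S g by auto
  have cij: "cur i \<noteq> cur j" using a(1,6) by (auto simp: inj_def)
  show ?thesis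
  proof (cases "r (cur i) (cur j) \<or> r (cur j) (cur i)")
    case True
    then show ?thesis using ok inj_swap[OF a(1)] by (auto simp: S g sim_bd_def)
  next
    case False
    \<comment> \<open>A slot outside \<open>A\<close> would be comparable with the other end of the
      gate.\<close>
    then have ij: "cur i \<in> A" "cur j \<in> A" using a(5) by blast+
    \<comment> \<open>A full row or column outside \<open>A\<close> stays full, because its changed
      entries are conjunctions or disjunctions of its own old entries.\<close>
    have "(\<forall>w. rel_update (cur i) (cur j) r x w) \<or> (\<forall>w. rel_update (cur i) (cur j) r w x)" if "x \<notin> A" for x
      using a(5)[OF that] that ij by (auto simp: rel_update_def row_update_def col_update_def)
    then show ?thesis
      using False a ij rel_count_rel_update[OF A ij cij, of r] rel_update_refl[of r]
      by (auto simp: S g sim_bd_def)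
  qed
qed

lemma sim_bd_fold:
  assumes "sim_bd A S" "finite A" "\<forall>g\<in>set gs. fst g \<noteq> snd g"
  shows "sim_bd A (fold sim_gate gs S)"
  using assms
proof (induction gs arbitrary: S)
  case (Cons g gs)
  then show ?case using sim_bd_sim_gate[OF Cons.prems(1,2), of g] by simp
qed simp

text \<open>The slots outside \<open>A\<close> hold the constants \<open>c\<close> and are comparable with every slot.\<close>

definition init_rel :: "nat set \<Rightarrow> (nat \<Rightarrow> bool) \<Rightarrow> nat \<Rightarrow> nat \<Rightarrow> bool" where
  "init_rel A c = (\<lambda>a b. a = b \<or> (a \<notin> A \<and> \<not> c a) \<or> (b \<notin> A \<and> c b))"

lemma sim_bd_init: "finite A \<Longrightarrow> sim_bd A (id, init_rel A c, [])"
  by (auto simp: sim_bd_def init_rel_def)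

lemma sim_ok_init: "(\<And>w. w \<notin> A \<Longrightarrow> v w = c w) \<Longrightarrow> sim_ok v v (id, init_rel A c, [])"
  by (auto simp: sim_ok_def init_rel_def sound_def)

lemma fold_apply_gate_cong:
  assumes "set es \<subseteq> A \<times> A" "\<And>w. w \<in> A \<Longrightarrow> v w = v' w"
  shows "\<And>w. w \<in> A \<Longrightarrow> fold apply_gate es v w = fold apply_gate es v' w"
  using assms
proof (induction es arbitrary: v v')
  case (Cons e es)
  obtain a b where e: "e = (a, b)" by (cases e)
  have "fold apply_gate es (apply_gate e v) w = fold apply_gate es (apply_gate e v') w"
    using Cons.prems by (intro Cons.IH) (auto simp: e)
  then show ?case by simp
qed simp

lemma fold_apply_gate_outside:
  assumes "set es \<subseteq> A \<times> A" "w \<notin> A"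
  shows "fold apply_gate es v w = v w"
  using assms by (induction es arbitrary: v) (auto split: if_splits)

section \<open>Keys of restricted circuits\<close>

text \<open>The tags 0 and 1 stand for the two constants; the shift by 2 keeps them apart from the
  live slots.\<close>

definition final_tag :: "nat set \<Rightarrow> (nat \<Rightarrow> bool) \<Rightarrow> nat \<Rightarrow> nat" where
  "final_tag A c w = (if w \<in> A then w + 2 else of_bool (c w))"

definition sim_key :: "nat set \<Rightarrow> (nat \<Rightarrow> bool) \<Rightarrow> (nat \<times> nat) list \<Rightarrow> nat \<Rightarrow> (nat \<times> nat) list \<times> nat" where
  "sim_key A c gs out = (case fold sim_gate gs (id, init_rel A c, []) of (cur, r, es) \<Rightarrow>
     (es, final_tag A c (cur out)))"

text \<open>Equal keys mean that both inputs run through the same reduced circuit and that the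
  output is the same live slot or the same constant. As the reduced circuit touches only slots of
  \<open>A\<close>, agreement on \<open>A\<close> is enough.\<close>

lemma sim_key_determines:
  assumes key: "sim_key A c gs out = sim_key A c' gs out" and "finite A"
    and gs: "\<forall>g\<in>set gs. fst g \<noteq> snd g"
    and v: "\<And>w. w \<notin> A \<Longrightarrow> v w = c w" "\<And>w. w \<notin> A \<Longrightarrow> v' w = c' w"
    and vv: "\<And>w. w \<in> A \<Longrightarrow> v w = v' w"
  shows "fold apply_gate gs v out = fold apply_gate gs v' out"
proof -
  obtain cur r es where S: "fold sim_gate gs (id, init_rel A c, []) = (cur, r, es)"
    using prod_cases3 by blast
  obtain cur' r' es' where S': "fold sim_gate gs (id, init_rel A c', []) = (cur', r', es')"
    using prod_cases3 by blast
  have es: "es' = es" "final_tag A c (cur out) = final_tag A c' (cur' out)"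
    using key by (simp_all add: sim_key_def S S')
  have 1: "fold apply_gate gs v = fold apply_gate es v \<circ> cur"
    using sim_ok_fold[OF sim_ok_init[of A v c] gs] v(1) by (simp add: S sim_ok_def)
  have 2: "fold apply_gate gs v' = fold apply_gate es v' \<circ> cur'"
    using sim_ok_fold[OF sim_ok_init[of A v' c'] gs] v(2) by (simp add: S' sim_ok_def es)
  have esA: "set es \<subseteq> A \<times> A"
    using sim_bd_fold[OF sim_bd_init[of A c] \<open>finite A\<close> gs] \<open>finite A\<close> by (simp add: S sim_bd_def)
  show ?thesis
  proof (cases "cur out \<in> A")
    case True
    then have "cur' out = cur out" using es(2) by (auto simp: final_tag_def of_bool_def split: if_splits)
    then show ?thesis using fold_apply_gate_cong[OF esA vv True] by (simp add: 1 2)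
  next
    case False
    then have f': "cur' out \<notin> A" "c (cur out) = c' (cur' out)"
      using es(2) by (auto simp: final_tag_def of_bool_def split: if_splits)
    then show ?thesis
      using v(1)[OF False] v(2)[OF f'(1)] False by (simp add: 1 2 fold_apply_gate_outside[OF esA])
  qed
qed

text \<open>The digits are shifted by one so that lists of different lengths get different numbers.\<close>

fun key_list :: "nat \<Rightarrow> (nat \<times> nat) list \<Rightarrow> nat \<Rightarrow> nat" where
  "key_list W [] k = k"
| "key_list W ((a, b) # es) k = key_list W es ((k * (W + 1) + a + 1) * (W + 1) + b + 1)"

definition key_num :: "nat \<Rightarrow> (nat \<times> nat) list \<times> nat \<Rightarrow> nat" where
  "key_num W p = key_list W (fst p) 0 * (W + 2) + snd p"

lemma key_list_append: "key_list W (es @ es') k = key_list W es' (key_list W es k)"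
  by (induction es arbitrary: k) auto

lemma mult_add_eq_iff:
  fixes a b c d W :: nat
  assumes "b < W" "d < W"
  shows "a * W + b = c * W + d \<longleftrightarrow> a = c \<and> b = d"
proof
  assume *: "a * W + b = c * W + d"
  have "(a * W + b) div W = (c * W + d) div W" "(a * W + b) mod W = (c * W + d) mod W"
    by (simp_all add: *)
  then show "a = c \<and> b = d" using assms by simp
qed simp

text \<open>The digits range over 1 to \<open>W\<close> in base \<open>W + 1\<close>. The lowest two
  digits are the last pair, so the induction runs from the end, and the absence of the digit 0
  separates the empty list from all others.\<close>

lemma key_list_inj:
  assumes "set es \<subseteq> {..<W} \<times> {..<W}" "set es' \<subseteq> {..<W} \<times> {..<W}" "key_list W es 0 = key_list W es' 0"
  shows "es = es'"
  using assms
proof (induction es arbitrary: es' rule: rev_induct)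
  case Nil
  then show ?case by (cases es' rule: rev_cases) (auto simp: key_list_append)
next
  case (snoc e es)
  obtain a b where e: "e = (a, b)" by (cases e)
  show ?case
  proof (cases es' rule: rev_cases)
    case Nil
    then show ?thesis using snoc.prems(3) by (simp add: key_list_append e)
  next
    case (snoc es2 e')
    obtain a' b' where e': "e' = (a', b')" by (cases e')
    let ?k = "key_list W es 0" and ?k' = "key_list W es2 0"
    have lt: "b + 1 < W + 1" "b' + 1 < W + 1" "a + 1 < W + 1" "a' + 1 < W + 1"
      using snoc.prems(1,2) snoc by (auto simp: e e')
    have "(?k * (W + 1) + (a + 1)) * (W + 1) + (b + 1) = (?k' * (W + 1) + (a' + 1)) * (W + 1) + (b' + 1)"
      using snoc.prems(3) snoc by (simp add: key_list_append e e' algebra_simps)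
    then have "?k * (W + 1) + (a + 1) = ?k' * (W + 1) + (a' + 1) \<and> b + 1 = b' + 1"
      using mult_add_eq_iff[OF lt(1,2)] by blast
    then have eq: "?k = ?k' \<and> a + 1 = a' + 1" "b = b'" using mult_add_eq_iff[OF lt(3,4)] by auto
    have "es = es2" using snoc.IH[of es2] snoc.prems(1,2) snoc eq by auto
    then show ?thesis using eq snoc by (simp add: e e')
  qed
qed

lemma key_num_inj:
  assumes "set es \<subseteq> {..<W} \<times> {..<W}" "set es' \<subseteq> {..<W} \<times> {..<W}" "t < W + 2" "t' < W + 2"
    "key_num W (es, t) = key_num W (es', t')"
  shows "es = es' \<and> t = t'"
  using assms key_list_inj[OF assms(1,2)] mult_add_eq_iff[OF assms(3,4)] by (simp add: key_num_def)

text \<open>The coarser base \<open>W + 2\<close> is the factor that \<open>key_num\<close> uses for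
  the tag, so that a complete key is bounded by a single power.\<close>

lemma key_list_less: "set es \<subseteq> {..<W} \<times> {..<W} \<Longrightarrow> key_list W es 0 < (W + 2) ^ (2 * length es)"
proof (induction es rule: rev_induct)
  case (snoc e es)
  obtain a b where e: "e = (a, b)" by (cases e)
  let ?k = "key_list W es 0" and ?p = "(W + 2) ^ (2 * length es)"
  have ab: "a < W" "b < W" "?k + 1 \<le> ?p" using snoc by (auto simp: e)
  have "?k * (W + 1) + a + 1 < (?k + 1) * (W + 2)" using ab by (simp add: algebra_simps)
  also have "\<dots> \<le> ?p * (W + 2)" using ab(3) by (rule mult_le_mono1)
  finally have 1: "?k * (W + 1) + a + 1 + 1 \<le> ?p * (W + 2)" by simp
  have "(?k * (W + 1) + a + 1) * (W + 1) + b + 1 < (?k * (W + 1) + a + 1 + 1) * (W + 2)"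
    using ab by (simp add: algebra_simps)
  also have "\<dots> \<le> ?p * (W + 2) * (W + 2)" using 1 by (rule mult_le_mono1)
  also have "\<dots> = (W + 2) ^ (2 * length (es @ [e]))" by simp
  finally show ?case by (simp add: key_list_append e)
qed simp

section \<open>Memory layout and evaluation\<close>

notation Seq (infixr ";;" 60)

definition EMod :: "expr \<Rightarrow> expr \<Rightarrow> expr" where
  "EMod e d = Sub e (Mul (Div e d) d)"

lemma eval_EMod [simp]: "eval_expr (EMod e d) s = eval_expr e s mod eval_expr d s"
  by (simp add: EMod_def minus_div_mult_eq_mod)

section \<open>Loading the literals of an assignment\<close>

text \<open>
  Registers 2 to 9 and 12 hold the parameters of the input and of the memory layout, 10 the rotation
  \<open>a\<close>, 11 the block length \<open>m\<close>, 13 and 14 the numbers \<open>2\<^sup>m\<close> and \<open>2\<^bsup>n-m\<^esup>\<close>, 15 and 16 the fixed and the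
  free part of the assignment in register 19.  Registers from 20 on are scratch.
\<close>

definition halve_com :: com where
  "halve_com = For 34 (Reg 32) (SetReg 33 (Div (Reg 33) (Num 2)))"

definition bit_index_com :: com where
  "bit_index_com =
     SetReg 31 (Mem (Add (Num 4) (Reg 30))) ;;
     SetReg 32 (EMod (Add (Div (Reg 31) (Num 2)) (Reg 10)) (Reg 12))"

text \<open>The second array repeats the literal value for wires fixed by the high bits and holds
  the mark 2 for wires that still vary.\<close>

definition load_com :: com where
  "load_com = For 30 (Reg 2) (
     bit_index_com ;;
     SetReg 33 (Reg 19) ;;
     halve_com ;;
     SetReg 33 (EMod (Add (Reg 33) (Reg 31)) (Num 2)) ;;
     Store (Add (Reg 5) (Reg 30)) (Reg 33) ;;
     If (Sub (Reg 11) (Reg 32)) (Store (Add (Reg 6) (Reg 30)) (Num 2))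
       (Store (Add (Reg 6) (Reg 30)) (Reg 33)))"

lemma wp_halve:
  assumes "R 32 < 2 ^ B" "R 33 < 2 ^ B"
  shows "wp B halve_com (\<lambda>k (R', M'). k \<le> 2 + R 32 * 3 \<and> M' = M \<and>
    R' = R(33 := R 33 div 2 ^ R 32, 34 := R 32)) (R, M)"
  unfolding halve_com_def
proof (rule wp_For[where N = "R 32" and T = 1 and
    I = "\<lambda>j R' M'. M' = M \<and> R' = R(33 := R 33 div 2 ^ j, 34 := j)"])
  fix j R' M'
  assume "j < R 32" and I: "M' = M \<and> R' = R(33 := R 33 div 2 ^ j, 34 := j)"
  have "R 33 div 2 ^ j div 2 < 2 ^ B"
    using assms(2) by (meson div_le_dividend le_less_trans)
  moreover have "R 33 div 2 ^ j div 2 = R 33 div 2 ^ Suc j"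
    by (metis div_mult2_eq power_Suc2)
  ultimately show "wp B (SetReg 33 (Div (Reg 33) (Num 2)))
      (\<lambda>k (R'', M''). k \<le> 1 \<and> R'' 34 = j \<and> M'' = M \<and>
        R''(34 := Suc j) = R(33 := R 33 div 2 ^ Suc j, 34 := Suc j)) (R', M')"
    using I by (auto simp: fun_eq_iff)
qed (use assms in \<open>auto simp: fun_eq_iff\<close>)

text \<open>An encoded circuit with \<open>W\<close> wires, named by their positions in the listing,
  and \<open>s\<close> gates. The three conditions on \<open>B\<close> leave room for counts up to
  \<open>2 ^ n\<close>, for literal codes and addresses up to the start of the table, and for
  keys.\<close>

locale layout =
  fixes n W s out :: nat and code ga gb :: "nat \<Rightarrow> nat" and B :: nat
  assumes n_pos: "0 < n"
    and code_less: "\<And>w. w < W \<Longrightarrow> code w < 2 * n"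
    and out_less: "out < W"
    and gates_less: "\<And>g. g < s \<Longrightarrow> ga g < W \<and> gb g < W \<and> ga g \<noteq> gb g"
    and B_n: "n + 3 \<le> B"
    and B_layout: "4 * W + 2 * s + W * W + 5 + 4 * n < 2 ^ B"
    and B_key: "(W + 2) ^ (2 * s + 2) < 2 ^ B"
begin

text \<open>The cells below \<open>VAL\<close> hold the input. The memo table begins at
  \<open>TAB\<close> and has no upper end, because the keys serve as offsets into it.\<close>

definition "VAL = 4 + W + 2 * s"
definition "TYP = VAL + W"
definition "CUR = TYP + W"
definition "REL = CUR + W"
definition "TAB = REL + W * W"

lemmas layout_defs = TAB_def REL_def CUR_def TYP_def VAL_def

lemma layout_bounds:
  "VAL < 2 ^ B" "TYP < 2 ^ B" "CUR < 2 ^ B" "REL < 2 ^ B" "TAB < 2 ^ B" "n < 2 ^ B" "4 * n < 2 ^ B"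
  "W < 2 ^ B" "s < 2 ^ B" "4 < (2::nat) ^ B"
  using B_layout unfolding layout_defs by linarith+

definition input_mem :: "(nat \<Rightarrow> nat) \<Rightarrow> bool" where
  "input_mem M \<longleftrightarrow> (\<forall>w<W. M (4 + w) = code w) \<and>
     (\<forall>g<s. M (4 + W + 2 * g) = ga g \<and> M (5 + W + 2 * g) = gb g)"

definition base_regs :: "(nat \<Rightarrow> nat) \<Rightarrow> bool" where
  "base_regs R \<longleftrightarrow> R 12 = n \<and> R 2 = W \<and> R 3 = s \<and> R 4 = out \<and> R 5 = VAL \<and> R 6 = TYP \<and> R 7 = CUR \<and>
     R 8 = REL \<and> R 9 = TAB"

lemma base_regsD:
  assumes "base_regs R"
  shows "R 12 = n" "R 2 = W" "R 3 = s" "R 4 = out" "R 5 = VAL" "R 6 = TYP" "R 7 = CUR" "R 8 = REL" "R 9 = TAB"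
  using assms by (simp_all add: base_regs_def)

lemma base_regs_cong: "base_regs R \<Longrightarrow> (\<forall>r<20. R' r = R r) \<Longrightarrow> base_regs R'"
  by (simp add: base_regs_def)

lemma input_mem_cong: "input_mem M \<Longrightarrow> (\<forall>p<VAL. M' p = M p) \<Longrightarrow> input_mem M'"
  by (simp add: input_mem_def VAL_def)

definition bit_index :: "nat \<Rightarrow> nat \<Rightarrow> nat" where
  "bit_index a w = (code w div 2 + a) mod n"

text \<open>The code of a negated literal is odd, so adding the code modulo 2 negates the bit
  exactly when required.\<close>

definition lit_bit :: "nat \<Rightarrow> nat \<Rightarrow> nat \<Rightarrow> nat" where
  "lit_bit a X w = (X div 2 ^ bit_index a w + code w) mod 2"

lemma bit_index_less: "bit_index a w < n"
  using n_pos by (simp add: bit_index_def)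

lemma lit_bit_less: "lit_bit a X w < 2"
  by (simp add: lit_bit_def)

lemma wp_bit_index:
  assumes "base_regs R" "input_mem M" "R 30 = w" "w < W" "R 10 < n"
    and "Q 2 (R(31 := code w, 32 := bit_index (R 10) w), M)"
  shows "wp B bit_index_com Q (R, M)"
proof -
  have "M (4 + w) = code w" using assms by (simp add: input_mem_def)
  moreover have "code w < 2 ^ B" "bit_index (R 10) w < 2 ^ B"
    using code_less[OF assms(4)] bit_index_less[of "R 10" w] layout_bounds(6,7) by linarith+
  ultimately show ?thesis
    using assms base_regsD[OF assms(1)] by (simp add: bit_index_com_def bit_index_def numeral_2_eq_2)
qed

definition load_time :: nat where
  "load_time = 2 + W * (3 * n + 14)"

definition load_post :: "nat \<Rightarrow> nat \<Rightarrow> nat \<Rightarrow> nat \<Rightarrow> (nat \<Rightarrow> nat) \<Rightarrow> bool" where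
  "load_post a m X i M \<longleftrightarrow> (\<forall>w<i. M (VAL + w) = lit_bit a X w) \<and>
     (\<forall>w<i. M (TYP + w) = (if bit_index a w < m then 2 else lit_bit a X w))"

lemma load_post_Suc:
  assumes "load_post a m X w M" "w < W" "t = (if bit_index a w < m then 2 else lit_bit a X w)"
  shows "load_post a m X (Suc w) (M(VAL + w := lit_bit a X w, TYP + w := t))"
  using assms by (simp add: load_post_def less_Suc_eq all_conj_distrib TYP_def)

lemma wp_load:
  assumes base: "base_regs R" and inp: "input_mem M" and a: "R 10 < n" and X: "R 19 < 2 ^ n"
  shows "wp B load_com (\<lambda>k (R', M'). k \<le> load_time \<and> (\<forall>r<30. R' r = R r) \<and>
    load_post (R 10) (R 11) (R 19) W M' \<and> (\<forall>p. p < VAL \<or> CUR \<le> p \<longrightarrow> M' p = M p)) (R, M)"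
  unfolding load_com_def
proof (rule wp_For[where N = W and T = "12 + n * 3" and
    I = "\<lambda>i R' M'. (\<forall>r<30. R' r = R r) \<and> load_post (R 10) (R 11) (R 19) i M' \<and>
      (\<forall>p. p < VAL \<or> CUR \<le> p \<longrightarrow> M' p = M p)"])
  fix w R' M'
  assume w: "w < W" and I: "(\<forall>r<30. R' r = R r) \<and> load_post (R 10) (R 11) (R 19) w M' \<and>
      (\<forall>p. p < VAL \<or> CUR \<le> p \<longrightarrow> M' p = M p)" and r: "R' 30 = w"
  have b: "base_regs R'" using base I by (auto intro: base_regs_cong)
  have i: "input_mem M'" using inp I by (auto intro: input_mem_cong)
  have bi: "bit_index (R 10) w < n" "bit_index (R 10) w < 2 ^ B"
    using bit_index_less[of "R 10" w] layout_bounds by linarith+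
  have B: "R 19 < 2 ^ B" "2 < (2::nat) ^ B"
    using X B_n power_increasing[of n B "2::nat"] layout_bounds by linarith+
  have lb: "lit_bit (R 10) (R 19) w < 2 ^ B"
    using lit_bit_less[of "R 10" "R 19" w] B(2) by linarith
  have lp: "load_post (R 10) (R 11) (R 19) w M'" using I by simp
  have ad: "VAL + w < CUR" "TYP + w < CUR" "VAL \<le> TYP + w"
    using w by (simp_all add: CUR_def TYP_def)
  show "wp B (bit_index_com ;;
     SetReg 33 (Reg 19) ;;
     halve_com ;;
     SetReg 33 (EMod (Add (Reg 33) (Reg 31)) (Num 2)) ;;
     Store (Add (Reg 5) (Reg 30)) (Reg 33) ;;
     If (Sub (Reg 11) (Reg 32)) (Store (Add (Reg 6) (Reg 30)) (Num 2))
       (Store (Add (Reg 6) (Reg 30)) (Reg 33)))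
     (\<lambda>k (R'', M''). k \<le> 12 + n * 3 \<and> R'' 30 = w \<and> (\<forall>r<30. (R''(30 := Suc w)) r = R r) \<and>
      load_post (R 10) (R 11) (R 19) (Suc w) M'' \<and> (\<forall>p. p < VAL \<or> CUR \<le> p \<longrightarrow> M'' p = M p)) (R', M')"
    apply (simp only: wp_Seq)
    apply (rule wp_bit_index[OF b i r w])
    using I a apply simp
    apply (simp only: wp_Seq wp_SetReg)
    apply (rule conjI)
    using I B apply simp
    apply (rule wp_mono[OF wp_halve])
    using I bi apply simp
    using I B apply simp
    apply (clarsimp simp: base_regsD[OF b] lit_bit_def[symmetric] lb B I r)
    using bi ad load_post_Suc[OF lp w, of 2] load_post_Suc[OF lp w, of "lit_bit (R 10) (R 19) w"]
    apply (auto simp: not_le)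
    done
qed (use assms in \<open>auto simp: base_regsD[OF base] load_post_def load_time_def layout_bounds algebra_simps\<close>)

end

section \<open>Brute-force counting of one block\<close>

definition gate_com :: com where
  "gate_com =
     SetReg 31 (Mem (Add (Add (Num 4) (Reg 2)) (Mul (Num 2) (Reg 20)))) ;;
     SetReg 32 (Mem (Add (Add (Num 5) (Reg 2)) (Mul (Num 2) (Reg 20))))"

definition eval_com :: com where
  "eval_com = For 20 (Reg 3) (
     gate_com ;;
     SetReg 31 (Add (Reg 5) (Reg 31)) ;;
     SetReg 32 (Add (Reg 5) (Reg 32)) ;;
     SetReg 33 (Mem (Reg 31)) ;;
     SetReg 34 (Mem (Reg 32)) ;;
     Store (Reg 31) (Mul (Reg 33) (Reg 34)) ;;
     Store (Reg 32) (Sub (Add (Reg 33) (Reg 34)) (Mul (Reg 33) (Reg 34))))"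

definition count_com :: com where
  "count_com =
     SetReg 17 (Num 0) ;;
     For 16 (Reg 13) (
       SetReg 19 (Add (Mul (Reg 15) (Reg 13)) (Reg 16)) ;;
       load_com ;;
       eval_com ;;
       SetReg 17 (Add (Reg 17) (Mem (Add (Reg 5) (Reg 4)))))"

context layout
begin

definition gate_list :: "nat \<Rightarrow> (nat \<times> nat) list" where
  "gate_list i = map (\<lambda>g. (ga g, gb g)) [0..<i]"

lemma gate_list_0 [simp]: "gate_list 0 = []"
  by (simp add: gate_list_def)

lemma gate_list_Suc: "gate_list (Suc i) = gate_list i @ [(ga i, gb i)]"
  by (simp add: gate_list_def)

text \<open>Being false beyond \<open>W\<close> makes numbers that are not wires constant, so they
  can be treated like the wires outside the live set.\<close>

definition lit_fun :: "nat \<Rightarrow> nat \<Rightarrow> nat \<Rightarrow> bool" where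
  "lit_fun a X w \<longleftrightarrow> w < W \<and> lit_bit a X w = 1"

definition circuit_out :: "nat \<Rightarrow> nat \<Rightarrow> bool" where
  "circuit_out a X = fold apply_gate (gate_list s) (lit_fun a X) out"

definition wire_mem :: "(nat \<Rightarrow> bool) \<Rightarrow> (nat \<Rightarrow> nat) \<Rightarrow> bool" where
  "wire_mem v M \<longleftrightarrow> (\<forall>w<W. M (VAL + w) = of_bool (v w))"

lemma one_less_B: "Suc 0 < 2 ^ B"
  using layout_bounds(10) by linarith

lemma wp_gate:
  assumes "base_regs R" "input_mem M" "R 20 = g" "g < s"
    and "Q (Suc (Suc 0)) (R(31 := ga g, 32 := gb g), M)"
  shows "wp B gate_com Q (R, M)"
proof -
  have "M (4 + W + 2 * g) = ga g" "M (5 + W + 2 * g) = gb g" using assms by (simp_all add: input_mem_def)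
  moreover have "ga g < 2 ^ B" "gb g < 2 ^ B"
    using gates_less[OF assms(4)] layout_bounds(8) by linarith+
  ultimately show ?thesis
    using assms(3,5) by (simp add: gate_com_def base_regsD[OF assms(1)])
qed

lemma wire_mem_apply_gate:
  assumes "wire_mem v M" "i < W" "j < W" "i \<noteq> j"
  shows "wire_mem (apply_gate (i, j) v) (M(VAL + i := M (VAL + i) * M (VAL + j),
    VAL + j := M (VAL + i) + M (VAL + j) - M (VAL + i) * M (VAL + j)))"
  using assms by (auto simp: wire_mem_def)

definition eval_time :: nat where
  "eval_time = 2 + s * 10"

lemma wp_eval:
  assumes base: "base_regs R" and inp: "input_mem M" and v: "wire_mem v M"
  shows "wp B eval_com (\<lambda>k (R', M'). k \<le> eval_time \<and> (\<forall>r<20. R' r = R r) \<and>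
    wire_mem (fold apply_gate (gate_list s) v) M' \<and> (\<forall>p. p < VAL \<or> TYP \<le> p \<longrightarrow> M' p = M p)) (R, M)"
  unfolding eval_com_def
proof (rule wp_For[where N = s and T = 8 and
    I = "\<lambda>i R' M'. (\<forall>r<20. R' r = R r) \<and> wire_mem (fold apply_gate (gate_list i) v) M' \<and>
      (\<forall>p. p < VAL \<or> TYP \<le> p \<longrightarrow> M' p = M p)"])
  fix g R' M'
  let ?v = "fold apply_gate (gate_list g) v"
  assume g: "g < s" and I: "(\<forall>r<20. R' r = R r) \<and> wire_mem ?v M' \<and>
      (\<forall>p. p < VAL \<or> TYP \<le> p \<longrightarrow> M' p = M p)" and r: "R' 20 = g"
  have b: "base_regs R'" using base I by (auto intro: base_regs_cong)
  have i: "input_mem M'" using inp I by (auto intro: input_mem_cong simp: TYP_def)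
  have ij: "ga g < W" "gb g < W" "ga g \<noteq> gb g" using gates_less[OF g] by auto
  have w: "wire_mem ?v M'" using I by simp
  have ad: "VAL + ga g < TYP" "VAL + gb g < TYP" "VAL \<le> TYP" using ij by (simp_all add: TYP_def)
  have ad': "VAL + ga g < 2 ^ B" "VAL + gb g < 2 ^ B" using ad layout_bounds(2) by linarith+
  have m: "M' (VAL + ga g) = of_bool (?v (ga g))" "M' (VAL + gb g) = of_bool (?v (gb g))"
    using w ij by (simp_all add: wire_mem_def)
  have mb: "M' (VAL + ga g) < 2 ^ B" "M' (VAL + gb g) < 2 ^ B" "M' (VAL + ga g) * M' (VAL + gb g) < 2 ^ B"
    "M' (VAL + ga g) + M' (VAL + gb g) - M' (VAL + ga g) * M' (VAL + gb g) < 2 ^ B"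
    unfolding m using one_less_B by (simp_all add: of_bool_def)
  have w': "wire_mem (fold apply_gate (gate_list (Suc g)) v)
      (M'(VAL + ga g := M' (VAL + ga g) * M' (VAL + gb g),
    VAL + gb g := M' (VAL + ga g) + M' (VAL + gb g) - M' (VAL + ga g) * M' (VAL + gb g)))"
    using wire_mem_apply_gate[OF w ij] by (simp add: gate_list_Suc)
  show "wp B (gate_com ;;
     SetReg 31 (Add (Reg 5) (Reg 31)) ;;
     SetReg 32 (Add (Reg 5) (Reg 32)) ;;
     SetReg 33 (Mem (Reg 31)) ;;
     SetReg 34 (Mem (Reg 32)) ;;
     Store (Reg 31) (Mul (Reg 33) (Reg 34)) ;;
     Store (Reg 32) (Sub (Add (Reg 33) (Reg 34)) (Mul (Reg 33) (Reg 34))))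
     (\<lambda>k (R'', M''). k \<le> 8 \<and> R'' 20 = g \<and> (\<forall>r<20. (R''(20 := Suc g)) r = R r) \<and>
       wire_mem (fold apply_gate (gate_list (Suc g)) v) M'' \<and>
      (\<forall>p. p < VAL \<or> TYP \<le> p \<longrightarrow> M'' p = M p)) (R', M')"
    apply (simp only: wp_Seq)
    apply (rule wp_gate[OF b i r g])
    apply (simp add: base_regsD[OF b] ad' mb r I w'[simplified])
    using ad ij by auto
qed (use assms in \<open>auto simp: base_regsD[OF base] eval_time_def layout_bounds algebra_simps\<close>)

definition count_time :: nat where
  "count_time = load_time + eval_time + 5"

definition block_count :: "nat \<Rightarrow> nat \<Rightarrow> nat \<Rightarrow> nat" where
  "block_count a m z = card {y. y < 2 ^ m \<and> circuit_out a (z * 2 ^ m + y)}"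

lemma block_count_le: "block_count a m z \<le> 2 ^ m"
proof -
  have "block_count a m z \<le> card {..<(2::nat) ^ m}"
    unfolding block_count_def by (intro card_mono) auto
  then show ?thesis by simp
qed

lemma block_index_less:
  fixes y z :: nat
  assumes "m \<le> n" "z < 2 ^ (n - m)" "y < 2 ^ m"
  shows "z * 2 ^ m + y < 2 ^ n"
proof -
  have "z * 2 ^ m + y < (z + 1) * 2 ^ m" using assms by simp
  also have "\<dots> \<le> 2 ^ (n - m) * 2 ^ m" using assms(2) by (intro mult_le_mono1) simp
  also have "\<dots> = 2 ^ n" using assms(1) by (simp flip: power_add)
  finally show ?thesis .
qed

lemma two_power_less_B: "i \<le> n + 2 \<Longrightarrow> 2 ^ i < (2::nat) ^ B"
  using B_n by simp

lemma wire_mem_load_post: "load_post a m X W M \<Longrightarrow> wire_mem (lit_fun a X) M"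
  unfolding load_post_def wire_mem_def lit_fun_def
  using lit_bit_less by (auto simp: of_bool_def less_2_cases_iff)

lemma wp_count:
  assumes base: "base_regs R" and inp: "input_mem M" and a: "R 10 = a" "a < n" and m: "R 11 = m" "m \<le> n"
    and m2: "R 13 = 2 ^ m" and z: "R 15 = z" "z < 2 ^ (n - m)"
  shows "wp B count_com (\<lambda>k (R', M'). k \<le> 3 + 2 ^ m * count_time \<and> (\<forall>r<16. R' r = R r) \<and>
    R' 17 = block_count a m z \<and> (\<forall>p. p < VAL \<or> CUR \<le> p \<longrightarrow> M' p = M p)) (R, M)"
proof -
  define c where "c i = card {y. y < i \<and> circuit_out a (z * 2 ^ m + y)}" for i
  have c_le: "c i \<le> i" for i
  proof -
    have "c i \<le> card {..<i}" unfolding c_def by (intro card_mono) auto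
    then show ?thesis by simp
  qed
  have c_Suc: "c (Suc i) = c i + of_bool (circuit_out a (z * 2 ^ m + i))" for i
  proof -
    have "{y. y < Suc i \<and> circuit_out a (z * 2 ^ m + y)} = {y. y < i \<and> circuit_out a (z * 2 ^ m + y)} \<union>
      (if circuit_out a (z * 2 ^ m + i) then {i} else {})" by (auto simp: less_Suc_eq)
    then show ?thesis by (simp add: c_def)
  qed
  have c0: "c 0 = 0" "c (2 ^ m) = block_count a m z" by (simp_all add: c_def block_count_def)
  have "wp B (For 16 (Reg 13) (
       SetReg 19 (Add (Mul (Reg 15) (Reg 13)) (Reg 16)) ;;
       load_com ;;
       eval_com ;;
       SetReg 17 (Add (Reg 17) (Mem (Add (Reg 5) (Reg 4))))))
     (\<lambda>k (R', M'). k \<le> 2 + 2 ^ m * count_time \<and> (\<forall>r<16. R' r = R r) \<and>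
    R' 17 = block_count a m z \<and> (\<forall>p. p < VAL \<or> CUR \<le> p \<longrightarrow> M' p = M p)) (R(17 := 0), M)"
  proof (rule wp_For[where N = "2 ^ m" and T = "load_time + eval_time + 2" and
      I = "\<lambda>i R' M'. (\<forall>r<16. R' r = R r) \<and> R' 17 = c i \<and> (\<forall>p. p < VAL \<or> CUR \<le> p \<longrightarrow> M' p = M p)"])
    fix y R' M'
    assume y: "y < 2 ^ m" and I: "(\<forall>r<16. R' r = R r) \<and> R' 17 = c y \<and>
      (\<forall>p. p < VAL \<or> CUR \<le> p \<longrightarrow> M' p = M p)" and r: "R' 16 = y"
    let ?X = "z * 2 ^ m + y"
    have X: "?X < 2 ^ n" by (rule block_index_less[OF m(2) z(2) y])
    have XB: "?X < 2 ^ B" using X two_power_less_B[of n] by linarith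
    have cB: "c y + of_bool P < 2 ^ B" for P
    proof -
      have "c y + of_bool P \<le> 2 ^ m" using c_le[of y] y by (simp add: of_bool_def)
      also have "\<dots> < 2 ^ B" using two_power_less_B[of m] m(2) by simp
      finally show ?thesis .
    qed
    let ?R = "R'(19 := ?X)"
    have b: "base_regs ?R" using base I by (auto intro: base_regs_cong simp: base_regs_def)
    have i: "input_mem M'" using inp I by (auto intro: input_mem_cong)
    show "wp B (SetReg 19 (Add (Mul (Reg 15) (Reg 13)) (Reg 16)) ;;
       load_com ;;
       eval_com ;;
       SetReg 17 (Add (Reg 17) (Mem (Add (Reg 5) (Reg 4)))))
       (\<lambda>k (R'', M''). k \<le> load_time + eval_time + 2 \<and> R'' 16 = y \<and>
       (\<forall>r<16. (R''(16 := Suc y)) r = R r) \<and> (R''(16 := Suc y)) 17 = c (Suc y) \<and>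
      (\<forall>p. p < VAL \<or> CUR \<le> p \<longrightarrow> M'' p = M p)) (R', M')"
      apply (simp only: wp_Seq wp_SetReg)
      apply (rule conjI)
       apply (simp add: I z m2 r XB)
      apply (simp add: I z m2 r del: wp_Seq)
      apply (rule wp_mono[OF wp_load[OF b i]])
        apply (simp add: I a)
       apply (simp add: X)
      apply (clarsimp)
      subgoal for k1 R1 M1
        apply (rule wp_mono[OF wp_eval[where v = "lit_fun a ?X"]])
           apply (rule base_regs_cong[OF b], simp)
          apply (rule input_mem_cong[OF i], simp)
         apply (rule wire_mem_load_post[where m = "R 11"])
        using I a apply simp
        apply clarsimp
        subgoal for k2 R2 M2
          using I cB[of "circuit_out a ?X"] out_less layout_bounds
          by (auto simp: c_Suc r base_regsD[OF base] wire_mem_def circuit_out_def TYP_def CUR_def)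
        done
      done
  qed (use assms B_n in \<open>auto simp: c0 count_time_def algebra_simps\<close>)
  then show ?thesis
    unfolding count_com_def wp_Seq wp_SetReg
    by (intro conjI) (simp, rule wp_mono, simp, auto)
qed

end

section \<open>Computing the key of a restriction\<close>

definition rel_addr :: "nat \<Rightarrow> nat \<Rightarrow> expr" where
  "rel_addr a b = Add (Reg 8) (Add (Mul (Reg a) (Reg 2)) (Reg b))"

text \<open>Under truncated subtraction at most one of the two differences is nonzero, and their sum
  vanishes exactly for equal values. The double complement in \<open>Or3\<close> truncates a sum to
  0 or 1.\<close>

definition Eq :: "expr \<Rightarrow> expr \<Rightarrow> expr" where
  "Eq e f = Sub (Num 1) (Add (Sub e f) (Sub f e))"

definition Or3 :: "expr \<Rightarrow> expr \<Rightarrow> expr \<Rightarrow> expr" where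
  "Or3 e f g = Sub (Num 1) (Sub (Num 1) (Add e (Add f g)))"

lemma eval_Eq [simp]: "eval_expr (Eq e f) s = of_bool (eval_expr e s = eval_expr f s)"
  by (auto simp: Eq_def of_bool_def)

lemma eval_Or3 [simp]:
  "eval_expr (Or3 e f g) s = of_bool (eval_expr e s \<noteq> 0 \<or> eval_expr f s \<noteq> 0 \<or> eval_expr g s \<noteq> 0)"
  by (auto simp: Or3_def of_bool_def)

text \<open>A live wire has type 2, so the tests for 0 and 1 pick out exactly the wires that hold
  these constants.\<close>

definition init_rel_com :: com where
  "init_rel_com = For 20 (Reg 2) (For 21 (Reg 2)
     (Store (rel_addr 20 21) (Or3 (Eq (Reg 20) (Reg 21)) (Eq (Mem (Add (Reg 6) (Reg 20))) (Num 0))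
       (Eq (Mem (Add (Reg 6) (Reg 21))) (Num 1)))))"

definition init_cur_com :: com where
  "init_cur_com = For 20 (Reg 2) (Store (Add (Reg 7) (Reg 20)) (Reg 20))"

definition col_com :: com where
  "col_com = For 21 (Reg 2) (
     SetReg 35 (Mem (rel_addr 21 33)) ;;
     SetReg 36 (Mem (rel_addr 21 34)) ;;
     Store (rel_addr 21 33) (Mul (Reg 35) (Reg 36)) ;;
     Store (rel_addr 21 34) (Sub (Add (Reg 35) (Reg 36)) (Mul (Reg 35) (Reg 36))))"

definition row_com :: com where
  "row_com = For 21 (Reg 2) (
     SetReg 35 (Mem (rel_addr 33 21)) ;;
     SetReg 36 (Mem (rel_addr 34 21)) ;;
     Store (rel_addr 33 21) (Sub (Add (Reg 35) (Reg 36)) (Mul (Reg 35) (Reg 36))) ;;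
     Store (rel_addr 34 21) (Mul (Reg 35) (Reg 36)))"

text \<open>The reduced circuit is never stored as a list: register 1 accumulates its number, and
  emitting a gate appends two digits. The last store restores the reflexive pair.\<close>

definition emit_com :: com where
  "emit_com =
     SetReg 1 (Add (Mul (Add (Mul (Reg 1) (Add (Reg 2) (Num 1))) (Add (Reg 33) (Num 1))) (Add (Reg 2) (Num 1)))
       (Add (Reg 34) (Num 1))) ;;
     col_com ;;
     row_com ;;
     Store (rel_addr 33 33) (Num 1)"

definition sim_com :: com where
  "sim_com =
     gate_com ;;
     SetReg 31 (Add (Reg 7) (Reg 31)) ;;
     SetReg 32 (Add (Reg 7) (Reg 32)) ;;
     SetReg 33 (Mem (Reg 31)) ;;
     SetReg 34 (Mem (Reg 32)) ;;
     If (Mem (rel_addr 33 34)) Skip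
       (If (Mem (rel_addr 34 33)) (Store (Reg 31) (Reg 34) ;; Store (Reg 32) (Reg 33)) emit_com)"

definition tag_com :: com where
  "tag_com =
     SetReg 31 (Mem (Add (Reg 7) (Reg 4))) ;;
     SetReg 32 (Mem (Add (Reg 6) (Reg 31))) ;;
     If (Eq (Reg 32) (Num 2)) (SetReg 32 (Add (Reg 31) (Num 2))) Skip ;;
     SetReg 1 (Add (Mul (Reg 1) (Add (Reg 2) (Num 2))) (Reg 32))"

text \<open>The low bits are set to 0. They influence live wires only, whose values do not enter the
  key.\<close>

definition key_com :: com where
  "key_com =
     SetReg 19 (Mul (Reg 15) (Reg 13)) ;;
     load_com ;;
     init_cur_com ;;
     init_rel_com ;;
     SetReg 1 (Num 0) ;;
     For 20 (Reg 3) sim_com ;;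
     tag_com"

context layout
begin

section \<open>Verification of one simulation step\<close>

definition rel_pos :: "nat \<Rightarrow> nat \<Rightarrow> nat" where
  "rel_pos a b = REL + (a * W + b)"

lemma eval_rel_addr:
  "base_regs R \<Longrightarrow> eval_expr (rel_addr a b) (R, M) = rel_pos (R a) (R b)"
  by (simp add: rel_addr_def rel_pos_def base_regsD)

lemma rel_pos_eq_iff: "b < W \<Longrightarrow> d < W \<Longrightarrow> rel_pos a b = rel_pos c d \<longleftrightarrow> a = c \<and> b = d"
  using mult_add_eq_iff[of b W d a c] by (simp add: rel_pos_def)

lemma rel_pos_bounds:
  assumes "a < W" "b < W"
  shows "REL \<le> rel_pos a b" "rel_pos a b < TAB"
proof -
  have "a * W + b < (a + 1) * W" using assms by simp
  also have "\<dots> \<le> W * W" using assms(1) by (intro mult_le_mono1) simp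
  finally show "rel_pos a b < TAB" by (simp add: rel_pos_def TAB_def)
qed (simp add: rel_pos_def)

definition rel_mem :: "(nat \<Rightarrow> nat \<Rightarrow> bool) \<Rightarrow> (nat \<Rightarrow> nat) \<Rightarrow> bool" where
  "rel_mem r M \<longleftrightarrow> (\<forall>a<W. \<forall>b<W. M (rel_pos a b) = of_bool (r a b))"

lemma rel_mem_upd:
  assumes "rel_mem r M" "a < W" "b < W"
    and "\<And>x y. x < W \<Longrightarrow> y < W \<Longrightarrow> r' x y = (if x = a \<and> y = b then P else r x y)"
  shows "rel_mem r' (M(rel_pos a b := of_bool P))"
  using assms by (auto simp: rel_mem_def rel_pos_eq_iff)

text \<open>The matrix can be rewritten in place: each row depends on its own two entries only, and
  these are copied to registers before either is overwritten.\<close>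

lemma wp_col:
  assumes base: "base_regs R" and r: "rel_mem r M" and a: "R 33 = a" "R 34 = b" "a < W" "b < W" "a \<noteq> b"
  shows "wp B col_com (\<lambda>k (R', M'). k \<le> 2 + W * 6 \<and> (\<forall>r. r \<notin> {21, 35, 36} \<longrightarrow> R' r = R r) \<and>
    rel_mem (col_update a b r) M' \<and> (\<forall>p. p < REL \<or> TAB \<le> p \<longrightarrow> M' p = M p)) (R, M)"
  unfolding col_com_def
proof (rule wp_For[where N = W and T = 4 and
    I = "\<lambda>i R' M'. (\<forall>r. r \<notin> {21, 35, 36} \<longrightarrow> R' r = R r) \<and>
      rel_mem (\<lambda>x y. if x < i then col_update a b r x y else r x y) M' \<and>
      (\<forall>p. p < REL \<or> TAB \<le> p \<longrightarrow> M' p = M p)"])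
  fix i R' M'
  assume i: "i < W" and I: "(\<forall>r. r \<notin> {21, 35, 36} \<longrightarrow> R' r = R r) \<and>
      rel_mem (\<lambda>x y. if x < i then col_update a b r x y else r x y) M' \<and>
      (\<forall>p. p < REL \<or> TAB \<le> p \<longrightarrow> M' p = M p)" and ri: "R' 21 = i"
  have b: "base_regs R'" using base I by (auto simp: base_regs_def)
  have b': "base_regs (R'(35 := x))" "base_regs (R'(35 := x, 36 := y))" for x y
    using b by (simp_all add: base_regs_def)
  let ?r = "\<lambda>x y. if x < i then col_update a b r x y else r x y"
  have m: "M' (rel_pos i a) = of_bool (r i a)" "M' (rel_pos i b) = of_bool (r i b)"
    using I i a by (auto simp: rel_mem_def)
  have ad: "REL \<le> rel_pos i a" "rel_pos i a < TAB" "REL \<le> rel_pos i b" "rel_pos i b < TAB"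
    using rel_pos_bounds i a by auto
  have 1: "rel_mem (\<lambda>x y. if x = i \<and> y = a then r i a \<and> r i b else ?r x y)
      (M'(rel_pos i a := of_bool (r i a \<and> r i b)))"
    using I i a by (intro rel_mem_upd[where r = ?r]) auto
  define r2 where "r2 = (\<lambda>x y. if x < Suc i then col_update a b r x y else r x y)"
  have 2: "rel_mem r2
      (M'(rel_pos i a := of_bool (r i a \<and> r i b), rel_pos i b := of_bool (r i a \<or> r i b)))"
    by (rule rel_mem_upd[OF 1 i a(4)]) (use a in \<open>auto simp: r2_def col_update_def less_Suc_eq\<close>)
  show "wp B (SetReg 35 (Mem (rel_addr 21 33)) ;;
     SetReg 36 (Mem (rel_addr 21 34)) ;;
     Store (rel_addr 21 33) (Mul (Reg 35) (Reg 36)) ;;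
     Store (rel_addr 21 34) (Sub (Add (Reg 35) (Reg 36)) (Mul (Reg 35) (Reg 36))))
     (\<lambda>k (R'', M''). k \<le> 4 \<and> R'' 21 = i \<and> (\<forall>r. r \<notin> {21, 35, 36} \<longrightarrow> (R''(21 := Suc i)) r = R r) \<and>
      rel_mem (\<lambda>x y. if x < Suc i then col_update a b r x y else r x y) M'' \<and>
      (\<forall>p. p < REL \<or> TAB \<le> p \<longrightarrow> M'' p = M p)) (R', M')"
    unfolding r2_def[symmetric]
    using I 2 ad one_less_B
    by (cases "r i a"; cases "r i b") (simp_all add: eval_rel_addr b b' ri a m)
qed (use assms in \<open>auto simp: base_regsD[OF base] layout_bounds base_regs_def rel_mem_def\<close>)

lemma wp_row:
  assumes base: "base_regs R" and r: "rel_mem r M" and a: "R 33 = a" "R 34 = b" "a < W" "b < W" "a \<noteq> b"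
  shows "wp B row_com (\<lambda>k (R', M'). k \<le> 2 + W * 6 \<and> (\<forall>r. r \<notin> {21, 35, 36} \<longrightarrow> R' r = R r) \<and>
    rel_mem (row_update a b r) M' \<and> (\<forall>p. p < REL \<or> TAB \<le> p \<longrightarrow> M' p = M p)) (R, M)"
  unfolding row_com_def
proof (rule wp_For[where N = W and T = 4 and
    I = "\<lambda>i R' M'. (\<forall>r. r \<notin> {21, 35, 36} \<longrightarrow> R' r = R r) \<and>
      rel_mem (\<lambda>x y. if y < i then row_update a b r x y else r x y) M' \<and>
      (\<forall>p. p < REL \<or> TAB \<le> p \<longrightarrow> M' p = M p)"])
  fix i R' M'
  assume i: "i < W" and I: "(\<forall>r. r \<notin> {21, 35, 36} \<longrightarrow> R' r = R r) \<and>
      rel_mem (\<lambda>x y. if y < i then row_update a b r x y else r x y) M' \<and>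
      (\<forall>p. p < REL \<or> TAB \<le> p \<longrightarrow> M' p = M p)" and ri: "R' 21 = i"
  have b: "base_regs R'" using base I by (auto simp: base_regs_def)
  have b': "base_regs (R'(35 := x))" "base_regs (R'(35 := x, 36 := y))" for x y
    using b by (simp_all add: base_regs_def)
  let ?r = "\<lambda>x y. if y < i then row_update a b r x y else r x y"
  have m: "M' (rel_pos a i) = of_bool (r a i)" "M' (rel_pos b i) = of_bool (r b i)"
    using I i a by (auto simp: rel_mem_def)
  have ad: "REL \<le> rel_pos a i" "rel_pos a i < TAB" "REL \<le> rel_pos b i" "rel_pos b i < TAB"
    using rel_pos_bounds i a by auto
  have 1: "rel_mem (\<lambda>x y. if x = a \<and> y = i then r a i \<or> r b i else ?r x y)
      (M'(rel_pos a i := of_bool (r a i \<or> r b i)))"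
    using I i a by (intro rel_mem_upd[where r = ?r]) auto
  define r2 where "r2 = (\<lambda>x y. if y < Suc i then row_update a b r x y else r x y)"
  have 2: "rel_mem r2
      (M'(rel_pos a i := of_bool (r a i \<or> r b i), rel_pos b i := of_bool (r a i \<and> r b i)))"
    by (rule rel_mem_upd[OF 1 a(4) i]) (use a in \<open>auto simp: r2_def row_update_def less_Suc_eq\<close>)
  show "wp B (SetReg 35 (Mem (rel_addr 33 21)) ;;
     SetReg 36 (Mem (rel_addr 34 21)) ;;
     Store (rel_addr 33 21) (Sub (Add (Reg 35) (Reg 36)) (Mul (Reg 35) (Reg 36))) ;;
     Store (rel_addr 34 21) (Mul (Reg 35) (Reg 36)))
     (\<lambda>k (R'', M''). k \<le> 4 \<and> R'' 21 = i \<and> (\<forall>r. r \<notin> {21, 35, 36} \<longrightarrow> (R''(21 := Suc i)) r = R r) \<and>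
      rel_mem (\<lambda>x y. if y < Suc i then row_update a b r x y else r x y) M'' \<and>
      (\<forall>p. p < REL \<or> TAB \<le> p \<longrightarrow> M'' p = M p)) (R', M')"
    unfolding r2_def[symmetric]
    using I 2 ad one_less_B
    by (cases "r a i"; cases "r b i") (simp_all add: eval_rel_addr b b' ri a m)
qed (use assms in \<open>auto simp: base_regsD[OF base] layout_bounds base_regs_def rel_mem_def\<close>)

definition key_step :: "nat \<Rightarrow> nat \<Rightarrow> nat \<Rightarrow> nat" where
  "key_step k a b = (k * (W + 1) + a + 1) * (W + 1) + b + 1"

lemma wp_emit:
  assumes base: "base_regs R" and r: "rel_mem r M" and a: "R 33 = a" "R 34 = b" "a < W" "b < W" "a \<noteq> b"
    and k: "key_step (R 1) a b < 2 ^ B"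
  shows "wp B emit_com (\<lambda>k (R', M'). k \<le> 6 + W * 12 \<and> (\<forall>r. r \<notin> {1, 21, 35, 36} \<longrightarrow> R' r = R r) \<and>
    R' 1 = key_step (R 1) a b \<and>
    rel_mem (rel_update a b r) M' \<and> (\<forall>p. p < REL \<or> TAB \<le> p \<longrightarrow> M' p = M p)) (R, M)"
proof -
  let ?R = "R(1 := key_step (R 1) a b)"
  have b: "base_regs ?R" using base by (simp add: base_regs_def)
  have ev: "eval_expr (Add (Mul (Add (Mul (Reg 1) (Add (Reg 2) (Num 1))) (Add (Reg 33) (Num 1))) (Add (Reg 2) (Num 1)))
       (Add (Reg 34) (Num 1))) (R, M) = key_step (R 1) a b"
    using a by (simp add: key_step_def base_regsD[OF base])
  have ad: "REL \<le> rel_pos a a" "rel_pos a a < TAB" using rel_pos_bounds a by auto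
  have a': "?R 33 = a" "?R 34 = b" using a by simp_all
  show ?thesis
    unfolding emit_com_def wp_Seq
  proof (subst wp_SetReg, unfold ev, intro conjI k, rule wp_mono[OF wp_col[OF b r a' a(3-5)]], goal_cases)
    case (1 k1 S1)
    obtain R1 M1 where S1: "S1 = (R1, M1)" by (cases S1)
    have 1: "k1 \<le> 2 + W * 6" "\<forall>r. r \<notin> {21, 35, 36} \<longrightarrow> R1 r = ?R r" "rel_mem (col_update a b r) M1"
      "\<forall>p. p < REL \<or> TAB \<le> p \<longrightarrow> M1 p = M p" using 1 by (auto simp: S1)
    note c1 = 1
    have b1: "base_regs R1" using b 1(2) by (simp add: base_regs_def)
    have a1: "R1 33 = a" "R1 34 = b" using 1(2) a by simp_all
    show ?case unfolding S1
    proof (rule wp_mono[OF wp_row[OF b1 1(3) a1 a(3-5)]], goal_cases)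
      case (1 k2 S2)
      obtain R2 M2 where S2: "S2 = (R2, M2)" by (cases S2)
      have 2: "k2 \<le> 2 + W * 6" "\<forall>r. r \<notin> {21, 35, 36} \<longrightarrow> R2 r = R1 r"
        "rel_mem (row_update a b (col_update a b r)) M2"
        "\<forall>p. p < REL \<or> TAB \<le> p \<longrightarrow> M2 p = M1 p" using 1 by (auto simp: S2)
      have b2: "base_regs R2" using b1 2(2) by (simp add: base_regs_def)
      have "rel_mem (rel_update a b r) (M2(rel_pos a a := of_bool True))"
        by (rule rel_mem_upd[OF 2(3)]) (use a in \<open>auto simp: rel_update_def\<close>)
      then show ?case using c1 2 a ad one_less_B by (simp add: S2 eval_rel_addr[OF b2])
    qed
  qed
qed

definition cur_mem :: "(nat \<Rightarrow> nat) \<Rightarrow> (nat \<Rightarrow> nat) \<Rightarrow> bool" where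
  "cur_mem cur M \<longleftrightarrow> (\<forall>w<W. M (CUR + w) = cur w)"

definition sim_mem :: "sim_state \<Rightarrow> nat \<Rightarrow> (nat \<Rightarrow> nat) \<Rightarrow> bool" where
  "sim_mem S k M \<longleftrightarrow> (case S of (cur, r, es) \<Rightarrow> cur_mem cur M \<and> rel_mem r M \<and> k = key_list W es 0)"

text \<open>The crude bound by the number of gates read keeps the bit length of a key polynomial.
  Counting the keys calls for the finer bound in \<open>sim_bd\<close>.\<close>

definition sim_valid :: "nat \<Rightarrow> sim_state \<Rightarrow> bool" where
  "sim_valid i S \<longleftrightarrow> (case S of (cur, r, es) \<Rightarrow> inj cur \<and> (\<forall>x. r x x) \<and> (\<forall>w<W. cur w < W) \<and>
     set es \<subseteq> {..<W} \<times> {..<W} \<and> length es \<le> i)"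

lemma sim_valid_Suc: "sim_valid i S \<Longrightarrow> i < s \<Longrightarrow> sim_valid (Suc i) (sim_gate (ga i, gb i) S)"
proof -
  assume a: "sim_valid i S" "i < s"
  obtain cur r es where S: "S = (cur, r, es)" by (cases S)
  show ?thesis
    using a gates_less[OF a(2)] inj_swap[of cur] rel_update_refl[of r]
    by (auto simp: sim_valid_def S)
qed

lemma key_list_less_B:
  assumes "sim_valid i (cur, r, es)" "i \<le> s" "t < W + 2"
  shows "key_list W es 0 * (W + 2) + t < 2 ^ B" "key_list W es 0 < 2 ^ B"
proof -
  have es: "set es \<subseteq> {..<W} \<times> {..<W}" "length es \<le> s" using assms by (auto simp: sim_valid_def)
  have "key_list W es 0 * (W + 2) + t < (key_list W es 0 + 1) * (W + 2)" using assms(3) by simp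
  also have "\<dots> \<le> (W + 2) ^ (2 * length es) * (W + 2)"
    using key_list_less[OF es(1)] by (intro mult_le_mono1) simp
  also have "\<dots> = (W + 2) ^ (2 * length es + 1)" by simp
  also have "\<dots> \<le> (W + 2) ^ (2 * s + 2)" using es(2) by (intro power_increasing) auto
  finally show 1: "key_list W es 0 * (W + 2) + t < 2 ^ B" using B_key by linarith
  have "key_list W es 0 * 1 \<le> key_list W es 0 * (W + 2)" by (rule mult_le_mono2) simp
  then show "key_list W es 0 < 2 ^ B" using 1 by linarith
qed

lemma wp_sim:
  assumes base: "base_regs R" and inp: "input_mem M" and g: "R 20 = g" "g < s"
    and S: "sim_mem S (R 1) M" "sim_valid g S"
  shows "wp B sim_com (\<lambda>k (R', M'). k \<le> 14 + W * 12 \<and> (\<forall>r<20. r \<noteq> 1 \<longrightarrow> R' r = R r) \<and> R' 20 = g \<and>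
    sim_mem (sim_gate (ga g, gb g) S) (R' 1) M' \<and> (\<forall>p. p < CUR \<or> TAB \<le> p \<longrightarrow> M' p = M p)) (R, M)"
proof -
  obtain cur r es where S': "S = (cur, r, es)" by (cases S)
  have v: "inj cur" "\<And>x. r x x" "\<And>w. w < W \<Longrightarrow> cur w < W"
    using S(2) by (auto simp: S' sim_valid_def)
  have m: "cur_mem cur M" "rel_mem r M" "R 1 = key_list W es 0"
    using S(1) by (auto simp: S' sim_mem_def)
  have ij: "ga g < W" "gb g < W" "ga g \<noteq> gb g" using gates_less[OF g(2)] by auto
  define a b where "a = cur (ga g)" and "b = cur (gb g)"
  have ab: "a < W" "b < W" "a \<noteq> b" using v ij by (auto simp: a_def b_def inj_def)
  have ad: "CUR \<le> CUR + ga g" "CUR + ga g < REL" "CUR \<le> CUR + gb g" "CUR + gb g < REL"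
    "CUR + ga g < 2 ^ B" "CUR + gb g < 2 ^ B" "REL \<le> TAB" "CUR \<le> REL"
    using ij layout_bounds(4) by (auto simp: REL_def TAB_def)
  have Mab: "M (CUR + ga g) = a" "M (CUR + gb g) = b"
    using m(1) ij by (simp_all add: cur_mem_def a_def b_def)
  have abB: "a < 2 ^ B" "b < 2 ^ B" using ab layout_bounds(8) by linarith+
  have rab: "M (rel_pos a b) = of_bool (r a b)" "M (rel_pos b a) = of_bool (r b a)"
    using m(2) ab by (auto simp: rel_mem_def)
  let ?R = "R(31 := CUR + ga g, 32 := CUR + gb g, 33 := a, 34 := b)"
  have b: "base_regs ?R" using base by (simp add: base_regs_def)
  \<comment> \<open>All three cases share the six steps that fetch the gate and the slots of its
    wires; \<open>start\<close> removes this prefix.\<close>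
  have start: "wp B sim_com Q (R, M)"
    if *: "wp B (If (Mem (rel_addr 33 34)) Skip
       (If (Mem (rel_addr 34 33)) (Store (Reg 31) (Reg 34) ;; Store (Reg 32) (Reg 33)) emit_com))
       (\<lambda>k. Q (Suc (Suc (Suc (Suc (Suc (Suc k))))))) (?R, M)" for Q
    unfolding sim_com_def wp_Seq
    apply (rule wp_gate[OF base inp g])
    using * by (simp add: base_regsD[OF base] ad abB Mab fun_upd_twist del: wp_If)
  show ?thesis
  proof (cases "r a b")
    case True
    then have "sim_gate (ga g, gb g) S = S" by (simp add: S' a_def b_def)
    then show ?thesis
      by (intro start) (use True S g in \<open>simp add: eval_rel_addr[OF b] rab\<close>)
  next
    case nab: False
    show ?thesis
    proof (cases "r b a")
      case True
      then have S1: "sim_gate (ga g, gb g) S = (cur(ga g := b, gb g := a), r, es)"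
        using nab by (simp add: S' a_def b_def)
      have "cur_mem (cur(ga g := b, gb g := a)) (M(CUR + ga g := b, CUR + gb g := a))"
        using m(1) ij by (auto simp: cur_mem_def)
      moreover have "rel_mem r (M(CUR + ga g := b, CUR + gb g := a))"
        unfolding rel_mem_def
      proof (intro allI impI)
        fix x y assume "x < W" "y < W"
        then show "(M(CUR + ga g := b, CUR + gb g := a)) (rel_pos x y) = of_bool (r x y)"
          using m(2) rel_pos_bounds[of x y] ad by (auto simp: rel_mem_def)
      qed
      ultimately have "sim_mem (sim_gate (ga g, gb g) S) (R 1) (M(CUR + ga g := b, CUR + gb g := a))"
        unfolding S1 sim_mem_def using m(3) by simp
      then show ?thesis
        by (intro start)
          (use True nab g ad abB in \<open>auto simp add: eval_rel_addr[OF b] rab\<close>)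
    next
      case False
      then have S1: "sim_gate (ga g, gb g) S = (cur, rel_update a b r, es @ [(a, b)])"
        using nab by (simp add: S' a_def b_def)
      have ks: "key_step (R 1) a b = key_list W (es @ [(a, b)]) 0"
        unfolding m(3) by (simp add: key_step_def key_list_append)
      have "sim_valid (Suc g) (cur, rel_update a b r, es @ [(a, b)])"
        using sim_valid_Suc[OF S(2) g(2)] S1 by simp
      then have kB: "key_step (?R 1) a b < 2 ^ B"
        using key_list_less_B(2)[of "Suc g" cur _ "es @ [(a, b)]" 0] g(2) ks by simp
      have "wp B emit_com (\<lambda>k (R', M'). k \<le> 6 + W * 12 \<and> (\<forall>r. r \<notin> {1, 21, 35, 36} \<longrightarrow> R' r = ?R r) \<and>
        R' 1 = key_step (?R 1) a b \<and> rel_mem (rel_update a b r) M' \<and>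
        (\<forall>p. p < REL \<or> TAB \<le> p \<longrightarrow> M' p = M p)) (?R, M)"
        by (rule wp_emit[OF b m(2) _ _ ab kB]) simp_all
      then have "wp B emit_com (\<lambda>k (R', M'). k + 8 \<le> 14 + W * 12 \<and> (\<forall>r<20. r \<noteq> 1 \<longrightarrow> R' r = R r) \<and> R' 20 = g \<and>
        sim_mem (sim_gate (ga g, gb g) S) (R' 1) M' \<and> (\<forall>p. p < CUR \<or> TAB \<le> p \<longrightarrow> M' p = M p)) (?R, M)"
      proof (rule wp_mono, goal_cases)
        case (1 k1 S1')
        obtain R1 M1 where S1': "S1' = (R1, M1)" by (cases S1')
        have *: "k1 \<le> 6 + W * 12" "\<forall>r. r \<notin> {1, 21, 35, 36} \<longrightarrow> R1 r = ?R r"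
          "R1 1 = key_step (R 1) a b" "rel_mem (rel_update a b r) M1"
          "\<forall>p. p < REL \<or> TAB \<le> p \<longrightarrow> M1 p = M p" using 1 by (auto simp: S1')
        have "cur_mem cur M1" using m(1) *(5) by (simp add: cur_mem_def REL_def)
        then have "sim_mem (sim_gate (ga g, gb g) S) (R1 1) M1"
          unfolding S1 sim_mem_def using * ks by simp
        then show ?case using * g ad by (simp add: S1')
      qed
      then show ?thesis
        by (intro start) (simp add: eval_rel_addr[OF b] rab nab False)
    qed
  qed
qed

section \<open>The key of a block of assignments\<close>

definition live :: "nat \<Rightarrow> nat \<Rightarrow> nat set" where
  "live a m = {w. w < W \<and> bit_index a w < m}"

lemma finite_live: "finite (live a m)"
  by (simp add: live_def)

definition sim :: "nat \<Rightarrow> nat \<Rightarrow> nat \<Rightarrow> nat \<Rightarrow> sim_state" where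
  "sim a m X i = fold sim_gate (gate_list i) (id, init_rel (live a m) (lit_fun a X), [])"

lemma gate_list_neq: "i \<le> s \<Longrightarrow> \<forall>g\<in>set (gate_list i). fst g \<noteq> snd g"
  using gates_less by (auto simp: gate_list_def)

lemma sim_valid_sim: "i \<le> s \<Longrightarrow> sim_valid i (sim a m X i)"
proof (induction i)
  case 0
  then show ?case by (auto simp: sim_valid_def sim_def init_rel_def)
next
  case (Suc i)
  then show ?case using sim_valid_Suc[of i "sim a m X i"] by (simp add: sim_def gate_list_Suc)
qed

definition block_key :: "nat \<Rightarrow> nat \<Rightarrow> nat \<Rightarrow> nat" where
  "block_key a m z = key_num W (sim_key (live a m) (lit_fun a (z * 2 ^ m)) (gate_list s) out)"

lemma wp_init_cur:
  assumes base: "base_regs R"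
  shows "wp B init_cur_com (\<lambda>k (R', M'). k \<le> 2 + W * 3 \<and> (\<forall>r<20. R' r = R r) \<and> cur_mem id M' \<and>
    (\<forall>p. p < CUR \<or> REL \<le> p \<longrightarrow> M' p = M p)) (R, M)"
  unfolding init_cur_com_def
proof (rule wp_For[where N = W and T = 1 and I = "\<lambda>i R' M'. (\<forall>r<20. R' r = R r) \<and>
    (\<forall>w<i. M' (CUR + w) = w) \<and> (\<forall>p. p < CUR \<or> REL \<le> p \<longrightarrow> M' p = M p)"])
  fix i R' M'
  assume i: "i < W" and I: "(\<forall>r<20. R' r = R r) \<and>
    (\<forall>w<i. M' (CUR + w) = w) \<and> (\<forall>p. p < CUR \<or> REL \<le> p \<longrightarrow> M' p = M p)" and r: "R' 20 = i"
  have b: "base_regs R'" using base I by (auto intro: base_regs_cong)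
  have "i < 2 ^ B" using i layout_bounds(8) by linarith
  then show "wp B (Store (Add (Reg 7) (Reg 20)) (Reg 20))
     (\<lambda>k (R'', M''). k \<le> 1 \<and> R'' 20 = i \<and> (\<forall>r<20. (R''(20 := Suc i)) r = R r) \<and>
       (\<forall>w<Suc i. M'' (CUR + w) = w) \<and> (\<forall>p. p < CUR \<or> REL \<le> p \<longrightarrow> M'' p = M p)) (R', M')"
    using I i by (auto simp: r base_regsD[OF b] less_Suc_eq REL_def)
qed (use assms in \<open>auto simp: base_regsD[OF base] layout_bounds cur_mem_def\<close>)

lemma wp_init_rel:
  assumes base: "base_regs R" and l: "load_post a m X W M"
  shows "wp B init_rel_com (\<lambda>k (R', M'). k \<le> 2 + W * (4 + W * 3) \<and> (\<forall>r<20. R' r = R r) \<and>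
    rel_mem (init_rel (live a m) (lit_fun a X)) M' \<and>
    (\<forall>p. p < REL \<or> TAB \<le> p \<longrightarrow> M' p = M p)) (R, M)"
proof -
  define r where "r = init_rel (live a m) (lit_fun a X)"
  \<comment> \<open>The pairs processed so far are those that precede \<open>(i, j)\<close>
    lexicographically, so one invariant serves both nested loops.\<close>
  define I where "I i j R' M' \<longleftrightarrow> (\<forall>r<20. R' r = R r) \<and>
    (\<forall>x<W. \<forall>y<W. x < i \<or> (x = i \<and> y < j) \<longrightarrow> M' (rel_pos x y) = of_bool (r x y)) \<and>
    (\<forall>p. p < REL \<or> TAB \<le> p \<longrightarrow> M' p = M p)" for i j :: nat and R' M' :: "nat \<Rightarrow> nat"
  have I_upd: "I i j (R'(q := v)) M' \<longleftrightarrow> I i j R' M'" if "20 \<le> q" for i j R' M' q v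
    using that by (simp add: I_def)
  have rel_iff: "r x y \<longleftrightarrow> x = y \<or> M (TYP + x) = 0 \<or> M (TYP + y) = 1" if "x < W" "y < W" for x y
  proof -
    have "lit_bit a X w = 0 \<or> lit_bit a X w = 1" for w using lit_bit_less[of a X w] by linarith
    from this[of x] this[of y] show ?thesis
      using l that by (auto simp: r_def init_rel_def live_def load_post_def lit_fun_def)
  qed
  have WB: "W < 2 ^ B" by (rule layout_bounds)
  have inner: "wp B (Store (rel_addr 20 21) (Or3 (Eq (Reg 20) (Reg 21)) (Eq (Mem (Add (Reg 6) (Reg 20))) (Num 0))
       (Eq (Mem (Add (Reg 6) (Reg 21))) (Num 1))))
       (\<lambda>k (R'', M''). k \<le> 1 \<and> R'' 21 = j \<and> (R''(21 := Suc j)) 20 = i \<and> I i (Suc j) (R''(21 := Suc j)) M'') (R', M')"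
    if i: "i < W" and j: "j < W" and Ij: "R' 20 = i" "I i j R' M'" and rj: "R' 21 = j" for i j R' M'
  proof -
    have b: "base_regs R'" using base Ij(2) by (auto intro: base_regs_cong simp: I_def)
    have M: "M' (TYP + i) = M (TYP + i)" "M' (TYP + j) = M (TYP + j)"
      using Ij(2) i j by (auto simp: I_def REL_def CUR_def)
    have ev: "eval_expr (Or3 (Eq (Reg 20) (Reg 21)) (Eq (Mem (Add (Reg 6) (Reg 20))) (Num 0))
       (Eq (Mem (Add (Reg 6) (Reg 21))) (Num 1))) (R', M') = of_bool (r i j)"
      using rel_iff[OF i j] by (simp add: base_regsD[OF b] Ij rj M)
    have "I i (Suc j) (R'(21 := Suc j)) (M'(rel_pos i j := of_bool (r i j)))"
      using Ij(2) i j rel_pos_bounds[OF i j] by (auto simp: I_def rel_pos_eq_iff less_Suc_eq)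
    then show ?thesis unfolding wp_Store ev
      using Ij(1) rj one_less_B by (simp add: eval_rel_addr[OF b] of_bool_def)
  qed
  have outer: "wp B init_rel_com (\<lambda>k (R', M'). k \<le> 2 + W * (2 + W * 3 + 2) \<and> I W 0 R' M') (R, M)"
    unfolding init_rel_com_def
  proof (rule wp_For[where N = W and T = "2 + W * 3" and I = "\<lambda>i R' M'. I i 0 R' M'"])
    fix i R' M'
    assume i: "i < W" and Ii: "I i 0 R' M'" and ri: "R' 20 = i"
    show "wp B (For 21 (Reg 2)
       (Store (rel_addr 20 21) (Or3 (Eq (Reg 20) (Reg 21)) (Eq (Mem (Add (Reg 6) (Reg 20))) (Num 0))
       (Eq (Mem (Add (Reg 6) (Reg 21))) (Num 1)))))
       (\<lambda>k (R'', M''). k \<le> 2 + W * 3 \<and> R'' 20 = i \<and> I (Suc i) 0 (R''(20 := Suc i)) M'') (R', M')"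
    proof (rule wp_For[where N = W and T = 1 and I = "\<lambda>j R' M'. R' 20 = i \<and> I i j R' M'"], goal_cases)
      case (2 j R1 M1)
      then have "base_regs R1" using base by (auto intro: base_regs_cong simp: I_def)
      then show ?case by (simp add: base_regsD)
    next
      case (3 j R1 M1)
      then show ?case using inner[OF i, of j R1 M1] by simp
    next
      case (5 k R1 M1)
      then have "I (Suc i) 0 R1 M1" by (auto simp: I_def less_Suc_eq)
      then show ?case using 5 by (simp add: I_upd)
    qed (use Ii ri WB in \<open>auto simp: I_upd\<close>)
  next
    fix i R' M'
    assume "I i 0 R' M'"
    then have "base_regs R'" using base by (auto intro: base_regs_cong simp: I_def)
    then show "eval_expr (Reg 2) (R', M') = W" by (simp add: base_regsD)
  qed (use WB in \<open>auto simp: I_def\<close>)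
  then show ?thesis
    by (rule wp_mono) (auto simp: I_def rel_mem_def r_def algebra_simps)
qed

lemma wp_tag:
  assumes base: "base_regs R" and S: "sim_mem (cur, r, es) (R 1) M" "sim_valid s (cur, r, es)"
    and l: "load_post a m X W M"
  shows "wp B tag_com (\<lambda>k (R', M'). k \<le> 5 \<and> (\<forall>q<20. q \<noteq> 1 \<longrightarrow> R' q = R q) \<and>
    R' 1 = key_num W (es, final_tag (live a m) (lit_fun a X) (cur out)) \<and> M' = M) (R, M)"
proof -
  let ?w = "cur out" and ?t = "final_tag (live a m) (lit_fun a X) (cur out)"
  have w: "?w < W" using S(2) out_less by (auto simp: sim_valid_def)
  have M: "M (CUR + out) = ?w" "R 1 = key_list W es 0"
    using S(1) out_less by (auto simp: sim_mem_def cur_mem_def)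
  have T: "M (TYP + ?w) = (if ?w \<in> live a m then 2 else lit_bit a X ?w)"
    using l w by (simp add: load_post_def live_def)
  have t: "?t = (if M (TYP + ?w) = 2 then ?w + 2 else M (TYP + ?w))"
    using lit_bit_less[of a X ?w] w unfolding T
    by (auto simp: final_tag_def lit_fun_def of_bool_def less_2_cases_iff)
  have tW: "?t < W + 2" using w by (auto simp: final_tag_def)
  note kB = key_list_less_B(1)[OF S(2) order_refl tW]
  have tB: "?t < 2 ^ B" "?w < 2 ^ B" "M (TYP + ?w) < 2 ^ B"
    using tW w layout_bounds(8) B_layout lit_bit_less[of a X ?w] layout_bounds(10) unfolding T
    by (auto split: if_splits)
  have b: "base_regs (R(31 := x))" for x using base by (simp add: base_regs_def)
  have k: "key_num W (es, ?t) = R (Suc 0) * (W + 2) + ?t" using M(2) by (simp add: key_num_def)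
  show ?thesis
    unfolding tag_com_def k
    using kB tB unfolding M(2)[symmetric]
    by (cases "M (TYP + ?w) = 2") (simp_all add: base_regsD[OF base] M(1) t)
qed

definition key_time :: nat where
  "key_time = load_time + 20 + W * (7 + W * 3) + s * (16 + W * 12)"

lemma wp_key:
  assumes base: "base_regs R" and inp: "input_mem M" and a: "R 10 = a" "a < n" and m: "R 11 = m" "m \<le> n"
    and m2: "R 13 = 2 ^ m" and z: "R 15 = z" "z < 2 ^ (n - m)"
  shows "wp B key_com (\<lambda>k (R', M'). k \<le> key_time \<and> (\<forall>r<16. r \<noteq> 1 \<longrightarrow> R' r = R r) \<and>
    R' 1 = block_key a m z \<and> (\<forall>p. p < VAL \<or> TAB \<le> p \<longrightarrow> M' p = M p)) (R, M)"
proof -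
  let ?X = "z * 2 ^ m"
  have X: "?X < 2 ^ n" using block_index_less[OF m(2) z(2), of 0] by simp
  have XB: "?X < 2 ^ B" using X two_power_less_B[of n] by linarith
  have b0: "base_regs (R(19 := ?X))" using base by (simp add: base_regs_def)
  have o: "VAL \<le> TYP" "TYP \<le> CUR" "CUR \<le> REL" "REL \<le> TAB" by (simp_all add: layout_defs)
  obtain cur r es where Ss: "sim a m ?X s = (cur, r, es)" using prod_cases3 by blast
  have bk: "block_key a m z = key_num W (es, final_tag (live a m) (lit_fun a ?X) (cur out))"
    using Ss by (simp add: block_key_def sim_key_def sim_def)
  show ?thesis
    unfolding key_com_def wp_Seq
  proof (subst wp_SetReg, intro conjI, goal_cases)
    case 1
    show ?case using XB by (simp add: z m2)
  next
    case 2
    have ev: "eval_expr (Mul (Reg 15) (Reg 13)) (R, M) = ?X" by (simp add: z m2)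
    show ?case unfolding ev
    proof (rule wp_mono[OF wp_load[OF b0 inp]], goal_cases)
      case (3 k1 S1)
      obtain R1 M1 where S1: "S1 = (R1, M1)" by (cases S1)
      have 1: "k1 \<le> load_time" "\<forall>q<20. R1 q = (R(19 := ?X)) q" "load_post a m ?X W M1"
        "\<forall>p. p < VAL \<or> CUR \<le> p \<longrightarrow> M1 p = M p" using 3 a m by (auto simp: S1)
      have b1: "base_regs R1" by (rule base_regs_cong[OF b0 1(2)])
      show ?case unfolding S1
      proof (rule wp_mono[OF wp_init_cur[OF b1]], goal_cases)
        case (1 k2 S2)
        obtain R2 M2 where S2: "S2 = (R2, M2)" by (cases S2)
        have 2: "k2 \<le> 2 + W * 3" "\<forall>q<20. R2 q = R1 q" "cur_mem id M2"
          "\<forall>p. p < CUR \<or> REL \<le> p \<longrightarrow> M2 p = M1 p" using 1 by (auto simp: S2)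
        have b2: "base_regs R2" by (rule base_regs_cong[OF b1 2(2)])
        have l2: "load_post a m ?X W M2" using \<open>load_post a m ?X W M1\<close> 2(4)
          by (simp add: load_post_def CUR_def TYP_def)
        show ?case unfolding S2
        proof (rule wp_mono[OF wp_init_rel[OF b2 l2]], goal_cases)
          case (1 k3 S3)
          obtain R3 M3 where S3: "S3 = (R3, M3)" by (cases S3)
          have 3: "k3 \<le> 2 + W * (4 + W * 3)" "\<forall>q<20. R3 q = R2 q"
            "rel_mem (init_rel (live a m) (lit_fun a ?X)) M3"
            "\<forall>p. p < REL \<or> TAB \<le> p \<longrightarrow> M3 p = M2 p" using 1 by (auto simp: S3)
          let ?R3 = "R3(1 := 0)"
          have b3: "base_regs ?R3" using base_regs_cong[OF b2 3(2)] by (simp add: base_regs_def)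
          have c3: "cur_mem id M3" using 2(3) 3(4) by (simp add: cur_mem_def REL_def)
          have l3: "load_post a m ?X W M3" using l2 3(4)
            by (simp add: load_post_def CUR_def TYP_def REL_def)
          have R3: "\<forall>q<20. q \<noteq> 1 \<longrightarrow> q \<noteq> 19 \<longrightarrow> ?R3 q = R q"
            using \<open>\<forall>q<20. R1 q = _ q\<close> 2(2) 3(2) by simp
          have M3: "\<forall>p. p < VAL \<or> TAB \<le> p \<longrightarrow> M3 p = M p"
            using \<open>\<forall>p. p < VAL \<or> CUR \<le> p \<longrightarrow> M1 p = M p\<close> 2(4) 3(4) o by simp
          show ?case unfolding S3
          proof (subst wp_SetReg, intro conjI, simp,
              rule wp_For[where N = s and T = "14 + W * 12" and I = "\<lambda>i R' M'.
                (\<forall>q<20. q \<noteq> 1 \<longrightarrow> R' q = ?R3 q) \<and> sim_mem (sim a m ?X i) (R' 1) M' \<and>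
                (\<forall>p. p < CUR \<or> TAB \<le> p \<longrightarrow> M' p = M3 p)"], goal_cases)
            case 1
            then show ?case using 3(3) c3 by (simp add: sim_mem_def sim_def)
          next
            case (2 i R' M')
            then have "base_regs R'" using b3 by (auto simp: base_regs_def)
            then show ?case by (simp add: base_regsD)
          next
            case (3 i R' M')
            have b': "base_regs R'" using b3 3(2) by (auto simp: base_regs_def)
            have i': "input_mem M'" using 3(2) M3 o by (intro input_mem_cong[OF inp]) simp
            have S': "sim_mem (sim a m ?X i) (R' 1) M'" using 3(2) by simp
            have V': "sim_valid i (sim a m ?X i)" using 3(1) by (intro sim_valid_sim) simp
            have *: "sim_gate (ga i, gb i) (sim a m ?X i) = sim a m ?X (Suc i)"
              by (simp add: sim_def gate_list_Suc)
            show ?case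
              by (rule wp_mono[OF wp_sim[OF b' i' 3(3,1) S' V']]) (use 3(2) in \<open>auto simp: *\<close>)
          next
            case 4
            show ?case by (rule layout_bounds)
          next
            case (5 k4 R4 M4)
            have 4: "\<forall>q<20. q \<noteq> 1 \<longrightarrow> R4 q = ?R3 q" "sim_mem (cur, r, es) (R4 1) M4"
              "\<forall>p. p < CUR \<or> TAB \<le> p \<longrightarrow> M4 p = M3 p" using 5(1) Ss by auto
            have b4: "base_regs R4" using b3 4(1) by (auto simp: base_regs_def)
            have V4: "sim_valid s (cur, r, es)" using sim_valid_sim[of s a m ?X] Ss by simp
            have l4: "load_post a m ?X W M4" using l3 4(3)
              by (simp add: load_post_def CUR_def TYP_def)
            have R4: "\<forall>q<16. q \<noteq> 1 \<longrightarrow> R4 q = R q" using 4(1) R3 by simp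
            have M4: "\<forall>p. p < VAL \<or> TAB \<le> p \<longrightarrow> M4 p = M p" using M3 4(3) o by simp
            have time: "1 + (k1 + (k2 + (k3 + (1 + (k4 + k5))))) \<le> key_time" if "k5 \<le> 5" for k5
            proof -
              have "key_time = load_time + (2 + W * 3) + (2 + W * (4 + W * 3)) + (2 + s * (14 + W * 12 + 2)) + 14"
                by (simp add: key_time_def algebra_simps)
              then show ?thesis
                using that 5(2) \<open>k1 \<le> _\<close> \<open>k2 \<le> _\<close> \<open>k3 \<le> _\<close> by linarith
            qed
            show ?case
              by (rule wp_mono[OF wp_tag[OF b4 4(2) V4 l4]]) (use R4 M4 time bk in auto)
          qed
        qed
      qed
    qed (use a X in auto)
  qed
qed

end

section \<open>Counting with memoization\<close>

text \<open>A table entry is the count plus one. Hence 0, the initial content of the memory, means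
  that the key has not occurred, even if a count is 0.\<close>

definition memo_com :: com where
  "memo_com =
     SetReg 0 (Num 0) ;;
     For 15 (Reg 14) (
       key_com ;;
       If (Mem (Add (Reg 9) (Reg 1))) Skip
         (count_com ;; Store (Add (Reg 9) (Reg 1)) (Add (Reg 17) (Num 1))) ;;
       SetReg 0 (Add (Reg 0) (Sub (Mem (Add (Reg 9) (Reg 1))) (Num 1))))"

definition double_com :: "nat \<Rightarrow> expr \<Rightarrow> com" where
  "double_com r e = SetReg r (Num 1) ;; For 20 e (SetReg r (Mul (Reg r) (Num 2)))"

definition log_com :: com where
  "log_com =
     SetReg 13 (Num 1) ;;
     SetReg 17 (Num 0) ;;
     For 20 (Reg 12) (If (Sub (Reg 12) (Reg 13))
       (SetReg 13 (Mul (Reg 13) (Num 2)) ;; SetReg 17 (Add (Reg 17) (Num 1))) Skip)"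

definition live_card_com :: com where
  "live_card_com =
     SetReg 18 (Num 0) ;;
     For 30 (Reg 2) (
       bit_index_com ;;
       If (Sub (Reg 20) (Reg 32)) (SetReg 18 (Add (Reg 18) (Num 1))) Skip)"

text \<open>
  The block length cannot be derived from \<open>k\<close>, which is not part of the input.  The program takes the
  largest one for which some rotation passes the test \<open>32 (L - 1)\<^sup>2 l \<le> n\<close>.
\<close>

definition search_com :: com where
  "search_com =
     SetReg 16 (Num 0) ;;
     SetReg 11 (Num 0) ;;
     For 20 (Add (Div (Reg 12) (Num 2)) (Num 1)) (
       For 21 (Reg 12) (
         SetReg 10 (Reg 21) ;;
         live_card_com ;;
         SetReg 18 (Sub (Reg 18) (Num 1)) ;;
         If (Sub (Add (Reg 12) (Num 1)) (Mul (Num 32) (Mul (Mul (Reg 18) (Reg 18)) (Reg 17))))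
           (SetReg 16 (Reg 21) ;; SetReg 11 (Reg 20)) Skip)) ;;
     SetReg 10 (Reg 16)"

definition prepare_com :: com where
  "prepare_com =
     SetReg 12 (Mem (Num 0)) ;;
     SetReg 2 (Mem (Num 1)) ;;
     SetReg 3 (Mem (Num 2)) ;;
     SetReg 4 (Mem (Num 3)) ;;
     SetReg 5 (Add (Num 4) (Add (Reg 2) (Mul (Num 2) (Reg 3)))) ;;
     SetReg 6 (Add (Reg 5) (Reg 2)) ;;
     SetReg 7 (Add (Reg 6) (Reg 2)) ;;
     SetReg 8 (Add (Reg 7) (Reg 2)) ;;
     SetReg 9 (Add (Reg 8) (Mul (Reg 2) (Reg 2)))"

definition count_sat_com :: com where
  "count_sat_com =
     prepare_com ;;
     log_com ;;
     search_com ;;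
     double_com 13 (Reg 11) ;;
     double_com 14 (Sub (Reg 12) (Reg 11)) ;;
     memo_com"

section \<open>High and low bits of an assignment\<close>

text \<open>As \<open>q < m\<close>, the high part \<open>z * 2 ^ m\<close> is an even multiple of
  \<open>2 ^ q\<close> and drops out modulo 2.\<close>

lemma block_bit_low:
  fixes y z :: nat
  assumes "q < m"
  shows "((z * 2 ^ m + y) div 2 ^ q + c) mod 2 = (y div 2 ^ q + c) mod 2"
proof -
  have "z * 2 ^ m = 2 ^ q * (2 * (z * 2 ^ (m - q - 1)))"
    using assms by (simp flip: power_add power_Suc)
  then have "(z * 2 ^ m + y) div 2 ^ q = 2 * (z * 2 ^ (m - q - 1)) + y div 2 ^ q"
    by (metis div_mult_self2 power_not_zero zero_neq_numeral add.commute)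
  then have "(z * 2 ^ m + y) div 2 ^ q + c = 2 * (z * 2 ^ (m - q - 1)) + (y div 2 ^ q + c)"
    by simp
  then show ?thesis by (simp only: mod_mult_self4)
qed

lemma block_bit_high:
  fixes y z :: nat
  assumes "m \<le> q" "y < 2 ^ m"
  shows "(z * 2 ^ m + y) div 2 ^ q = (z * 2 ^ m) div 2 ^ q"
proof -
  have q: "2 ^ q = 2 ^ m * (2::nat) ^ (q - m)" using assms(1) by (simp flip: power_add)
  show ?thesis unfolding q div_mult2_eq using assms(2) by simp
qed

context layout
begin

text \<open>A live wire reads one of the low bits \<open>y\<close>, hence the fixed part
  \<open>z\<close> may be exchanged; \<open>lit_fun_high\<close> is the counterpart for all other
  wires.\<close>

lemma lit_fun_low:
  assumes "w \<in> live a m"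
  shows "lit_fun a (z * 2 ^ m + y) w = lit_fun a (z' * 2 ^ m + y) w"
  using assms block_bit_low[of "bit_index a w" m] by (simp add: live_def lit_fun_def lit_bit_def)

lemma lit_fun_high:
  assumes "w \<notin> live a m" "y < 2 ^ m"
  shows "lit_fun a (z * 2 ^ m + y) w = lit_fun a (z * 2 ^ m) w"
  using assms block_bit_high[of m "bit_index a w" y z]
  by (auto simp: live_def lit_fun_def lit_bit_def)

lemma sim_key_bounds:
  assumes "sim_key (live a m) c (gate_list s) out = (es, t)" "c = lit_fun a X"
  shows "set es \<subseteq> {..<W} \<times> {..<W}" "t < W + 2"
proof -
  obtain cur r es' where S: "sim a m X s = (cur, r, es')" using prod_cases3 by blast
  have "sim_valid s (cur, r, es')" using sim_valid_sim[of s a m X] S by simp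
  then show "set es \<subseteq> {..<W} \<times> {..<W}" "t < W + 2"
    using assms S out_less by (auto simp: sim_key_def sim_def sim_valid_def final_tag_def)
qed

text \<open>This justifies reusing a stored count. For every \<open>y\<close> the two assignments
  agree on the live wires, and the key accounts for everything that the other wires
  contribute.\<close>

lemma block_key_determines:
  assumes "block_key a m z = block_key a m z'"
  shows "block_count a m z = block_count a m z'"
proof -
  obtain es t where k: "sim_key (live a m) (lit_fun a (z * 2 ^ m)) (gate_list s) out = (es, t)" by fastforce
  obtain es' t' where k': "sim_key (live a m) (lit_fun a (z' * 2 ^ m)) (gate_list s) out = (es', t')" by fastforce
  have "es = es' \<and> t = t'"
    using key_num_inj[of es W es' t t'] sim_key_bounds[OF k refl] sim_key_bounds[OF k' refl] assms
    by (simp add: block_key_def k k')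
  then have key: "sim_key (live a m) (lit_fun a (z * 2 ^ m)) (gate_list s) out =
      sim_key (live a m) (lit_fun a (z' * 2 ^ m)) (gate_list s) out" by (simp add: k k')
  have "circuit_out a (z * 2 ^ m + y) = circuit_out a (z' * 2 ^ m + y)" if "y < 2 ^ m" for y
    unfolding circuit_out_def
    by (rule sim_key_determines[OF key finite_live gate_list_neq[OF order_refl]])
      (use that lit_fun_low lit_fun_high in auto)
  then show ?thesis unfolding block_count_def by (metis (no_types, lifting))
qed

section \<open>Amortized cost of the memo loop\<close>

text \<open>The first product pays for the key of every block, the second for one brute-force count
  per distinct key.\<close>

definition memo_time :: "nat \<Rightarrow> nat \<Rightarrow> nat" where
  "memo_time a m = 5 + 2 ^ (n - m) * (key_time + 10) +
     card (block_key a m ` {..<2 ^ (n - m)}) * (2 ^ m * count_time + 10)"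

lemma wp_memo:
  assumes base: "base_regs R" and inp: "input_mem M" and a: "R 10 = a" "a < n" and m: "R 11 = m" "m \<le> n"
    and m2: "R 13 = 2 ^ m" "R 14 = 2 ^ (n - m)" and tab: "\<And>p. TAB \<le> p \<Longrightarrow> M p = 0"
  shows "wp B memo_com (\<lambda>k (R', M'). k \<le> memo_time a m \<and>
    R' 0 = (\<Sum>z<2 ^ (n - m). block_count a m z)) (R, M)"
proof -
  define key where "key = block_key a m"
  define cnt where "cnt = block_count a m"
  define miss where "miss = 2 ^ m * count_time + 5"
  \<comment> \<open>The number of distinct keys so far is the number of misses so far; each of them
    has paid \<open>miss\<close> once.\<close>
  define I where "I i k R' M' \<longleftrightarrow> (\<forall>q<15. q \<noteq> 0 \<longrightarrow> q \<noteq> 1 \<longrightarrow> R' q = R q) \<and>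
      R' 0 = (\<Sum>z<i. cnt z) \<and> (\<forall>p<VAL. M' p = M p) \<and>
      (\<forall>z<i. M' (TAB + key z) = Suc (cnt z)) \<and> (\<forall>c. c \<notin> key ` {..<i} \<longrightarrow> M' (TAB + c) = 0) \<and>
      k \<le> 1 + i * (key_time + 6) + card (key ` {..<i}) * miss"
    for i k and R' M' :: "nat \<Rightarrow> nat"
  have I_mono: "I i k R' M' \<Longrightarrow> k' \<le> k \<Longrightarrow> I i k' R' M'" for i k k' R' M'
    unfolding I_def by (elim conjE, intro conjI) (assumption | linarith)+
  have sum_le: "(\<Sum>z<i. cnt z) \<le> i * 2 ^ m" for i
    using sum_mono[of "{..<i}" cnt "\<lambda>_. 2 ^ m"] block_count_le by (simp add: cnt_def)
  have det: "cnt z = cnt z'" if "key z = key z'" for z z'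
    using block_key_determines[of a m z z'] that unfolding key_def cnt_def by blast
  have o: "VAL \<le> CUR" "CUR \<le> TAB" by (simp_all add: layout_defs)
  have "wp B (For 15 (Reg 14) (
       key_com ;;
       If (Mem (Add (Reg 9) (Reg 1))) Skip
         (count_com ;; Store (Add (Reg 9) (Reg 1)) (Add (Reg 17) (Num 1))) ;;
       SetReg 0 (Add (Reg 0) (Sub (Mem (Add (Reg 9) (Reg 1))) (Num 1)))))
     (\<lambda>k (R', M'). Suc k \<le> memo_time a m \<and> R' 0 = (\<Sum>z<2 ^ (n - m). cnt z)) (R(0 := 0), M)"
  proof (rule wp_For_amortized[where N = "2 ^ (n - m)" and I = I], goal_cases)
    case 1
    show ?case by (simp add: I_def tab)
  next
    case (2 i k R' M')
    then show ?case by (simp add: I_def m2)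
  next
    case (3 z k R' M')
    note z = 3(1) and R15 = 3(3)
    have I: "\<forall>q<15. q \<noteq> 0 \<longrightarrow> q \<noteq> 1 \<longrightarrow> R' q = R q" "R' 0 = (\<Sum>z<z. cnt z)" "\<forall>p<VAL. M' p = M p"
      "\<forall>z'<z. M' (TAB + key z') = Suc (cnt z')" "\<forall>c. c \<notin> key ` {..<z} \<longrightarrow> M' (TAB + c) = 0"
      "k \<le> 1 + z * (key_time + 6) + card (key ` {..<z}) * miss" using 3(2) by (auto simp: I_def)
    have b: "base_regs R'" using base I(1) by (simp add: base_regs_def)
    have i: "input_mem M'" by (rule input_mem_cong[OF inp I(3)])
    have sumB: "(\<Sum>z<z. cnt z) + cnt z < 2 ^ B"
    proof -
      have "(\<Sum>z<z. cnt z) + cnt z \<le> Suc z * 2 ^ m" using sum_le[of "Suc z"] by simp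
      also have "\<dots> \<le> 2 ^ (n - m) * 2 ^ m" using z by (intro mult_le_mono1) simp
      also have "\<dots> = 2 ^ n" using m(2) by (simp flip: power_add)
      also have "\<dots> < 2 ^ B" by (rule two_power_less_B) simp
      finally show ?thesis .
    qed
    have cntB: "Suc (cnt z) < 2 ^ B"
    proof -
      have "Suc (cnt z) \<le> 2 ^ m + 2 ^ m" using block_count_le[of a m z] one_le_power[of "2::nat" m] unfolding cnt_def by linarith
      also have "\<dots> = 2 ^ (m + 1)" by simp
      also have "\<dots> < 2 ^ B" by (rule two_power_less_B) (use m(2) in simp)
      finally show ?thesis .
    qed
    have r: "R' 10 = a" "R' 11 = m" "R' 13 = 2 ^ m" using I(1) a m m2 by simp_all
    show ?case unfolding wp_Seq
    proof (rule wp_mono[OF wp_key[OF b i r(1) a(2) r(2) m(2) r(3) R15 z]], goal_cases)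
      case (1 k1 S1)
      obtain R1 M1 where S1: "S1 = (R1, M1)" by (cases S1)
      have 1: "k1 \<le> key_time" "\<forall>q<16. q \<noteq> 1 \<longrightarrow> R1 q = R' q" "R1 1 = key z"
        "\<forall>p. p < VAL \<or> TAB \<le> p \<longrightarrow> M1 p = M' p" using 1 by (auto simp: S1 key_def)
      have b1: "base_regs R1" using b 1(2) by (simp add: base_regs_def)
      have i1: "input_mem M1" using 1(4) by (intro input_mem_cong[OF i]) simp
      have r1: "R1 10 = a" "R1 11 = m" "R1 13 = 2 ^ m" "R1 15 = z" using 1(2) r R15 by simp_all
      have ad: "eval_expr (Add (Reg 9) (Reg 1)) (R1, M1) = TAB + key z"
        using 1(3) by (simp add: base_regsD[OF b1])
      show ?case
      proof (cases "key z \<in> key ` {..<z}")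
        case True
        then obtain z' where z': "z' < z" "key z' = key z" by auto
        \<comment> \<open>The entry belongs to an earlier block with the same key, and by
          \<open>det\<close> its count is that of \<open>z\<close>.\<close>
        then have Mz: "M1 (TAB + key z) = Suc (cnt z)" using I(4) 1(4) det[OF z'(2)] by (metis le_add1)
        have guard: "eval_expr (Mem (Add (Reg 9) (Reg 1))) (R1, M1) = Suc (cnt z)"
          using Mz ad by simp
        have e0: "eval_expr (Add (Reg 0) (Sub (Mem (Add (Reg 9) (Reg 1))) (Num 1))) (R1, M1) = (\<Sum>z<Suc z. cnt z)"
          using Mz ad 1(2) I(2) by simp
        have im: "key ` {..<Suc z} = key ` {..<z}" using True by (auto simp: lessThan_Suc)
        have "I (Suc z) (k + (k1 + 3) + 2) (R1(0 := (\<Sum>z<Suc z. cnt z), 15 := Suc z)) M1"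
          unfolding I_def im
          proof (intro conjI, goal_cases)
            case 4
            show ?case using I(4) 1(4) Mz by (auto simp: less_Suc_eq)
          next
            case 5
            show ?case using I(5) 1(4) im by simp
          qed (use I 1 in auto)
        then show ?thesis
          using r1 sumB by (simp only: S1 wp_If guard wp_Skip wp_SetReg e0 nat.simps not_False_eq_True if_True)
            (auto elim!: I_mono)
      next
        case False
        then have guard: "eval_expr (Mem (Add (Reg 9) (Reg 1))) (R1, M1) = 0" using I(5) 1(4) ad by simp
        have im: "card (key ` {..<Suc z}) = Suc (card (key ` {..<z}))" using False by (simp add: lessThan_Suc)
        have "wp B count_com (\<lambda>k2 (R2, M2). k2 \<le> 3 + 2 ^ m * count_time \<and> (\<forall>r<16. R2 r = R1 r) \<and>
          R2 17 = cnt z \<and> (\<forall>p. p < VAL \<or> CUR \<le> p \<longrightarrow> M2 p = M1 p)) (R1, M1)"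
          unfolding cnt_def by (rule wp_count[OF b1 i1 r1(1) a(2) r1(2) m(2) r1(3,4) z])
        then have "wp B count_com (\<lambda>k2. wp B (Store (Add (Reg 9) (Reg 1)) (Add (Reg 17) (Num 1))) (\<lambda>k3.
          wp B (SetReg 0 (Add (Reg 0) (Sub (Mem (Add (Reg 9) (Reg 1))) (Num 1))))
          (\<lambda>k4 (R'', M''). R'' 15 = z \<and> I (Suc z) (k + (k1 + (k2 + k3 + 1 + k4)) + 2) (R''(15 := Suc z)) M''))) (R1, M1)"
        proof (rule wp_mono, goal_cases)
          case (1 k2 S2)
          obtain R2 M2 where S2: "S2 = (R2, M2)" by (cases S2)
          have 2: "k2 \<le> 3 + 2 ^ m * count_time" "\<forall>r<16. R2 r = R1 r" "R2 17 = cnt z"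
            "\<forall>p. p < VAL \<or> CUR \<le> p \<longrightarrow> M2 p = M1 p" using 1 by (auto simp: S2)
          have b2: "base_regs R2" using b1 2(2) by (simp add: base_regs_def)
          have M2: "\<forall>c. M2 (TAB + c) = M' (TAB + c)" using 2(4) \<open>\<forall>p. p < VAL \<or> TAB \<le> p \<longrightarrow> M1 p = M' p\<close> o by simp
          have "I (Suc z) (k + (k1 + (k2 + 3)) + 2) (R2(0 := (\<Sum>z<Suc z. cnt z), 15 := Suc z))
              (M2(TAB + key z := Suc (cnt z)))"
            unfolding I_def im
          proof (intro conjI, goal_cases)
            case 1
            show ?case using 2(2) \<open>\<forall>q<16. q \<noteq> 1 \<longrightarrow> R1 q = R' q\<close> I(1) by simp
          next
            case 3
            show ?case using 2(4) \<open>\<forall>p. p < VAL \<or> TAB \<le> p \<longrightarrow> M1 p = M' p\<close> I(3) o by simp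
          next
            case 4
            show ?case using I(4) M2 by (auto simp: less_Suc_eq intro: det[OF sym])
          next
            case 5
            show ?case using I(5) M2 by (auto simp: lessThan_Suc)
          next
            case 6
            show ?case using I(6) 2(1) \<open>k1 \<le> key_time\<close> by (simp add: miss_def algebra_simps)
          qed simp
          moreover have ad2: "eval_expr (Add (Reg 9) (Reg 1)) (R2, M2'') = TAB + key z" for M2''
            using \<open>R1 1 = key z\<close> 2(2) by (simp add: base_regsD[OF b2])
          moreover have "eval_expr (Add (Reg 17) (Num 1)) (R2, M2) = Suc (cnt z)" using 2(3) by simp
          moreover have "eval_expr (Add (Reg 0) (Sub (Mem (Add (Reg 9) (Reg 1))) (Num 1)))
              (R2, M2(TAB + key z := Suc (cnt z))) = (\<Sum>z<Suc z. cnt z)"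
            using ad2[of "M2(TAB + key z := Suc (cnt z))"] 2(2) \<open>\<forall>q<16. q \<noteq> 1 \<longrightarrow> R1 q = R' q\<close> I(2) by simp
          ultimately show ?case
            using sumB cntB r1 2(2) by (simp only: S2 wp_Store wp_SetReg) (auto elim!: I_mono)
        qed
        then show ?thesis
          unfolding S1 wp_If guard wp_Seq by (simp only: not_True_eq_False if_False simp_thms add.assoc)
      qed
    qed
  next
    case 4
    show ?case by (rule two_power_less_B) simp
  next
    case (5 k R' M')
    then have "k \<le> 1 + 2 ^ (n - m) * (key_time + 6) + card (key ` {..<2 ^ (n - m)}) * miss"
      "R' 0 = (\<Sum>z<2 ^ (n - m). cnt z)" by (auto simp: I_def)
    moreover have "2 ^ (n - m) * (key_time + 6) \<le> 2 ^ (n - m) * (key_time + 10)"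
      "card (key ` {..<2 ^ (n - m)}) * miss \<le> card (key ` {..<2 ^ (n - m)}) * (2 ^ m * count_time + 10)"
      by (intro mult_le_mono2, simp add: miss_def)+
    ultimately have "Suc (k + 1) \<le> memo_time a m" unfolding memo_time_def key_def[symmetric] by linarith
    with 5 show ?case by (simp add: I_def)
  qed
  then show ?thesis
    unfolding memo_com_def wp_Seq wp_SetReg cnt_def by simp
qed

section \<open>Powers, logarithm, rotation and block length\<close>

lemma wp_double:
  assumes e: "\<And>R' M'. (\<forall>q. q \<notin> {r, 20} \<longrightarrow> R' q = R q) \<Longrightarrow> eval_expr e (R', M') = N"
    and N: "N \<le> n" and r: "r \<noteq> 20"
  shows "wp B (double_com r e) (\<lambda>k (R', M'). k \<le> 3 + N * 3 \<and> (\<forall>q. q \<notin> {r, 20} \<longrightarrow> R' q = R q) \<and>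
    R' r = 2 ^ N \<and> M' = M) (R, M)"
proof -
  have *: "wp B (For 20 e (SetReg r (Mul (Reg r) (Num 2)))) (\<lambda>k (R', M'). k \<le> 2 + N * 3 \<and>
    (\<forall>q. q \<notin> {r, 20} \<longrightarrow> R' q = R q) \<and> R' r = 2 ^ N \<and> M' = M) (R(r := 1), M)"
  proof (rule wp_For[where N = N and T = 1 and I = "\<lambda>i R' M'. (\<forall>q. q \<notin> {r, 20} \<longrightarrow> R' q = R q) \<and>
      R' r = 2 ^ i \<and> M' = M"], goal_cases)
    case (2 i R' M')
    then show ?case using e by blast
  next
    case (3 i R' M')
    have "2 ^ Suc i < (2::nat) ^ B" by (rule two_power_less_B) (use 3 N in simp)
    then show ?case using 3 r by (simp add: mult.commute)
  next
    case 4
    show ?case using N layout_bounds(6) by linarith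
  qed (use r in auto)
  show ?thesis
    unfolding double_com_def wp_Seq wp_SetReg eval_expr.simps
    by (intro conjI) (simp add: one_less_B, rule wp_mono[OF *], auto)
qed

text \<open>For positive \<open>n\<close> this says that \<open>l\<close> is the binary logarithm of
  \<open>n\<close>, rounded up.\<close>

definition is_log :: "nat \<Rightarrow> bool" where
  "is_log l \<longleftrightarrow> n \<le> 2 ^ l \<and> (l = 0 \<or> 2 ^ (l - 1) < n) \<and> l \<le> n"

lemma wp_log:
  assumes base: "base_regs R"
  shows "wp B log_com (\<lambda>k (R', M'). k \<le> 4 + n * 5 \<and> (\<forall>q. q \<notin> {13, 17, 20} \<longrightarrow> R' q = R q) \<and>
    is_log (R' 17) \<and> M' = M) (R, M)"
proof -
  have *: "wp B (For 20 (Reg 12) (If (Sub (Reg 12) (Reg 13))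
       (SetReg 13 (Mul (Reg 13) (Num 2)) ;; SetReg 17 (Add (Reg 17) (Num 1))) Skip))
    (\<lambda>k (R', M'). k \<le> 2 + n * 5 \<and> (\<forall>q. q \<notin> {13, 17, 20} \<longrightarrow> R' q = R q) \<and>
    is_log (R' 17) \<and> M' = M) (R(13 := 1, 17 := 0), M)"
  proof (rule wp_For[where N = n and T = 3 and I = "\<lambda>i R' M'. (\<forall>q. q \<notin> {13, 17, 20} \<longrightarrow> R' q = R q) \<and>
      R' 13 = 2 ^ R' 17 \<and> (R' 17 = 0 \<or> 2 ^ (R' 17 - 1) < n) \<and> (n \<le> 2 ^ R' 17 \<or> R' 17 = i) \<and> R' 17 \<le> i \<and> M' = M"], goal_cases)
    case (2 i R' M')
    then show ?case by (simp add: base_regsD[OF base])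
  next
    case (3 i R' M')
    then have I: "\<forall>q. q \<notin> {13, 17, 20} \<longrightarrow> R' q = R q" "R' 13 = 2 ^ R' 17" "R' 17 = 0 \<or> 2 ^ (R' 17 - 1) < n"
      "n \<le> 2 ^ R' 17 \<or> R' 17 = i" "R' 17 \<le> i" "M' = M" by auto
    have R12: "R' 12 = n" using I(1) by (simp add: base_regsD[OF base])
    have "2 * 2 ^ R' 17 < (2::nat) ^ B"  "Suc (R' 17) < 2 ^ B" if "2 ^ R' 17 < n"
      using that layout_bounds(6,7) 3(1) I(5) by linarith+
    then show ?case using 3(1,3) I R12 by (auto simp: mult.commute)
  next
    case 4
    show ?case by (rule layout_bounds)
  next
    case (5 k R' M')
    \<comment> \<open>If the exponent grew in every round it is \<open>n\<close> now, and
      \<open>n \<le> 2 ^ n\<close>.\<close>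
    moreover have "n \<le> 2 ^ R' 17"
    proof -
      have "n \<le> 2 ^ n" by (simp add: less_imp_le)
      then show ?thesis using 5(1) by auto
    qed
    ultimately show ?case by (simp add: is_log_def)
  qed auto
  show ?thesis
    unfolding log_com_def wp_Seq wp_SetReg eval_expr.simps
    by (intro conjI) (simp add: one_less_B, simp, rule wp_mono[OF *], auto)
qed

lemma wp_live_card:
  assumes base: "base_regs R" and inp: "input_mem M" and a: "R 10 = a" "a < n" and j: "R 20 = j"
  shows "wp B live_card_com (\<lambda>k (R', M'). k \<le> 3 + W * 7 \<and> (\<forall>q<30. q \<noteq> 18 \<longrightarrow> R' q = R q) \<and>
    R' 18 = card (live a j) \<and> M' = M) (R, M)"
proof -
  define c where "c i = card {w. w < i \<and> bit_index a w < j}" for i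
  have c_Suc: "c (Suc i) = c i + of_bool (bit_index a i < j)" for i
  proof -
    have "{w. w < Suc i \<and> bit_index a w < j} = {w. w < i \<and> bit_index a w < j} \<union>
      (if bit_index a i < j then {i} else {})" by (auto simp: less_Suc_eq)
    then show ?thesis by (simp add: c_def)
  qed
  have c_le: "c i \<le> i" for i
  proof -
    have "c i \<le> card {..<i}" unfolding c_def by (intro card_mono) auto
    then show ?thesis by simp
  qed
  have *: "wp B (For 30 (Reg 2) (bit_index_com ;;
       If (Sub (Reg 20) (Reg 32)) (SetReg 18 (Add (Reg 18) (Num 1))) Skip))
    (\<lambda>k (R', M'). k \<le> 2 + W * 7 \<and> (\<forall>q<30. q \<noteq> 18 \<longrightarrow> R' q = R q) \<and>
    R' 18 = card (live a j) \<and> M' = M) (R(18 := 0), M)"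
  proof (rule wp_For[where N = W and T = 5 and I = "\<lambda>i R' M'. (\<forall>q<30. q \<noteq> 18 \<longrightarrow> R' q = R q) \<and>
      R' 18 = c i \<and> M' = M"], goal_cases)
    case (2 i R' M')
    then show ?case by (simp add: base_regsD[OF base])
  next
    case (3 i R' M')
    then have I: "\<forall>q<30. q \<noteq> 18 \<longrightarrow> R' q = R q" "R' 18 = c i" "M' = M" by auto
    have b: "base_regs R'" using base I(1) by (simp add: base_regs_def)
    have r: "R' 10 = a" "R' 20 = j" using I(1) a j by simp_all
    have "Suc (c i) < 2 ^ B" using c_le[of i] 3(1) layout_bounds(8) by linarith
    then show ?case unfolding wp_Seq I(3)
      by (intro wp_bit_index[OF b inp 3(3,1)]) (use 3(3) I r a in \<open>auto simp: c_Suc\<close>)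
  next
    case 4
    show ?case by (rule layout_bounds)
  qed (auto simp: c_def live_def)
  show ?thesis
    unfolding live_card_com_def wp_Seq wp_SetReg eval_expr.simps
    by (intro conjI) (simp, rule wp_mono[OF *], auto)
qed

text \<open>Subtracting one absorbs the share of the output wire in
  \<open>W \<le> 2 * s + 1\<close>. The factor 32 is what limits the keys to
  \<open>2 ^ (n/16)\<close> up to a polynomial factor.\<close>

definition good_block :: "nat \<Rightarrow> nat \<Rightarrow> nat \<Rightarrow> bool" where
  "good_block l a m \<longleftrightarrow> 32 * ((card (live a m) - 1) * (card (live a m) - 1) * l) \<le> n"

text \<open>The search starts from block length 0, so it always holds a valid candidate.\<close>

lemma good_block_0: "good_block l a 0"
  by (simp add: good_block_def live_def)

definition search_time :: nat where
  "search_time = 6 + (n + 1) * (4 + n * (W * 7 + 12))"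

text \<open>Block lengths are tried in increasing order and each success overwrites the previous
  one, so the last success is a largest one. The invariant speaks of the candidates that
  lexicographically precede \<open>(i, j)\<close>.\<close>

lemma wp_search:
  assumes base: "base_regs R" and inp: "input_mem M" and l: "R 17 = l"
  shows "wp B search_com (\<lambda>k (R', M'). k \<le> search_time \<and> base_regs R' \<and> R' 10 < n \<and> 2 * R' 11 \<le> n \<and>
    good_block l (R' 10) (R' 11) \<and>
    (\<forall>m a. 2 * m \<le> n \<longrightarrow> a < n \<longrightarrow> good_block l a m \<longrightarrow> m \<le> R' 11) \<and> M' = M) (R, M)"
proof -
  define I where "I i j R' M' \<longleftrightarrow> (\<forall>q<10. R' q = R q) \<and> R' 12 = n \<and> R' 17 = l \<and> R' 16 < n \<and> 2 * R' 11 \<le> n \<and> R' 11 \<le> i \<and>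
    good_block l (R' 16) (R' 11) \<and>
    (\<forall>m a. m < i \<or> (m = i \<and> a < j) \<longrightarrow> a < n \<longrightarrow> good_block l a m \<longrightarrow> m \<le> R' 11) \<and> M' = M"
    for i j :: nat and R' M' :: "nat \<Rightarrow> nat"
  have I_upd: "I i j (R'(q := v)) M' \<longleftrightarrow> I i j R' M'" if "20 \<le> q" for i j R' M' q v
    using that by (simp add: I_def)
  have I_base: "base_regs R'" if "I i j R' M'" for i j R' M'
    using that base by (simp add: I_def base_regs_def)
  have nB: "n < 2 ^ B" by (rule layout_bounds)
  have inner: "wp B (SetReg 10 (Reg 21) ;; live_card_com ;; SetReg 18 (Sub (Reg 18) (Num 1)) ;;
         If (Sub (Add (Reg 12) (Num 1)) (Mul (Num 32) (Mul (Mul (Reg 18) (Reg 18)) (Reg 17))))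
           (SetReg 16 (Reg 21) ;; SetReg 11 (Reg 20)) Skip)
       (\<lambda>k (R'', M''). k \<le> W * 7 + 10 \<and> R'' 21 = j \<and> R'' 20 = i \<and> I i (Suc j) (R''(21 := Suc j)) M'') (R', M')"
    if i: "2 * i \<le> n" and j: "j < n" and Ri: "R' 20 = i" and Ij: "I i j R' M'" and rj: "R' 21 = j" for i j R' M'
  proof -
    have b: "base_regs (R'(10 := j))" using I_base[OF Ij] by (simp add: base_regs_def)
    have M': "M' = M" using Ij by (simp add: I_def)
    have "wp B live_card_com (\<lambda>k (R'', M''). k \<le> 3 + W * 7 \<and> (\<forall>q<30. q \<noteq> 18 \<longrightarrow> R'' q = (R'(10 := j)) q) \<and>
      R'' 18 = card (live j i) \<and> M'' = M) (R'(10 := j), M)"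
      by (rule wp_live_card[OF b inp _ j]) (simp_all add: Ri)
    then have "wp B live_card_com (\<lambda>k1. wp B (SetReg 18 (Sub (Reg 18) (Num 1))) (\<lambda>k2.
       wp B (If (Sub (Add (Reg 12) (Num 1)) (Mul (Num 32) (Mul (Mul (Reg 18) (Reg 18)) (Reg 17))))
           (SetReg 16 (Reg 21) ;; SetReg 11 (Reg 20)) Skip) (\<lambda>k3 (R'', M'').
         1 + (k1 + (k2 + k3)) \<le> W * 7 + 10 \<and> R'' 21 = j \<and> R'' 20 = i \<and> I i (Suc j) (R''(21 := Suc j)) M'')))
         (R'(10 := j), M)"
    proof (rule wp_mono, goal_cases)
      case (1 k1 S1)
      obtain R1 M1 where S1: "S1 = (R1, M1)" by (cases S1)
      have 1: "k1 \<le> 3 + W * 7" "\<forall>q<30. q \<noteq> 18 \<longrightarrow> R1 q = (R'(10 := j)) q" "R1 18 = card (live j i)" "M1 = M"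
        using 1 by (auto simp: S1)
      have Ii: "\<forall>q<10. R' q = R q" "R' 12 = n" "R' 17 = l" "R' 16 < n" "2 * R' 11 \<le> n" "R' 11 \<le> i"
        "good_block l (R' 16) (R' 11)"
        "\<And>m a. m < i \<or> (m = i \<and> a < j) \<Longrightarrow> a < n \<Longrightarrow> good_block l a m \<Longrightarrow> m \<le> R' 11"
        using Ij by (auto simp: I_def)
      let ?L = "card (live j i) - 1"
      have "card (live j i) \<le> card {..<W}" by (intro card_mono) (auto simp: live_def)
      then have LB: "?L < 2 ^ B" using layout_bounds(8) by simp
      have ijB: "i < 2 ^ B" "j < 2 ^ B" using i j nB by linarith+
      let ?R = "R1(18 := ?L)"
      have r: "R1 10 = j" "\<forall>q<10. R1 q = R q" "R1 12 = n" "R1 17 = l" "R1 16 = R' 16" "R1 11 = R' 11"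
        "R1 20 = i" "R1 21 = j" using 1(2) Ii Ri rj by auto
      have e1: "eval_expr (Sub (Reg 18) (Num 1)) (R1, M) = ?L" using 1(3) by simp
      \<comment> \<open>With truncated subtraction, \<open>n + 1 - x\<close> is nonzero exactly if
        \<open>x \<le> n\<close>.\<close>
      have e2: "eval_expr (Sub (Add (Reg 12) (Num 1)) (Mul (Num 32) (Mul (Mul (Reg 18) (Reg 18)) (Reg 17)))) (?R, M) \<noteq> 0
          \<longleftrightarrow> good_block l j i"
        using r by (simp add: good_block_def) linarith
      show ?case
      proof (cases "good_block l j i")
        case True
        have "I i (Suc j) (?R(16 := j, 11 := i, 21 := Suc j)) M"
          unfolding I_def
        proof (intro conjI allI impI, goal_cases)
          case (8 m' a')
          then show ?case by auto
        qed (use i j r True in simp_all)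
        then show ?thesis unfolding S1 1(4) wp_SetReg e1 wp_If e2
          using True ijB LB r 1(1) by (simp add: wp_Seq)
      next
        case False
        have "I i (Suc j) (?R(21 := Suc j)) M"
          unfolding I_def
        proof (intro conjI allI impI, goal_cases)
          case (8 m' a')
          then have "m' < i \<or> m' = i \<and> a' < j" using False by (metis less_SucE)
          then show ?case using Ii(8)[of m' a'] 8 r by simp
        qed (use Ii r in simp_all)
        then show ?thesis unfolding S1 1(4) wp_SetReg e1 wp_If e2
          using False LB r 1(1) by simp
      qed
    qed
    moreover have "j < 2 ^ B" using j nB by linarith
    ultimately show ?thesis
      unfolding wp_Seq wp_SetReg by (simp only: eval_expr.simps fst_conv rj M' simp_thms)
  qed
  have outer: "wp B (For 20 (Add (Div (Reg 12) (Num 2)) (Num 1)) (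
       For 21 (Reg 12) (
         SetReg 10 (Reg 21) ;;
         live_card_com ;;
         SetReg 18 (Sub (Reg 18) (Num 1)) ;;
         If (Sub (Add (Reg 12) (Num 1)) (Mul (Num 32) (Mul (Mul (Reg 18) (Reg 18)) (Reg 17))))
           (SetReg 16 (Reg 21) ;; SetReg 11 (Reg 20)) Skip)))
     (\<lambda>k (R', M'). k \<le> 2 + (n div 2 + 1) * (2 + n * (W * 7 + 10 + 2) + 2) \<and> I (n div 2 + 1) 0 R' M')
     (R(16 := 0, 11 := 0), M)"
  proof (rule wp_For[where N = "n div 2 + 1" and T = "2 + n * (W * 7 + 10 + 2)" and I = "\<lambda>i R' M'. I i 0 R' M'"], goal_cases)
    case 1
    show ?case using base l n_pos good_block_0 by (simp add: I_def base_regs_def)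
  next
    case (2 i R' M')
    then show ?case by (simp add: I_def)
  next
    case (3 i R' M')
    show ?case
    proof (rule wp_For[where N = n and T = "W * 7 + 10" and I = "\<lambda>j R' M'. R' 20 = i \<and> I i j R' M'"], goal_cases)
      case 1
      then show ?case using 3 by (simp add: I_upd)
    next
      case (2 j R1 M1)
      then show ?case by (simp add: I_def)
    next
      case (3 j R1 M1)
      have "2 * i \<le> n" using \<open>i < n div 2 + 1\<close> by simp
      from inner[of i j R1 M1, OF this] 3 show ?case by simp
    next
      case 4
      show ?case by (rule nB)
    next
      case (5 k R1 M1)
      then have "I (Suc i) 0 R1 M1" by (auto simp: I_def less_Suc_eq)
      then show ?case using 5 by (simp add: I_upd)
    qed
  next
    case 4
    have "n div 2 + 1 \<le> n + 1" by simp
    then show ?case using layout_bounds(7) n_pos by linarith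
  qed auto
  show ?thesis
    unfolding search_com_def wp_Seq wp_SetReg eval_expr.simps
  proof (intro conjI, simp, simp, rule wp_mono[OF outer], goal_cases)
    case (1 k S)
    obtain R1 M1 where S: "S = (R1, M1)" by (cases S)
    have I1: "I (n div 2 + 1) 0 R1 M1" and k: "k \<le> 2 + (n div 2 + 1) * (2 + n * (W * 7 + 10 + 2) + 2)"
      using 1 by (auto simp: S)
    have "(n div 2 + 1) * (2 + n * (W * 7 + 10 + 2) + 2) \<le> (n + 1) * (4 + n * (W * 7 + 12))"
      by (intro mult_le_mono) auto
    then have t: "k + 3 \<le> search_time" using k unfolding search_time_def by linarith
    have b: "base_regs (R1(10 := R1 16))" using I_base[OF I1] by (simp add: base_regs_def)
    have "R1 16 < 2 ^ B" using I1 nB by (auto simp: I_def)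
    moreover have "\<forall>m a. 2 * m \<le> n \<longrightarrow> a < n \<longrightarrow> good_block l a m \<longrightarrow> m \<le> R1 11"
      using I1 by (auto simp: I_def)
    ultimately show ?case
      using I1 t b unfolding S wp_SetReg by (simp add: I_def)
  qed
qed

definition prepare_time :: nat where
  "prepare_time = search_time + 11 * n + 40"

lemma wp_count_sat:
  assumes inp: "input_mem M" "M 0 = n" "M 1 = W" "M 2 = s" "M 3 = out" and tab: "\<And>p. VAL \<le> p \<Longrightarrow> M p = 0"
  shows "wp B count_sat_com (\<lambda>k (R', M'). \<exists>l a m. is_log l \<and> a < n \<and> 2 * m \<le> n \<and> good_block l a m \<and>
    (\<forall>m' a'. 2 * m' \<le> n \<longrightarrow> a' < n \<longrightarrow> good_block l a' m' \<longrightarrow> m' \<le> m) \<and>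
    k \<le> prepare_time + memo_time a m \<and> R' 0 = (\<Sum>z<2 ^ (n - m). block_count a m z)) (R, M)"
proof -
  define R0 where "R0 = R(12 := n, 2 := W, 3 := s, 4 := out, 5 := VAL, 6 := TYP, 7 := CUR, 8 := REL, 9 := TAB)"
  have b0: "base_regs R0" by (simp add: R0_def base_regs_def)
  have "out < 2 ^ B" using out_less layout_bounds(8) by linarith
  have e: "4 + (W + 2 * s) = VAL" "VAL + W = TYP" "TYP + W = CUR" "CUR + W = REL" "REL + W * W = TAB"
    by (simp_all add: layout_defs)
  have prep: "wp B prepare_com (\<lambda>k S. k = 9 \<and> S = (R0, M)) (R, M)"
    by (simp add: prepare_com_def R0_def inp(2-5) inp(3)[simplified] e layout_bounds(1-6,8,9) \<open>out < 2 ^ B\<close>)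
  show ?thesis unfolding count_sat_com_def wp_Seq
  proof (rule wp_mono[OF prep], goal_cases)
    case (1 k0 S0)
    then have S0: "k0 = 9" "S0 = (R0, M)" by blast+
    show ?case unfolding S0
    proof (rule wp_mono[OF wp_log[OF b0]], goal_cases)
      case (1 k1 S1)
      obtain R1 M1 where S1: "S1 = (R1, M1)" by (cases S1)
      have 1: "k1 \<le> 4 + n * 5" "\<forall>q. q \<notin> {13, 17, 20} \<longrightarrow> R1 q = R0 q" "is_log (R1 17)" "M1 = M"
        using 1 by (auto simp: S1)
      have b1: "base_regs R1" using b0 1(2) by (simp add: base_regs_def)
      show ?case unfolding S1 1(4)
      proof (rule wp_mono[OF wp_search[OF b1 inp(1) refl]], goal_cases)
        case (1 k2 S2)
        obtain R2 M2 where S2: "S2 = (R2, M2)" by (cases S2)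
        define a m where "a = R2 10" and "m = R2 11"
        have 2: "k2 \<le> search_time" "base_regs R2" "a < n" "2 * m \<le> n" "good_block (R1 17) a m"
          "\<forall>m' a'. 2 * m' \<le> n \<longrightarrow> a' < n \<longrightarrow> good_block (R1 17) a' m' \<longrightarrow> m' \<le> m" "M2 = M"
          using 1 by (auto simp: S2 a_def m_def)
        have m: "m \<le> n" using 2(4) by simp
        have d1: "wp B (double_com 13 (Reg 11)) (\<lambda>k (R', M'). k \<le> 3 + m * 3 \<and>
          (\<forall>q. q \<notin> {13, 20} \<longrightarrow> R' q = R2 q) \<and> R' 13 = 2 ^ m \<and> M' = M) (R2, M)"
          by (rule wp_double) (use m in \<open>auto simp: m_def\<close>)
        show ?case unfolding S2 2(7)
        proof (rule wp_mono[OF d1], goal_cases)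
          case (1 k3 S3)
          obtain R3 M3 where S3: "S3 = (R3, M3)" by (cases S3)
          have 3: "k3 \<le> 3 + m * 3" "\<forall>q. q \<notin> {13, 20} \<longrightarrow> R3 q = R2 q" "R3 13 = 2 ^ m" "M3 = M"
            using 1 by (auto simp: S3)
          have b3: "base_regs R3" using 2(2) 3(2) by (simp add: base_regs_def)
          have d2: "wp B (double_com 14 (Sub (Reg 12) (Reg 11))) (\<lambda>k (R', M'). k \<le> 3 + (n - m) * 3 \<and>
            (\<forall>q. q \<notin> {14, 20} \<longrightarrow> R' q = R3 q) \<and> R' 14 = 2 ^ (n - m) \<and> M' = M) (R3, M)"
            by (rule wp_double) (use 3 base_regsD[OF b3] in \<open>auto simp: m_def\<close>)
          show ?case unfolding S3 3(4)
          proof (rule wp_mono[OF d2], goal_cases)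
            case (1 k4 S4)
            obtain R4 M4 where S4: "S4 = (R4, M4)" by (cases S4)
            have 4: "k4 \<le> 3 + (n - m) * 3" "\<forall>q. q \<notin> {14, 20} \<longrightarrow> R4 q = R3 q" "R4 14 = 2 ^ (n - m)" "M4 = M"
              using 1 by (auto simp: S4)
            have b4: "base_regs R4" using b3 4(2) by (simp add: base_regs_def)
            have tab': "M p = 0" if "TAB \<le> p" for p using that by (intro tab) (simp add: layout_defs)
            have r4: "R4 10 = a" "R4 11 = m" "R4 13 = 2 ^ m" using 4(2) 3(2,3) by (simp_all add: a_def m_def)
            have time: "9 + (k1 + (k2 + (k3 + (k4 + k5)))) \<le> prepare_time + memo_time a m" if "k5 \<le> memo_time a m" for k5 :: nat
            proof -
              have "m * 3 \<le> n * 3" "(n - m) * 3 \<le> n * 3" using m by simp_all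
              then have "k1 + k2 + k3 + k4 + 9 \<le> prepare_time"
                using \<open>k1 \<le> _\<close> 2(1) 3(1) 4(1) unfolding prepare_time_def by linarith
              then show ?thesis using that by linarith
            qed
            show ?case unfolding S4 4(4)
              apply (rule wp_mono[OF wp_memo[OF b4 inp(1) r4(1) 2(3) r4(2) m r4(3) 4(3) tab']])
               apply assumption
              apply clarify
              using \<open>is_log (R1 17)\<close> 2 time by blast
          qed
        qed
      qed
    qed
  qed
qed

end

section \<open>Combinatorial bounds\<close>

lemma card_block_sum:
  fixes M N :: nat
  shows "card {X. X < N * M \<and> P X} = (\<Sum>z<N. card {y. y < M \<and> P (z * M + y)})"
proof (induction N)
  case (Suc N)
  have eq: "{X. X < Suc N * M \<and> P X} = {X. X < N * M \<and> P X} \<union> (\<lambda>y. N * M + y) ` {y. y < M \<and> P (N * M + y)}"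
  proof (intro equalityI subsetI)
    fix X assume X: "X \<in> {X. X < Suc N * M \<and> P X}"
    show "X \<in> {X. X < N * M \<and> P X} \<union> (\<lambda>y. N * M + y) ` {y. y < M \<and> P (N * M + y)}"
    proof (cases "X < N * M")
      case False
      then have "X = N * M + (X - N * M)" "X - N * M < M" using X by auto
      then show ?thesis using X by auto
    qed (use X in simp)
  qed auto
  show ?case unfolding eq
    by (subst card_Un_disjoint) (auto simp: Suc.IH card_image)
qed simp

lemma bij_betw_add_mod:
  fixes n c :: nat
  assumes "0 < n"
  shows "bij_betw (\<lambda>a. (c + a) mod n) {..<n} {..<n}"
proof -
  have inj: "inj_on (\<lambda>a. (c + a) mod n) {..<n}"
  proof (rule inj_onI)
    fix a b assume ab: "a \<in> {..<n}" "b \<in> {..<n}" and eq: "(c + a) mod n = (c + b) mod n"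
    have "(int c + int a) mod int n = (int c + int b) mod int n"
      using eq by (metis of_nat_add of_nat_mod)
    then have "int n dvd int a - int b" by (simp add: mod_eq_dvd_iff)
    then have "int a mod int n = int b mod int n" by (simp add: mod_eq_dvd_iff)
    then show "a = b" using ab by simp
  qed
  have "(\<lambda>a. (c + a) mod n) ` {..<n} \<subseteq> {..<n}" using assms by auto
  from endo_inj_surj[OF finite_lessThan this inj] inj show ?thesis
    unfolding bij_betw_def by (intro conjI)
qed

definition input_bits :: "nat \<Rightarrow> nat \<Rightarrow> nat \<Rightarrow> bool list" where
  "input_bits n a X = map (\<lambda>i. odd (X div 2 ^ ((i + a) mod n))) [0..<n]"

text \<open>Injective, because the rotation reaches every bit position below \<open>n\<close>; onto,
  because both sets have \<open>2 ^ n\<close> elements.\<close>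

lemma bij_betw_input_bits:
  assumes "0 < n"
  shows "bij_betw (input_bits n a) {..<2 ^ n} {x. length x = n}"
proof -
  have inj: "inj_on (input_bits n a) {..<2 ^ n}"
  proof (rule inj_onI)
    fix X Y :: nat
    assume XY: "X \<in> {..<2 ^ n}" "Y \<in> {..<2 ^ n}" and eq: "input_bits n a X = input_bits n a Y"
    show "X = Y"
    proof (rule bit_eqI)
      fix q
      show "bit X q \<longleftrightarrow> bit Y q"
      proof (cases "q < n")
        case True
        have "q \<in> (\<lambda>i. (a + i) mod n) ` {..<n}"
          unfolding bij_betw_imp_surj_on[OF bij_betw_add_mod[OF assms]] using True by simp
        then obtain i where i: "i < n" "(a + i) mod n = q" by blast
        have "input_bits n a X ! i = input_bits n a Y ! i" by (simp only: eq)
        then show ?thesis using i by (simp add: input_bits_def bit_iff_odd add.commute)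
      next
        case False
        then have pow: "(2::nat) ^ n \<le> 2 ^ q" by (intro power_increasing) auto
        have "X < 2 ^ q" "Y < 2 ^ q" using XY less_le_trans[OF _ pow] by blast+
        then show ?thesis by (simp add: bit_iff_odd)
      qed
    qed
  qed
  have sub: "input_bits n a ` {..<2 ^ n} \<subseteq> {x. length x = n}" by (auto simp: input_bits_def)
  have fin: "finite {x :: bool list. length x = n}" "card {x :: bool list. length x = n} = 2 ^ n"
    using finite_lists_length_eq[of "UNIV :: bool set" n] card_lists_length_eq[of "UNIV :: bool set" n]
    by simp_all
  have "input_bits n a ` {..<2 ^ n} = {x. length x = n}"
    by (rule card_subset_eq[OF fin(1) sub]) (simp add: card_image[OF inj] fin(2))
  then show ?thesis using inj by (simp add: bij_betw_def)
qed

context layout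
begin

lemma sum_block_count:
  assumes "m \<le> n"
  shows "(\<Sum>z<2 ^ (n - m). block_count a m z) = card {X. X < 2 ^ n \<and> circuit_out a X}"
proof -
  have "2 ^ (n - m) * 2 ^ m = (2::nat) ^ n" using assms by (simp flip: power_add)
  then show ?thesis
    using card_block_sum[of "2 ^ (n - m)" "2 ^ m" "circuit_out a"] by (simp add: block_count_def)
qed

text \<open>Double counting: as the rotation runs through all \<open>n\<close> values, the bit read
  by a fixed wire visits every position once, so the wire is live \<open>m\<close> times.\<close>

lemma sum_card_live:
  assumes "m \<le> n"
  shows "(\<Sum>a<n. card (live a m)) = W * m"
proof -
  have "(\<Sum>a<n. card (live a m)) = (\<Sum>a<n. \<Sum>w<W. of_bool (bit_index a w < m))"
  proof (rule sum.cong[OF refl])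
    fix a
    have "live a m = {..<W} \<inter> {w. bit_index a w < m}" by (auto simp: live_def)
    then show "card (live a m) = (\<Sum>w<W. of_bool (bit_index a w < m))" by simp
  qed
  also have "\<dots> = (\<Sum>w<W. \<Sum>a<n. of_bool (bit_index a w < m))" by (rule sum.swap)
  also have "\<dots> = (\<Sum>w<W. m)"
  proof (rule sum.cong[OF refl])
    fix w
    have "(\<Sum>a<n. of_bool (bit_index a w < m)) = (\<Sum>q<n. of_bool (q < m) :: nat)"
      unfolding bit_index_def by (rule sum.reindex_bij_betw[OF bij_betw_add_mod[OF n_pos]])
    also have "\<dots> = card ({..<n} \<inter> {q. q < m})" by simp
    also have "{..<n} \<inter> {q. q < m} = {..<m}" using assms by auto
    finally show "(\<Sum>a<n. of_bool (bit_index a w < m)) = m" by simp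
  qed
  finally show ?thesis by simp
qed

lemma exists_sparse_block:
  assumes "m \<le> n"
  shows "\<exists>a<n. n * card (live a m) \<le> W * m"
proof (rule ccontr)
  assume "\<not> ?thesis"
  then have *: "W * m < n * card (live a m)" if "a < n" for a using that by auto
  have "(\<Sum>a<n. W * m) < (\<Sum>a<n. n * card (live a m))"
    by (rule sum_strict_mono) (use * n_pos in auto)
  also have "\<dots> = n * (W * m)" by (simp add: sum_distrib_left[symmetric] sum_card_live[OF assms])
  finally show False by simp
qed

text \<open>A key is a list of at most \<open>L^2\<close> gates, each from \<open>L^2\<close> pairs,
  together with a tag below \<open>W + 2\<close>, where \<open>L\<close> is the number of live
  wires.\<close>

lemma card_block_keys:
  "card (block_key a m ` Z) \<le> (W + 2) * ((card (live a m))\<^sup>2 + 1) ^ ((card (live a m))\<^sup>2 + 1)"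
proof -
  let ?A = "live a m" and ?q = "(card (live a m))\<^sup>2"
  let ?E = "{es. set es \<subseteq> ?A \<times> ?A \<and> length es \<le> ?q}"
  have fin: "finite (?A \<times> ?A)" by (simp add: finite_live)
  have "block_key a m z \<in> key_num W ` (?E \<times> {..<W + 2})" for z
  proof -
    let ?c = "lit_fun a (z * 2 ^ m)"
    obtain cur r es where S: "fold sim_gate (gate_list s) (id, init_rel ?A ?c, []) = (cur, r, es)"
      using prod_cases3 by blast
    let ?t = "final_tag ?A ?c (cur out)"
    have k: "sim_key ?A ?c (gate_list s) out = (es, ?t)" by (simp add: sim_key_def S)
    have "sim_bd ?A (cur, r, es)"
      using sim_bd_fold[OF sim_bd_init[OF finite_live] finite_live gate_list_neq[OF order_refl]] S by metis
    then have "es \<in> ?E"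
      using rel_count_le[OF finite_live[of a m], of r] by (auto simp: sim_bd_def)
    moreover have "?t < W + 2" using sim_key_bounds(2)[OF k refl] .
    ultimately show ?thesis by (auto simp: block_key_def k)
  qed
  then have "block_key a m ` Z \<subseteq> key_num W ` (?E \<times> {..<W + 2})" by blast
  moreover have finE: "finite ?E" using finite_lists_length_le[OF fin] .
  ultimately have 1: "card (block_key a m ` Z) \<le> card (?E \<times> {..<W + 2})"
    by (meson card_image_le card_mono finite_SigmaI finite_imageI finite_lessThan order_trans)
  have "card ?E = (\<Sum>i\<le>?q. ?q ^ i)"
    using card_lists_length_le[OF fin, of ?q] by (simp add: card_cartesian_product power2_eq_square)
  \<comment> \<open>With base \<open>?q + 1\<close> each of the \<open>?q + 1\<close> summands is at
    most \<open>(?q + 1) ^ ?q\<close>, also for \<open>?q = 0\<close>.\<close>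
  also have "\<dots> \<le> (\<Sum>i\<le>?q. (?q + 1) ^ ?q)"
  proof (rule sum_mono)
    fix i assume "i \<in> {..?q}"
    have "?q ^ i \<le> (?q + 1) ^ i" by (intro power_mono) auto
    also have "\<dots> \<le> (?q + 1) ^ ?q" using \<open>i \<in> {..?q}\<close> by (intro power_increasing) auto
    finally show "?q ^ i \<le> (?q + 1) ^ ?q" .
  qed
  also have "\<dots> = (?q + 1) ^ (?q + 1)" by simp
  finally have "(W + 2) * card ?E \<le> (W + 2) * (?q + 1) ^ (?q + 1)" by (rule mult_le_mono2)
  then show ?thesis using 1 unfolding card_cartesian_product card_lessThan mult.commute[of _ "W + 2"] by linarith
qed

text \<open>With \<open>u = L - 1\<close> the exponent \<open>L^2 + 1\<close> is at most
  \<open>2 u^2 + 3\<close>, and the base is at most \<open>n \<le> 2 ^ l\<close>. The part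
  \<open>2 u^2 l\<close> of the resulting exponent is \<open>e\<close>; the remaining
  \<open>(2 ^ l)^3\<close> is at most \<open>(2 n)^3\<close>, which explains
  \<open>8 * n ^ 3\<close>.\<close>

lemma card_block_keys_good:
  assumes l: "is_log l" and good: "good_block l a m" and n4: "4 \<le> n"
  obtains e where "16 * e \<le> n" "card (block_key a m ` Z) \<le> (W + 2) * (8 * n ^ 3) * 2 ^ e"
proof -
  define u where "u = card (live a m) - 1"
  have l2: "2 \<le> l"
  proof (rule ccontr)
    assume "\<not> 2 \<le> l"
    then have "(2::nat) ^ l \<le> 2 ^ 1" by (intro power_increasing) auto
    then show False using l n4 by (simp add: is_log_def)
  qed
  have u: "32 * (u * u * l) \<le> n" using good by (simp add: good_block_def u_def)
  have "u * u * 2 \<le> u * u * l" using l2 by (intro mult_le_mono2)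
  then have uu: "64 * (u * u) \<le> n" using u by linarith
  have "(card (live a m))\<^sup>2 \<le> (u + 1)\<^sup>2" by (intro power_mono) (auto simp: u_def)
  also have "(u + 1)\<^sup>2 \<le> 2 * (u * u) + 2"
  proof -
    have "2 * u \<le> u * u + 1" by (cases u) auto
    then show ?thesis by (simp add: power2_eq_square algebra_simps)
  qed
  finally have q: "(card (live a m))\<^sup>2 + 1 \<le> 2 * (u * u) + 3" by simp
  \<comment> \<open>From \<open>64 u^2 \<le> n\<close> the left side is at most
    \<open>n / 32 + 3\<close>, which is below \<open>n\<close> from 4 on.\<close>
  have "2 * (u * u) + 3 \<le> n" using uu n4 by linarith
  also have "n \<le> 2 ^ l" using l by (simp add: is_log_def)
  finally have q2: "(card (live a m))\<^sup>2 + 1 \<le> 2 ^ l" using q by linarith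
  have "((card (live a m))\<^sup>2 + 1) ^ ((card (live a m))\<^sup>2 + 1) \<le> (2 ^ l) ^ ((card (live a m))\<^sup>2 + 1)"
    by (rule power_mono[OF q2]) simp
  also have "\<dots> \<le> (2 ^ l) ^ (2 * (u * u) + 3)"
    by (rule power_increasing[OF q]) simp
  also have "\<dots> = 2 ^ (2 * (u * u * l)) * (2 ^ l) ^ 3"
    by (simp add: power_add power_mult[symmetric] algebra_simps)
  also have "(2 ^ l) ^ 3 \<le> (2 * n) ^ 3"
  proof (rule power_mono)
    have "(2::nat) ^ l = 2 * 2 ^ (l - 1)" using l2 by (cases l) auto
    also have "2 ^ (l - 1) \<le> n" using l l2 by (auto simp: is_log_def)
    finally show "2 ^ l \<le> 2 * n" by simp
  qed simp
  also have "(2 * n) ^ 3 = 8 * n ^ 3" by (simp add: power_mult_distrib)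
  finally have "((card (live a m))\<^sup>2 + 1) ^ ((card (live a m))\<^sup>2 + 1) \<le> 2 ^ (2 * (u * u * l)) * (8 * n ^ 3)"
    by simp
  then have "(W + 2) * ((card (live a m))\<^sup>2 + 1) ^ ((card (live a m))\<^sup>2 + 1)
      \<le> (W + 2) * (2 ^ (2 * (u * u * l)) * (8 * n ^ 3))" by (rule mult_le_mono2)
  then have "card (block_key a m ` Z) \<le> (W + 2) * (8 * n ^ 3) * 2 ^ (2 * (u * u * l))"
    using card_block_keys[of a m Z] by (simp add: algebra_simps)
  moreover have "16 * (2 * (u * u * l)) \<le> n" using u by simp
  ultimately show ?thesis using that by blast
qed

definition poly_time :: nat where
  "poly_time = prepare_time + key_time + 15 + (W + 2) * (8 * n ^ 3) * (count_time + 10)"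

text \<open>The misses are paid for by \<open>e + m + k \<le> n / 16 + n / 2 + n / 4 < n\<close>,
  the key computations of all blocks by \<open>k \<le> m\<close>.\<close>

lemma total_time_le:
  assumes "is_log l" "good_block l a m" "4 \<le> n" "2 * m \<le> n" "k \<le> m" "4 * k \<le> n"
  shows "prepare_time + memo_time a m \<le> 2 ^ (n - k) * poly_time"
proof -
  obtain e where e: "16 * e \<le> n"
    "card (block_key a m ` {..<2 ^ (n - m)}) \<le> (W + 2) * (8 * n ^ 3) * 2 ^ e"
    using card_block_keys_good[OF assms(1-3)] by blast
  let ?P = "2 ^ (n - k) :: nat"
  have P1: "1 \<le> ?P" by simp
  have 1: "2 ^ (n - m) * (key_time + 10) \<le> ?P * (key_time + 10)"
    using assms by (intro mult_le_mono1 power_increasing) auto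
  have "2 ^ e * (2 ^ m * count_time + 10) \<le> 2 ^ e * (2 ^ m * (count_time + 10))"
    by (intro mult_le_mono2) (simp add: algebra_simps)
  also have "\<dots> = 2 ^ (e + m) * (count_time + 10)" by (simp add: power_add)
  also have "\<dots> \<le> ?P * (count_time + 10)"
    using assms e(1) by (intro mult_le_mono1 power_increasing) auto
  finally have 2: "2 ^ e * (2 ^ m * count_time + 10) \<le> ?P * (count_time + 10)" .
  define c where "c = (W + 2) * (8 * n ^ 3)"
  have "card (block_key a m ` {..<2 ^ (n - m)}) * (2 ^ m * count_time + 10)
      \<le> c * 2 ^ e * (2 ^ m * count_time + 10)"
    using e(2) unfolding c_def by (rule mult_le_mono1)
  also have "\<dots> = c * (2 ^ e * (2 ^ m * count_time + 10))" by (rule mult.assoc)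
  also have "\<dots> \<le> c * (?P * (count_time + 10))" using 2 by (rule mult_le_mono2)
  also have "\<dots> = ?P * (c * (count_time + 10))" by (rule mult.left_commute)
  finally have 3: "card (block_key a m ` {..<2 ^ (n - m)}) * (2 ^ m * count_time + 10)
      \<le> ?P * (c * (count_time + 10))" .
  have 4: "prepare_time + 5 \<le> ?P * (prepare_time + 5)" using P1 by (metis mult_le_mono1 nat_mult_1)
  have "?P * poly_time = ?P * (prepare_time + 5) + ?P * (key_time + 10) +
      ?P * (c * (count_time + 10))"
    unfolding poly_time_def c_def[symmetric] by (simp add: add_mult_distrib2)
  then show ?thesis unfolding memo_time_def using 1 3 4 by linarith
qed

end

section \<open>The size bound and the encoding of circuits\<close>

definition poly_fun :: "(nat \<Rightarrow> nat) \<Rightarrow> bool" where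
  "poly_fun f \<longleftrightarrow> (\<exists>p::nat poly. \<forall>n. poly p n = f n)"

lemma poly_fun_const: "poly_fun (\<lambda>n. c)"
  unfolding poly_fun_def by (rule exI[of _ "[:c:]"]) simp

lemma poly_fun_id: "poly_fun (\<lambda>n. n)"
  unfolding poly_fun_def by (rule exI[of _ "[:0, 1:]"]) simp

lemma poly_fun_add: "poly_fun f \<Longrightarrow> poly_fun g \<Longrightarrow> poly_fun (\<lambda>n. f n + g n)"
  unfolding poly_fun_def by (metis poly_add)

lemma poly_fun_mult: "poly_fun f \<Longrightarrow> poly_fun g \<Longrightarrow> poly_fun (\<lambda>n. f n * g n)"
  unfolding poly_fun_def by (metis poly_mult)

lemma poly_fun_power: "poly_fun f \<Longrightarrow> poly_fun (\<lambda>n. f n ^ i)"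
  unfolding poly_fun_def by (metis poly_power)

lemmas poly_fun_intros = poly_fun_const poly_fun_id poly_fun_add poly_fun_mult poly_fun_power

text \<open>This is \<open>poly_time\<close> with all its parts unfolded. As a monotone function of
  \<open>W\<close> and \<open>s\<close> it lets both be replaced by polynomials in
  \<open>n\<close>.\<close>

definition time_bound :: "nat \<Rightarrow> nat \<Rightarrow> nat \<Rightarrow> nat" where
  "time_bound n W s =
     6 + (n + 1) * (4 + n * (W * 7 + 12)) + 11 * n + 40 +
     (2 + W * (3 * n + 14) + 20 + W * (7 + W * 3) + s * (16 + W * 12)) + 15 +
     (W + 2) * (8 * n ^ 3) * (2 + W * (3 * n + 14) + (2 + s * 10) + 5 + 10)"

lemma (in layout) poly_time_eq: "poly_time = time_bound n W s"
  by (simp add: poly_time_def time_bound_def prepare_time_def search_time_def key_time_def load_time_def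
      count_time_def eval_time_def)

lemma time_bound_mono: "W \<le> W' \<Longrightarrow> s \<le> s' \<Longrightarrow> time_bound n W s \<le> time_bound n W' s'"
  unfolding time_bound_def by (intro add_mono mult_le_mono order_refl)

text \<open>Each of the three summands secures one of the conditions on \<open>B\<close> in
  \<open>layout\<close>; the last one comes from \<open>W + 2 < 2 ^ (W + 2)\<close>.\<close>

definition bit_bound :: "nat \<Rightarrow> nat \<Rightarrow> nat \<Rightarrow> nat" where
  "bit_bound n W s = n + 3 + (4 * W + 2 * s + W * W + 5 + 4 * n) + (W + 2) * (2 * s + 2)"

lemma bit_bound_mono: "W \<le> W' \<Longrightarrow> s \<le> s' \<Longrightarrow> bit_bound n W s \<le> bit_bound n W' s'"
  unfolding bit_bound_def by (intro add_mono mult_le_mono order_refl)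

lemma less_two_power_mono: "x \<le> b \<Longrightarrow> x < (2::nat) ^ b"
  using less_exp[of b] by linarith

lemma bit_bound_sufficient:
  assumes "bit_bound n W s \<le> B"
  shows "n + 3 \<le> B" "4 * W + 2 * s + W * W + 5 + 4 * n < 2 ^ B" "(W + 2) ^ (2 * s + 2) < 2 ^ B"
proof -
  show "n + 3 \<le> B" "4 * W + 2 * s + W * W + 5 + 4 * n < 2 ^ B"
    using assms by (simp_all add: bit_bound_def less_two_power_mono)
  have "(W + 2) ^ (2 * s + 2) \<le> (2 ^ (W + 2)) ^ (2 * s + 2)"
    by (intro power_mono less_imp_le less_exp) simp
  also have "\<dots> = 2 ^ ((W + 2) * (2 * s + 2))" by (rule power_mult[symmetric])
  also have "\<dots> < 2 ^ B"
    by (rule power_strict_increasing) (use assms in \<open>simp_all add: bit_bound_def\<close>)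
  finally show "(W + 2) ^ (2 * s + 2) < 2 ^ B" .
qed

section \<open>Consequences of the size bound\<close>

lemma size_bound_imp:
  fixes n k s :: nat
  assumes n4: "4 \<le> n" and k: "1 \<le> k"
    and s: "real s \<le> real n powr (3/2) / (16 * real k * sqrt (log 2 (real n)))"
  shows "s \<le> n\<^sup>2" "real s * k * sqrt (log 2 (real n)) * 16 \<le> n * sqrt n"
proof -
  let ?L = "log 2 (real n)"
  have n0: "0 < real n" using n4 by simp
  have L: "2 \<le> ?L" using n4 by (simp add: le_log_iff)
  then have L1: "1 \<le> sqrt ?L" by simp
  have "real n powr (3/2) = real n powr (1 + 1/2)" by simp
  also have "\<dots> = n * sqrt n" unfolding powr_add using n0 by (simp add: powr_half_sqrt)
  finally have p: "real n powr (3/2) = n * sqrt n" .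
  have pos: "0 < 16 * real k * sqrt ?L" using k L by simp
  show 1: "real s * k * sqrt ?L * 16 \<le> n * sqrt n"
    using s pos unfolding p by (simp add: pos_le_divide_eq mult_ac)
  have "1 * 1 \<le> real k * sqrt ?L" using k L1 by (intro mult_mono) auto
  then have "1 \<le> k * sqrt ?L * 16" by simp
  then have "real s * 1 \<le> real s * (k * sqrt ?L * 16)" by (intro mult_left_mono) auto
  also have "\<dots> \<le> n * sqrt n" using 1 by (simp add: mult_ac)
  also have "\<dots> \<le> n * real n"
  proof (rule mult_left_mono)
    have "sqrt n \<le> sqrt (real n * real n)" using n4 by (intro real_sqrt_le_mono) simp
    then show "sqrt n \<le> n" by simp
  qed simp
  also have "\<dots> = real (n\<^sup>2)" by (simp add: power2_eq_square)
  finally show "s \<le> n\<^sup>2" by (simp del: of_nat_power)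
qed

text \<open>Here the constant 16 is spent. With \<open>u = c - 1\<close> the density gives
  \<open>n u \<le> 2 s k\<close>, the size bound turns this into
  \<open>8 u sqrt (log n) \<le> sqrt n\<close>, and squaring yields
  \<open>64 u^2 log n \<le> n\<close>. Since \<open>l \<le> 2 log n\<close>, half of the factor 64
  remains.\<close>

lemma sparse_block_good:
  fixes n k s c l W :: nat
  assumes n4: "4 \<le> n" and k: "1 \<le> k" "4 * k \<le> n"
    and s: "real s \<le> real n powr (3/2) / (16 * real k * sqrt (log 2 (real n)))"
    and W: "W \<le> 2 * s + 1" and c: "n * c \<le> W * k" and l: "l = 0 \<or> 2 ^ (l - 1) < n"
  shows "32 * ((c - 1) * (c - 1) * l) \<le> n"
proof (cases "c \<le> 1 \<or> l = 0")
  case False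
  let ?L = "log 2 (real n)"
  define u where "u = real (c - 1)"
  have n0: "0 < real n" using n4 by simp
  have L: "2 \<le> ?L" using n4 by (simp add: le_log_iff)
  have "real l - 1 \<le> ?L"
  proof -
    have "2 powr (real l - 1) = real (2 ^ (l - 1))"
      using False by (simp add: powr_realpow[symmetric] of_nat_diff)
    also have "\<dots> \<le> n" using l False by (simp only: of_nat_le_iff) simp
    finally show ?thesis using n0 by (simp add: le_log_iff)
  qed
  \<comment> \<open>Rounding up adds at most 1, which \<open>2 \<le> ?L\<close> absorbs.\<close>
  then have l2: "real l \<le> 2 * ?L" using L by linarith
  have u: "real c = u + 1" "0 \<le> u" using False by (simp_all add: u_def of_nat_diff)
  have "n * c \<le> (2 * s + 1) * k" using c mult_le_mono1[OF W, of k] by (rule order_trans)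
  then have "real (n * c) \<le> real ((2 * s + 1) * k)" by (simp only: of_nat_le_iff)
  then have "n * (u + 1) \<le> 2 * (real s * k) + k" unfolding u(1)[symmetric] by (simp add: algebra_simps)
  moreover have "real k \<le> n" using k(2) by simp
  \<comment> \<open>The summand \<open>k\<close> caused by the output wire cancels against the
    \<open>n\<close> in \<open>n * (u + 1)\<close>.\<close>
  ultimately have 1: "n * u \<le> 2 * (real s * k)" by (simp add: algebra_simps)
  have "n * u * (sqrt ?L * 8) \<le> 2 * (real s * k) * (sqrt ?L * 8)"
    using L by (intro mult_right_mono[OF 1]) simp
  also have "\<dots> = real s * k * sqrt ?L * 16" by simp
  also have "\<dots> \<le> n * sqrt n" by (rule size_bound_imp(2)[OF n4 k(1) s])
  finally have "n * (u * (sqrt ?L * 8)) \<le> n * sqrt n" by (simp add: mult_ac)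
  then have "u * (sqrt ?L * 8) \<le> sqrt n" using n0 by simp
  then have "(u * (sqrt ?L * 8))\<^sup>2 \<le> (sqrt n)\<^sup>2" using u(2) L by (intro power_mono) auto
  then have 2: "u\<^sup>2 * ?L * 64 \<le> n" using L by (simp add: power_mult_distrib algebra_simps)
  have "32 * (u\<^sup>2 * l) \<le> 32 * (u\<^sup>2 * (2 * ?L))" using l2 by (intro mult_left_mono) auto
  also have "\<dots> = u\<^sup>2 * ?L * 64" by simp
  finally have "32 * (u\<^sup>2 * l) \<le> n" using 2 by linarith
  then have "real (32 * ((c - 1) * (c - 1) * l)) \<le> real n"
    by (simp add: u_def power2_eq_square)
  then show ?thesis by (simp only: of_nat_le_iff)
qed auto

section \<open>Reading the encoded circuit\<close>

lemma position_nth: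
  assumes "w \<in> set ws"
  shows "position ws w < length ws" "ws ! position ws w = w"
proof -
  obtain i where "i < length ws \<and> ws ! i = w" using assms by (auto simp: in_set_conv_nth)
  then have "position ws w < length ws \<and> ws ! position ws w = w"
    unfolding position_def by (rule LeastI)
  then show "position ws w < length ws" "ws ! position ws w = w" by auto
qed

lemma nth_concat_pairs:
  assumes "g < length xs"
  shows "concat (map (\<lambda>(i, j). [f i, f j]) xs) ! (2 * g) = f (fst (xs ! g))"
    "concat (map (\<lambda>(i, j). [f i, f j]) xs) ! (2 * g + 1) = f (snd (xs ! g))"
  using assms
proof (induction xs arbitrary: g)
  case (Cons x xs)
  {
    case 1
    then show ?case using Cons(1)[of "g - 1"] by (cases g; cases x) auto
  next
    case 2
    then show ?case using Cons(2)[of "g - 1"] by (cases g; cases x) auto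
  }
qed auto

lemma length_concat_pairs: "length (concat (map (\<lambda>(i, j). [f i, f j]) xs)) = 2 * length xs"
  by (induction xs) auto

lemma encode_circuit_nth:
  fixes n C ws
  defines "xs \<equiv> encode_circuit n C ws"
  shows "length xs = 4 + length ws + 2 * length (gates C)"
    "xs ! 0 = n" "xs ! 1 = length ws" "xs ! 2 = length (gates C)" "xs ! 3 = position ws (out_wire C)"
    "w < length ws \<Longrightarrow> xs ! (4 + w) = encode_literal (label C (ws ! w))"
    "g < length (gates C) \<Longrightarrow> xs ! (4 + length ws + 2 * g) = position ws (fst (gates C ! g))"
    "g < length (gates C) \<Longrightarrow> xs ! (5 + length ws + 2 * g) = position ws (snd (gates C ! g))"
proof -
  let ?h = "[n, length ws, length (gates C), position ws (out_wire C)]"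
  let ?ls = "map (\<lambda>w. encode_literal (label C w)) ws"
  let ?gs = "concat (map (\<lambda>(i, j). [position ws i, position ws j]) (gates C))"
  have xs: "xs = ?h @ ?ls @ ?gs" by (simp add: xs_def encode_circuit_def)
  show "length xs = 4 + length ws + 2 * length (gates C)"
    unfolding xs length_append length_concat_pairs by simp
  show "xs ! 0 = n" "xs ! 1 = length ws" "xs ! 2 = length (gates C)" "xs ! 3 = position ws (out_wire C)"
    by (simp_all add: xs)
  show "xs ! (4 + w) = encode_literal (label C (ws ! w))" if "w < length ws"
    using that by (simp add: xs nth_append)
  have tail: "xs ! (4 + length ws + i) = ?gs ! i" for i
    unfolding xs by (simp add: nth_append)
  show "xs ! (4 + length ws + 2 * g) = position ws (fst (gates C ! g))" if "g < length (gates C)"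
    unfolding tail by (rule nth_concat_pairs(1)[OF that])
  have "5 + length ws + 2 * g = 4 + length ws + (2 * g + 1)" by simp
  then show "xs ! (5 + length ws + 2 * g) = position ws (snd (gates C ! g))" if "g < length (gates C)"
    using tail[of "2 * g + 1"] nth_concat_pairs(2)[OF that, of "position ws"] by metis
qed

text \<open>On a list without repetitions \<open>position\<close> is inverse to indexing, so
  renaming wires by their positions commutes with applying gates.\<close>

lemma fold_apply_gate_positions:
  assumes "distinct ws" "\<forall>(i, j)\<in>set gs. i \<in> set ws \<and> j \<in> set ws"
    and "\<And>p. p < length ws \<Longrightarrow> v' p = v (ws ! p)" and "p < length ws"
  shows "fold apply_gate (map (map_prod (position ws) (position ws)) gs) v' p = fold apply_gate gs v (ws ! p)"
  using assms
proof (induction gs arbitrary: v v')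
  case (Cons g gs)
  obtain i j where g: "g = (i, j)" by (cases g)
  have ij: "i \<in> set ws" "j \<in> set ws" using Cons.prems(2) by (auto simp: g)
  have pos: "q = position ws x \<longleftrightarrow> ws ! q = x" if "x \<in> set ws" "q < length ws" for q x
    using position_nth[OF that(1)] that Cons.prems(1) by (metis nth_eq_iff_index_eq)
  have "apply_gate (map_prod (position ws) (position ws) g) v' q = apply_gate g v (ws ! q)"
    if "q < length ws" for q
    using that pos[OF ij(1) that] pos[OF ij(2) that] Cons.prems(3) position_nth[OF ij(1)] position_nth[OF ij(2)]
    by (simp add: g)
  then show ?case using Cons.IH[of "apply_gate (map_prod (position ws) (position ws) g) v'" "apply_gate g v"]
    Cons.prems by simp
qed simp

lemma encode_literal_less: "var_of x < n \<Longrightarrow> encode_literal x < 2 * n"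
  by (cases x) auto

section \<open>Correctness and running time of the algorithm\<close>

lemma count_sat_com_correct:
  assumes k: "1 \<le> k" "real k \<le> real n / 4" and C: "comparator_circuit n C"
    and size: "real (circuit_size C) \<le> real n powr (3/2) / (16 * real k * sqrt (log 2 (real n)))"
    and ws: "wire_listing C ws"
  shows "computes_within count_sat_com (encode_circuit n C ws) (num_sat n C)
    (2 ^ (n - k) * (time_bound n (3 * n\<^sup>2) (n\<^sup>2) * com_weight count_sat_com * (bit_bound n (3 * n\<^sup>2) (n\<^sup>2))\<^sup>2))"
proof -
  define W where "W = length ws"
  define s where "s = length (gates C)"
  define code where "code w = encode_literal (label C (ws ! w))" for w
  define ga where "ga g = position ws (fst (gates C ! g))" for g
  define gb where "gb g = position ws (snd (gates C ! g))" for g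
  define out where "out = position ws (out_wire C)"
  define B where "B = bit_bound n (3 * n\<^sup>2) (n\<^sup>2)"
  define xs where "xs = encode_circuit n C ws"
  have k4: "4 * k \<le> n" using k(2) by linarith
  have n4: "4 \<le> n" using k(1) k4 by linarith
  have sz: "real s \<le> real n powr (3/2) / (16 * real k * sqrt (log 2 (real n)))"
    using size by (simp add: s_def circuit_size_def)
  have sn: "s \<le> n\<^sup>2" by (rule size_bound_imp(1)[OF n4 k(1) sz])
  have dist: "distinct ws" and set_ws: "set ws = occurring_wires C" using ws by (auto simp: wire_listing_def)
  have sub: "set ws \<subseteq> wires C"
    using C unfolding set_ws occurring_wires_def comparator_circuit_def by force
  have gates_ws: "\<forall>(i, j)\<in>set (gates C). i \<in> set ws \<and> j \<in> set ws"
    unfolding set_ws occurring_wires_def by force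
  have out_ws: "out_wire C \<in> set ws" unfolding set_ws occurring_wires_def by simp
  have W: "W \<le> 2 * s + 1"
  proof -
    have "W = card (occurring_wires C)" using distinct_card[OF dist] set_ws by (simp add: W_def)
    also have "\<dots> \<le> Suc (card (fst ` set (gates C) \<union> snd ` set (gates C)))"
      unfolding occurring_wires_def by (rule card_insert_le_m1) auto
    also have "\<dots> \<le> Suc (card (fst ` set (gates C)) + card (snd ` set (gates C)))"
      using card_Un_le by auto
    also have "\<dots> \<le> Suc (s + s)"
      using card_image_le[of "set (gates C)" fst] card_image_le[of "set (gates C)" snd] card_length[of "gates C"]
      unfolding s_def by fastforce
    finally show ?thesis by simp
  qed
  have n1: "1 \<le> n\<^sup>2" using n4 by simp
  \<comment> \<open>\<open>2 * s + 1 \<le> 3 * n^2\<close>, the source of the polynomial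
    \<open>3 * n^2\<close> in the bounds.\<close>
  have Wn: "W \<le> 3 * n\<^sup>2" using W sn n1 by linarith
  have B: "bit_bound n W s \<le> B" unfolding B_def by (rule bit_bound_mono[OF Wn sn])
  have gate_ws: "fst (gates C ! g) \<in> set ws \<and> snd (gates C ! g) \<in> set ws" if "g < s" for g
    using gates_ws nth_mem[of g "gates C"] that by (auto simp: s_def case_prod_beta)
  have gate_neq: "fst (gates C ! g) \<noteq> snd (gates C ! g)" if "g < s" for g
  proof -
    have "\<forall>x\<in>set (gates C). fst x \<noteq> snd x" using C by (auto simp: comparator_circuit_def)
    then show ?thesis using that by (simp add: s_def)
  qed
  have var: "var_of (label C (ws ! w)) < n" if "w < W" for w
  proof -
    have "ws ! w \<in> wires C" using sub nth_mem[of w ws] that unfolding W_def by blast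
    then show ?thesis using C by (simp add: comparator_circuit_def)
  qed
  interpret layout n W s out code ga gb B
  proof
    show "0 < n" using n4 by simp
    show "code w < 2 * n" if "w < W" for w
      unfolding code_def by (rule encode_literal_less[OF var[OF that]])
    show "out < W" using position_nth(1)[OF out_ws] by (simp add: out_def W_def)
    show "ga g < W \<and> gb g < W \<and> ga g \<noteq> gb g" if "g < s" for g
      using position_nth gate_ws[OF that] gate_neq[OF that] unfolding ga_def gb_def W_def by metis
  qed (rule bit_bound_sufficient[OF B])+
  obtain R M where init: "init_state xs = (R, M)" by (cases "init_state xs")
  have M: "M i = (if i < length xs then xs ! i else 0)" and R: "R = (\<lambda>_. 0)" for i
    using init by (auto simp: init_state_def)
  note nth = encode_circuit_nth[where n = n and C = C and ws = ws, folded xs_def W_def s_def out_def]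
  have len: "length xs = VAL" by (simp add: nth(1) VAL_def)
  have im: "input_mem M"
    using nth(6-8) unfolding input_mem_def M len code_def ga_def gb_def by (auto simp: VAL_def)
  have M03: "M 0 = n" "M 1 = W" "M 2 = s" "M 3 = out"
    using nth(2-5) unfolding M len by (simp_all add: VAL_def)
  have tab: "M p = 0" if "VAL \<le> p" for p using that by (simp add: M len)
  have bnd: "bounded_state B (init_state xs)"
  proof -
    have "M p < 2 ^ B" for p
    proof -
      consider "p < 4" | "4 \<le> p" "p < 4 + W" | "4 + W \<le> p" "p < VAL" | "VAL \<le> p" by linarith
      then show ?thesis
      proof cases
        case 1
        then have "p = 0 \<or> p = 1 \<or> p = 2 \<or> p = 3" by auto
        then show ?thesis using M03 layout_bounds out_less by auto
      next
        case 2
        then obtain w where w: "p = 4 + w" "w < W" by (metis add_less_cancel_left le_Suc_ex)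
        then have "M p = code w" using im by (simp add: input_mem_def)
        then show ?thesis using code_less[OF w(2)] layout_bounds(7) by linarith
      next
        case 3
        define q where "q = p - (4 + W)"
        have q: "p = 4 + W + q" "q < 2 * s" using 3 by (auto simp: q_def VAL_def)
        define g where "g = q div 2"
        have g: "g < s" using q(2) by (auto simp: g_def)
        have "q = 2 * g \<or> q = 2 * g + 1" by (auto simp: g_def)
        then have "p = 4 + W + 2 * g \<or> p = 5 + W + 2 * g" using q(1) by auto
        then have "M p = ga g \<or> M p = gb g" using im g by (auto simp: input_mem_def)
        then show ?thesis using gates_less[OF g] layout_bounds(8) by auto
      qed (simp add: tab)
    qed
    then show ?thesis unfolding init by (simp add: bounded_state_def R)
  qed
  define Q where "Q = (\<lambda>k (R', M' :: nat \<Rightarrow> nat). \<exists>l a m. is_log l \<and> a < n \<and> 2 * m \<le> n \<and> good_block l a m \<and>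
    (\<forall>m' a'. 2 * m' \<le> n \<longrightarrow> a' < n \<longrightarrow> good_block l a' m' \<longrightarrow> m' \<le> m) \<and>
    k \<le> prepare_time + memo_time a m \<and> R' (0 :: nat) = (\<Sum>z<2 ^ (n - m). block_count a m z))"
  have "wp B count_sat_com Q (R, M)" unfolding Q_def by (rule wp_count_sat[OF im M03 tab])
  then obtain t S where tS: "brun B count_sat_com (R, M) t S" "Q t S" unfolding wp_def by blast
  obtain R' M' where S: "S = (R', M')" by (cases S)
  note r = tS(1)[unfolded S]
  obtain l a m where lm: "is_log l" "a < n" "2 * m \<le> n" "good_block l a m"
      "\<forall>m' a'. 2 * m' \<le> n \<longrightarrow> a' < n \<longrightarrow> good_block l a' m' \<longrightarrow> m' \<le> m"
    and t: "t \<le> prepare_time + memo_time a m" and res: "R' 0 = (\<Sum>z<2 ^ (n - m). block_count a m z)"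
    using tS(2) unfolding S Q_def prod.case by (elim exE conjE)
  \<comment> \<open>The program never sees \<open>k\<close>. A good block of length \<open>k\<close>
    exists by averaging, so the largest good length that it finds is at least
    \<open>k\<close>.\<close>
  have "k \<le> m"
  proof -
    obtain a' where a': "a' < n" "n * card (live a' k) \<le> W * k"
      using exists_sparse_block[of k] k4 by auto
    have "good_block l a' k"
      unfolding good_block_def
      by (rule sparse_block_good[OF n4 k(1) k4 sz W a'(2)]) (use lm(1) in \<open>simp add: is_log_def\<close>)
    then show ?thesis using lm(5) a'(1) k4 by auto
  qed
  then have "t \<le> 2 ^ (n - k) * poly_time"
    using t total_time_le[OF lm(1,4) n4 lm(3) _ k4] by linarith
  also have "\<dots> \<le> 2 ^ (n - k) * time_bound n (3 * n\<^sup>2) (n\<^sup>2)"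
    unfolding poly_time_eq by (intro mult_le_mono2 time_bound_mono Wn sn)
  finally have t: "t \<le> 2 ^ (n - k) * time_bound n (3 * n\<^sup>2) (n\<^sup>2)" .
  have "0 < B" using B_n by simp
  then obtain T where T: "run count_sat_com (init_state xs) T (R', M')" "T \<le> t * com_weight count_sat_com * B\<^sup>2"
    using run_of_brun[OF r[folded init] bnd] by blast
  have "t * com_weight count_sat_com * B\<^sup>2
      \<le> 2 ^ (n - k) * time_bound n (3 * n\<^sup>2) (n\<^sup>2) * com_weight count_sat_com * B\<^sup>2"
    by (intro mult_le_mono1 t)
  then have time: "T \<le> 2 ^ (n - k) * (time_bound n (3 * n\<^sup>2) (n\<^sup>2) * com_weight count_sat_com * B\<^sup>2)"
    using T(2) unfolding mult.assoc by (rule order_trans[rotated])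
  have gl: "gate_list s = map (map_prod (position ws) (position ws)) (gates C)"
    by (rule nth_equalityI) (auto simp: gate_list_def s_def ga_def gb_def map_prod_def split: prod.splits)
  have val: "circuit_out a X = circuit_val C (input_bits n a X)" for X
  proof -
    have "lit_fun a X w = lit_val (input_bits n a X) (label C (ws ! w))" if "w < W" for w
      using var[OF that] that
      by (cases "label C (ws ! w)")
        (auto simp: lit_fun_def lit_bit_def code_def bit_index_def input_bits_def mod_2_eq_odd)
    then have "fold apply_gate (gate_list s) (lit_fun a X) out =
        fold apply_gate (gates C) (\<lambda>w. lit_val (input_bits n a X) (label C w)) (ws ! out)"
      unfolding gl out_def W_def
      by (intro fold_apply_gate_positions[OF dist gates_ws] position_nth(1)[OF out_ws])
    then show ?thesis
      by (simp only: circuit_out_def circuit_val_def position_nth(2)[OF out_ws, folded out_def])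
  qed
  \<comment> \<open>The program counts numbers below \<open>2 ^ n\<close>; for the chosen rotation
    \<open>input_bits\<close> carries them bijectively to the inputs.\<close>
  have "num_sat n C = card (input_bits n a ` {X. X < 2 ^ n \<and> circuit_out a X})"
  proof -
    have "{x. length x = n \<and> circuit_val C x} = {x \<in> input_bits n a ` {..<2 ^ n}. circuit_val C x}"
      unfolding bij_betw_imp_surj_on[OF bij_betw_input_bits[OF n_pos, of a]] by simp
    also have "\<dots> = input_bits n a ` {X. X < 2 ^ n \<and> circuit_out a X}" unfolding val by auto
    finally have "{x. length x = n \<and> circuit_val C x} = input_bits n a ` {X. X < 2 ^ n \<and> circuit_out a X}" .
    then show ?thesis by (simp add: num_sat_def)
  qed
  also have "\<dots> = card {X. X < 2 ^ n \<and> circuit_out a X}"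
    by (rule card_image, rule inj_on_subset[OF bij_betw_imp_inj_on[OF bij_betw_input_bits[OF n_pos]]]) auto
  also have "\<dots> = R' 0" using res sum_block_count[of m a] lm(3) by simp
  finally have "num_sat n C = R' 0" .
  then show ?thesis
    unfolding computes_within_def xs_def[symmetric] B_def[symmetric] using T(1) time by auto
qed

theorem theorem2:
  shows "\<exists>(d::real) (A::com) (p::nat poly). d > 1 \<and>
    (\<forall>(n::nat) (k::nat) (C::circuit) (ws::nat list).
       1 \<le> k \<longrightarrow> real k \<le> real n / 4 \<longrightarrow>
       comparator_circuit n C \<longrightarrow>
       real (circuit_size C) \<le> real n powr (3/2) / (d * real k * sqrt (log 2 (real n))) \<longrightarrow>
       wire_listing C ws \<longrightarrow>
       computes_within A (encode_circuit n C ws) (num_sat n C) (2 ^ (n - k) * poly p n))"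
proof -
  have "poly_fun (\<lambda>n. time_bound n (3 * n\<^sup>2) (n\<^sup>2) * com_weight count_sat_com *
      (bit_bound n (3 * n\<^sup>2) (n\<^sup>2))\<^sup>2)"
    unfolding time_bound_def bit_bound_def by (intro poly_fun_intros)
  then obtain p :: "nat poly" where p: "poly p n = time_bound n (3 * n\<^sup>2) (n\<^sup>2) * com_weight count_sat_com *
      (bit_bound n (3 * n\<^sup>2) (n\<^sup>2))\<^sup>2" for n unfolding poly_fun_def by blast
  show ?thesis
    by (rule exI[of _ 16], rule exI[of _ count_sat_com], rule exI[of _ p])
      (auto simp: p intro!: count_sat_com_correct)
qed

end
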